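(* Let $F\in L^\infty(\mathbb T)$, and let $T_F$ be the Toeplitz operator with symbol $F$ on $H^2$. Suppose that $0$ does not belong to the interior $\mathrm{int}(W(T_F))$ of the numerical range $W(T_F)$ of $T_F$. Then $T_F$ is embeddable into a $C_0$-semigroup of operators on $H^2$.
   Context: $\mathbb T$ is the unit circle, $H^2$ the Hardy space of the unit disk with its usual (sesquilinear) inner product, $P_+$ the Riesz (orthogonal) projection of $L^2(\mathbb T)$ onto $H^2$, and $T_Ff=P_+(Ff)$. The numerical range of a bounded operator $T$ on a Hilbert space $H$ is $W(T)=\{\langle Tx,x\rangle: x\in H,\ \|x\|=1\}$; its interior is taken in $\mathbb C$. A $C_0$-semigroup on a Banach space $X$ is a family $(T_t)_{t>0}$ of bounded operators with $T_tT_s=T_{t+s}$ for $t,s>0$ and $\|T_tx-x\|\to0$ as $t\to0^+$ for every $x\in X$. $T$ is embeddable into a $C_0$-semigroup if there is a $C_0$-semigroup $(T_t)_{t>0}$ with $T_1=T$. *)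

theory Defs
  imports "HOL-Analysis.Analysis"
begin

section \<open>Complex normed spaces and complex inner product spaces\<close>

class scaleC =
  fixes scaleC :: "complex \<Rightarrow> 'a \<Rightarrow> 'a" (infixr \<open>*\<^sub>C\<close> 75)

class complex_normed_vector = real_normed_vector + scaleC +
  assumes scaleC_add_right: "c *\<^sub>C (x + y) = c *\<^sub>C x + c *\<^sub>C y"
    and scaleC_add_left: "(c + d) *\<^sub>C x = c *\<^sub>C x + d *\<^sub>C x"
    and scaleC_scaleC: "c *\<^sub>C (d *\<^sub>C x) = (c * d) *\<^sub>C x"
    and scaleC_of_real: "complex_of_real r *\<^sub>C x = r *\<^sub>R x"
    and norm_scaleC: "norm (c *\<^sub>C x) = cmod c * norm x"

text \<open>The inner product is linear in the first argument and conjugate-linear in the second;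
  its real part is the library's real inner product, so that
  \<open>norm x = sqrt (Re (cinner x x))\<close>.\<close>

class complex_inner = complex_normed_vector + real_inner +
  fixes cinner :: "'a \<Rightarrow> 'a \<Rightarrow> complex"
  assumes cinner_commute: "cinner x y = cnj (cinner y x)"
    and cinner_add_left: "cinner (x + y) z = cinner x z + cinner y z"
    and cinner_scaleC_left: "cinner (c *\<^sub>C x) y = c * cinner x y"
    and Re_cinner: "Re (cinner x y) = inner x y"


section \<open>Bounded operators, numerical range, semigroups\<close>

definition bounded_clinear ::
    "('a::complex_normed_vector \<Rightarrow> 'b::complex_normed_vector) \<Rightarrow> bool" where
  "bounded_clinear T \<longleftrightarrow> bounded_linear T \<and> (\<forall>c x. T (c *\<^sub>C x) = c *\<^sub>C T x)"

definition numerical_range :: "('a::complex_inner \<Rightarrow> 'a) \<Rightarrow> complex set" where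
  "numerical_range T = {cinner (T x) x | x. norm x = 1}"

text \<open>A semigroup is indexed by the strictly positive reals; the values of \<open>T\<close> at
  nonpositive reals are irrelevant.\<close>

definition C0_semigroup :: "(real \<Rightarrow> 'a::complex_normed_vector \<Rightarrow> 'a) \<Rightarrow> bool" where
  "C0_semigroup T \<longleftrightarrow>
     (\<forall>t>0. bounded_clinear (T t)) \<and>
     (\<forall>t>0. \<forall>s>0. T t \<circ> T s = T (t + s)) \<and>
     (\<forall>x. ((\<lambda>t. norm (T t x - x)) \<longlongrightarrow> 0) (at_right 0))"

definition C0_embeddable :: "('a::complex_normed_vector \<Rightarrow> 'a) \<Rightarrow> bool" where
  "C0_embeddable S \<longleftrightarrow> (\<exists>T. C0_semigroup T \<and> T 1 = S)"


section \<open>Lebesgue spaces on the unit circle\<close>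

text \<open>Normalised arc length, as a Borel measure on the plane carried by the unit circle.
  Functions on the circle are represented by Borel functions on the plane, whose values off
  the circle do not matter.\<close>

definition circle_measure :: "complex measure" where
  "circle_measure = distr (uniform_measure lborel {0..2 * pi}) borel cis"

definition circle_Linf :: "(complex \<Rightarrow> complex) set" where
  "circle_Linf = {F \<in> borel_measurable circle_measure.
     \<exists>C. AE z in circle_measure. cmod (F z) \<le> C}"

definition circle_sqint :: "(complex \<Rightarrow> complex) set" where
  "circle_sqint = {f \<in> borel_measurable circle_measure.
     integrable circle_measure (\<lambda>z. (cmod (f z))\<^sup>2)}"

lemma borel_measurable_cnj [measurable (raw)]:
  "f \<in> borel_measurable M \<Longrightarrow> (\<lambda>z. cnj (f z)) \<in> borel_measurable M"
  by (rule borel_measurable_continuous_on[of cnj]) (auto intro: continuous_intros)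

lemma cis_borel_measurable: "cis \<in> borel_measurable (uniform_measure lborel A)"
proof -
  have "cis \<in> borel_measurable borel"
    by (intro borel_measurable_continuous_onI continuous_intros)
  then show ?thesis
    by (simp add: uniform_measure_def)
qed

lemma powi_borel_measurable: "(\<lambda>z::complex. z powi n) \<in> borel_measurable circle_measure"
proof -
  have "(\<lambda>z::complex. z powi n) \<in> borel_measurable borel"
    by (cases "0 \<le> n") (auto simp: power_int_def)
  then show ?thesis
    by (simp add: circle_measure_def)
qed

lemma circle_sqint_zero: "(\<lambda>_. 0) \<in> circle_sqint"
  by (simp add: circle_sqint_def)

lemma circle_sqint_scale:
  assumes "f \<in> circle_sqint"
  shows "(\<lambda>z. c * f z) \<in> circle_sqint"
  using assms by (auto simp: circle_sqint_def norm_mult power_mult_distrib)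

lemma cmod_add_square_le: "(cmod (a + b))\<^sup>2 \<le> 2 * (cmod a)\<^sup>2 + 2 * (cmod b)\<^sup>2"
proof -
  have "(cmod (a + b))\<^sup>2 \<le> (cmod a + cmod b)\<^sup>2"
    by (intro power_mono norm_triangle_ineq) auto
  also have "\<dots> \<le> 2 * (cmod a)\<^sup>2 + 2 * (cmod b)\<^sup>2"
    using zero_le_power2[of "cmod a - cmod b"] by (simp add: power2_eq_square algebra_simps)
  finally show ?thesis .
qed

lemma circle_sqint_add:
  assumes "f \<in> circle_sqint" "g \<in> circle_sqint"
  shows "(\<lambda>z. f z + g z) \<in> circle_sqint"
proof -
  have m: "f \<in> borel_measurable circle_measure" "g \<in> borel_measurable circle_measure"
    and i: "integrable circle_measure (\<lambda>z. 2 * (cmod (f z))\<^sup>2 + 2 * (cmod (g z))\<^sup>2)"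
    using assms by (auto simp: circle_sqint_def)
  have "integrable circle_measure (\<lambda>z. (cmod (f z + g z))\<^sup>2)"
    by (rule Bochner_Integration.integrable_bound[OF i]) (use m cmod_add_square_le in auto)
  with m show ?thesis by (simp add: circle_sqint_def)
qed

lemma circle_sqint_minus:
  assumes "f \<in> circle_sqint"
  shows "(\<lambda>z. - f z) \<in> circle_sqint"
  using circle_sqint_scale[OF assms, of "-1"] by simp

lemma circle_sqint_diff:
  assumes "f \<in> circle_sqint" "g \<in> circle_sqint"
  shows "(\<lambda>z. f z - g z) \<in> circle_sqint"
  using circle_sqint_add[OF assms(1) circle_sqint_minus[OF assms(2)]] by simp

lemma circle_sqint_mult:
  assumes "F \<in> circle_Linf" "f \<in> circle_sqint"
  shows "(\<lambda>z. F z * f z) \<in> circle_sqint"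
proof -
  from assms obtain C where C: "AE z in circle_measure. cmod (F z) \<le> C"
    and m: "F \<in> borel_measurable circle_measure" "f \<in> borel_measurable circle_measure"
    and i: "integrable circle_measure (\<lambda>z. C\<^sup>2 * (cmod (f z))\<^sup>2)"
    by (auto simp: circle_sqint_def circle_Linf_def)
  have "AE z in circle_measure. norm ((cmod (F z * f z))\<^sup>2) \<le> norm (C\<^sup>2 * (cmod (f z))\<^sup>2)"
    using C by eventually_elim (auto simp: norm_mult power_mult_distrib intro!: mult_right_mono power_mono)
  then have "integrable circle_measure (\<lambda>z. (cmod (F z * f z))\<^sup>2)"
    by (intro Bochner_Integration.integrable_bound[OF i]) (use m in auto)
  with m show ?thesis by (simp add: circle_sqint_def)
qed

lemma circle_sqint_integrable:
  assumes "f \<in> circle_sqint" "g \<in> circle_sqint"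
  shows "integrable circle_measure (\<lambda>z. f z * cnj (g z))"
proof -
  have m: "f \<in> borel_measurable circle_measure" "g \<in> borel_measurable circle_measure"
    and i: "integrable circle_measure (\<lambda>z. (cmod (f z))\<^sup>2 + (cmod (g z))\<^sup>2)"
    using assms by (auto simp: circle_sqint_def)
  have "cmod a * cmod b \<le> (cmod a)\<^sup>2 + (cmod b)\<^sup>2" for a b :: complex
    using sum_squares_bound[of "cmod a" "cmod b"] mult_nonneg_nonneg[OF norm_ge_zero norm_ge_zero, of a b]
    by linarith
  then show ?thesis
    by (intro Bochner_Integration.integrable_bound[OF i]) (use m in \<open>auto simp: norm_mult\<close>)
qed

quotient_type circle_L2 = "complex \<Rightarrow> complex" / partial:
  "\<lambda>f g. f \<in> circle_sqint \<and> g \<in> circle_sqint \<and> (AE z in circle_measure. f z = g z)"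
proof (rule part_equivpI)
  show "\<exists>f. f \<in> circle_sqint \<and> f \<in> circle_sqint \<and> (AE z in circle_measure. f z = f z)"
    using circle_sqint_zero by auto
  show "symp (\<lambda>f g. f \<in> circle_sqint \<and> g \<in> circle_sqint \<and> (AE z in circle_measure. f z = g z))"
    by (auto intro!: sympI elim: eventually_mono)
  show "transp (\<lambda>f g. f \<in> circle_sqint \<and> g \<in> circle_sqint \<and> (AE z in circle_measure. f z = g z))"
    by (intro transpI) auto
qed

instantiation circle_L2 :: real_vector
begin

lift_definition zero_circle_L2 :: circle_L2 is "\<lambda>_. 0"
  by (simp add: circle_sqint_zero)

lift_definition plus_circle_L2 :: "circle_L2 \<Rightarrow> circle_L2 \<Rightarrow> circle_L2" is "\<lambda>f g z. f z + g z"
  by (auto intro: circle_sqint_add)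

lift_definition minus_circle_L2 :: "circle_L2 \<Rightarrow> circle_L2 \<Rightarrow> circle_L2" is "\<lambda>f g z. f z - g z"
  by (auto intro: circle_sqint_diff)

lift_definition uminus_circle_L2 :: "circle_L2 \<Rightarrow> circle_L2" is "\<lambda>f z. - f z"
  by (auto intro: circle_sqint_minus)

lift_definition scaleR_circle_L2 :: "real \<Rightarrow> circle_L2 \<Rightarrow> circle_L2" is
  "\<lambda>r f z. complex_of_real r * f z"
  by (auto intro: circle_sqint_scale)

instance
proof
  fix f g h :: circle_L2 and r s :: real
  show "f + g + h = f + (g + h)"
    by transfer (auto simp: algebra_simps intro!: circle_sqint_add)
  show "f + g = g + f"
    by transfer (auto simp: algebra_simps intro!: circle_sqint_add)
  show "0 + f = f"
    by transfer auto
  show "- f + f = 0"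
    by transfer (auto intro: circle_sqint_zero)
  show "f - g = f + - g"
    by transfer (auto intro: circle_sqint_diff)
  show "r *\<^sub>R (f + g) = r *\<^sub>R f + r *\<^sub>R g"
    by transfer (auto simp: distrib_left distrib_right intro!: circle_sqint_add circle_sqint_scale)
  show "(r + s) *\<^sub>R f = r *\<^sub>R f + s *\<^sub>R f"
    by transfer (auto simp: distrib_left distrib_right intro!: circle_sqint_add circle_sqint_scale)
  show "r *\<^sub>R s *\<^sub>R f = (r * s) *\<^sub>R f"
    by transfer (auto simp: mult.assoc intro!: circle_sqint_scale)
  show "1 *\<^sub>R f = f"
    by transfer auto
qed

end

lift_definition circle_cinner :: "circle_L2 \<Rightarrow> circle_L2 \<Rightarrow> complex" is
  "\<lambda>f g. LINT z|circle_measure. f z * cnj (g z)"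
proof goal_cases
  case (1 f f' g g')
  then have [measurable]: "f \<in> borel_measurable circle_measure" "f' \<in> borel_measurable circle_measure"
      "g \<in> borel_measurable circle_measure" "g' \<in> borel_measurable circle_measure"
    by (auto simp: circle_sqint_def)
  from 1 have "AE z in circle_measure. f z = f' z" "AE z in circle_measure. g z = g' z"
    by auto
  then have "AE z in circle_measure. f z * cnj (g z) = f' z * cnj (g' z)"
    by eventually_elim simp
  then show ?case
    by (intro integral_cong_AE) measurable
qed

lemma circle_cinner_commute: "circle_cinner f g = cnj (circle_cinner g f)"
  by transfer (simp flip: Bochner_Integration.integral_cnj add: mult.commute)

lemma circle_cinner_add_left: "circle_cinner (f + g) h = circle_cinner f h + circle_cinner g h"
  by transfer (simp add: distrib_right circle_sqint_integrable)

lemma circle_cinner_self: "0 \<le> Re (circle_cinner f f) \<and> (Re (circle_cinner f f) = 0 \<longleftrightarrow> f = 0)"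
proof (transfer, goal_cases)
  case (1 f)
  then have f: "f \<in> circle_sqint" by simp
  have eq: "(LINT z|circle_measure. f z * cnj (f z)) =
      complex_of_real (LINT z|circle_measure. (cmod (f z))\<^sup>2)"
    by (simp only: complex_norm_square[symmetric] integral_complex_of_real)
  have "(LINT z|circle_measure. (cmod (f z))\<^sup>2) = 0 \<longleftrightarrow>
      (AE z in circle_measure. (cmod (f z))\<^sup>2 = 0)"
    using f by (intro integral_nonneg_eq_0_iff_AE) (auto simp: circle_sqint_def)
  then show ?case
    using f unfolding eq by (auto simp: circle_sqint_zero)
qed

instantiation circle_L2 :: real_inner
begin

definition "inner f g = Re (circle_cinner f g)"
definition "norm (f :: circle_L2) = sqrt (inner f f)"
definition "dist f g = norm (f - g :: circle_L2)"
definition "sgn (f :: circle_L2) = inverse (norm f) *\<^sub>R f"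
definition "(uniformity :: (circle_L2 \<times> circle_L2) filter) =
  (INF e\<in>{0 <..}. principal {(x, y). dist x y < e})"
definition "open (U :: circle_L2 set) \<longleftrightarrow>
  (\<forall>x\<in>U. \<forall>\<^sub>F (x', y) in uniformity. x' = x \<longrightarrow> y \<in> U)"

instance
proof
  fix f g h :: circle_L2 and r :: real
  show "inner f g = inner g f"
    unfolding inner_circle_L2_def by (subst circle_cinner_commute) simp
  show "inner (f + g) h = inner f h + inner g h"
    by (simp add: inner_circle_L2_def circle_cinner_add_left)
  show "inner (r *\<^sub>R f) g = r * inner f g"
    unfolding inner_circle_L2_def by transfer (simp add: mult.assoc)
  show "0 \<le> inner f f" "inner f f = 0 \<longleftrightarrow> f = 0"
    unfolding inner_circle_L2_def using circle_cinner_self by auto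
qed (simp_all only: norm_circle_L2_def dist_circle_L2_def sgn_circle_L2_def
      uniformity_circle_L2_def open_circle_L2_def)

end

instantiation circle_L2 :: complex_inner
begin

lift_definition scaleC_circle_L2 :: "complex \<Rightarrow> circle_L2 \<Rightarrow> circle_L2" is "\<lambda>c f z. c * f z"
  by (auto intro: circle_sqint_scale)

definition cinner_circle_L2 :: "circle_L2 \<Rightarrow> circle_L2 \<Rightarrow> complex" where
  "cinner_circle_L2 = circle_cinner"

instance
proof
  fix f g h :: circle_L2 and c d :: complex and r :: real
  show "c *\<^sub>C (f + g) = c *\<^sub>C f + c *\<^sub>C g"
    by transfer (auto simp: distrib_left distrib_right intro!: circle_sqint_add circle_sqint_scale)
  show "(c + d) *\<^sub>C f = c *\<^sub>C f + d *\<^sub>C f"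
    by transfer (auto simp: distrib_left distrib_right intro!: circle_sqint_add circle_sqint_scale)
  show "c *\<^sub>C (d *\<^sub>C f) = (c * d) *\<^sub>C f"
    by transfer (auto simp: mult.assoc intro!: circle_sqint_scale)
  show "complex_of_real r *\<^sub>C f = r *\<^sub>R f"
    by transfer (auto intro: circle_sqint_scale)
  show "cinner f g = cnj (cinner g f)"
    unfolding cinner_circle_L2_def by (rule circle_cinner_commute)
  show "cinner (f + g) h = cinner f h + cinner g h"
    unfolding cinner_circle_L2_def by (rule circle_cinner_add_left)
  show scale: "cinner (c *\<^sub>C f) g = c * cinner f g" for c and f g :: circle_L2
    unfolding cinner_circle_L2_def by transfer (simp add: mult.assoc)
  show re: "Re (cinner f g) = inner f g" for f g :: circle_L2
    by (simp add: cinner_circle_L2_def inner_circle_L2_def)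
  have comm: "cinner f g = cnj (cinner g f)" for f g :: circle_L2
    unfolding cinner_circle_L2_def by (rule circle_cinner_commute)
  have "cinner (c *\<^sub>C f) (c *\<^sub>C f) = c * cnj c * cinner f f"
    by (metis comm scale complex_cnj_mult mult.assoc)
  then have "inner (c *\<^sub>C f) (c *\<^sub>C f) = (cmod c)\<^sup>2 * inner f f"
    unfolding re[symmetric] complex_norm_square[symmetric] by simp
  then show "norm (c *\<^sub>C f) = cmod c * norm f"
    by (simp add: norm_eq_sqrt_inner real_sqrt_mult)
qed

end

text \<open>Multiplication by an essentially bounded symbol; the value for other symbols is a dummy.\<close>

lift_definition circle_mult :: "(complex \<Rightarrow> complex) \<Rightarrow> circle_L2 \<Rightarrow> circle_L2" is
  "\<lambda>F f. if F \<in> circle_Linf then (\<lambda>z. F z * f z) else (\<lambda>_. 0)"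
  by (auto intro: circle_sqint_mult circle_sqint_zero)

lift_definition fourier_coeff :: "circle_L2 \<Rightarrow> int \<Rightarrow> complex" is
  "\<lambda>f n. LINT z|circle_measure. f z * cnj (z powi n)"
proof (rule ext, goal_cases)
  case (1 f g n)
  then have [measurable]: "f \<in> borel_measurable circle_measure" "g \<in> borel_measurable circle_measure"
    by (auto simp: circle_sqint_def)
  note [measurable] = powi_borel_measurable[of n]
  have "AE z in circle_measure. f z = g z"
    using 1 by auto
  then show ?case
    by (intro integral_cong_AE) (measurable, auto elim: eventually_mono)
qed


section \<open>The Hardy space and Toeplitz operators\<close>

lemma circle_sqint_powi: "(\<lambda>z. z powi n) \<in> circle_sqint"
proof -
  note [measurable] = powi_borel_measurable[of n] cis_borel_measurable
  have "finite_measure (uniform_measure lborel {0..2 * pi})"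
    by (rule finite_measureI) (simp add: emeasure_uniform_measure_1)
  then have "finite_measure circle_measure"
    unfolding circle_measure_def
    by (rule finite_measure.finite_measure_distr) (rule cis_borel_measurable)
  moreover have "AE z in circle_measure. cmod (z powi n) = 1"
    unfolding circle_measure_def
  proof (subst AE_distr_iff)
    have "(\<lambda>z. cmod (z powi n)) \<in> borel_measurable borel"
      using powi_borel_measurable[of n] by (simp add: circle_measure_def)
    then show "{z \<in> space borel. cmod (z powi n) = 1} \<in> sets borel"
      by measurable
  qed (use cis_borel_measurable in \<open>auto simp: norm_power_int\<close>)
  ultimately have "integrable circle_measure (\<lambda>z. (cmod (z powi n))\<^sup>2)"
    by (intro finite_measure.integrable_const_bound[where B = 1])
      (auto elim: eventually_mono)
  then show ?thesis
    by (simp add: circle_sqint_def)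
qed

lemma fourier_coeff_zero: "fourier_coeff 0 n = 0"
  by transfer simp

lemma fourier_coeff_add: "fourier_coeff (f + g) n = fourier_coeff f n + fourier_coeff g n"
  by transfer (simp add: distrib_right circle_sqint_integrable circle_sqint_powi del: complex_cnj_power_int)

lemma fourier_coeff_scaleC: "fourier_coeff (c *\<^sub>C f) n = c * fourier_coeff f n"
  by transfer (simp add: mult.assoc)

lemma fourier_coeff_scaleR: "fourier_coeff (r *\<^sub>R f) n = complex_of_real r * fourier_coeff f n"
  by (simp flip: scaleC_of_real add: fourier_coeff_scaleC)

lemma fourier_coeff_minus: "fourier_coeff (- f) n = - fourier_coeff f n"
  using fourier_coeff_scaleR[of "-1" f n] by simp

lemma fourier_coeff_diff: "fourier_coeff (f - g) n = fourier_coeff f n - fourier_coeff g n"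
  using fourier_coeff_add[of f "- g" n] by (simp add: fourier_coeff_minus)

text \<open>The Hardy space of the disk is identified, through boundary values, with the closed subspace
  of \<open>L\<^sup>2\<close> of the circle given by vanishing Fourier coefficients of negative index.\<close>

typedef hardy2 = "{f :: circle_L2. \<forall>n<0. fourier_coeff f n = 0}"
  morphisms hardy2_to_L2 Abs_hardy2
  by (rule exI[of _ 0]) (simp add: fourier_coeff_zero)

setup_lifting type_definition_hardy2

instantiation hardy2 :: complex_inner
begin

lift_definition zero_hardy2 :: hardy2 is 0
  by (simp add: fourier_coeff_zero)

lift_definition plus_hardy2 :: "hardy2 \<Rightarrow> hardy2 \<Rightarrow> hardy2" is "(+)"
  by (simp add: fourier_coeff_add)

lift_definition minus_hardy2 :: "hardy2 \<Rightarrow> hardy2 \<Rightarrow> hardy2" is "(-)"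
  by (simp add: fourier_coeff_diff)

lift_definition uminus_hardy2 :: "hardy2 \<Rightarrow> hardy2" is uminus
  by (simp add: fourier_coeff_minus)

lift_definition scaleR_hardy2 :: "real \<Rightarrow> hardy2 \<Rightarrow> hardy2" is scaleR
  by (simp add: fourier_coeff_scaleR)

lift_definition scaleC_hardy2 :: "complex \<Rightarrow> hardy2 \<Rightarrow> hardy2" is scaleC
  by (simp add: fourier_coeff_scaleC)

lift_definition inner_hardy2 :: "hardy2 \<Rightarrow> hardy2 \<Rightarrow> real" is inner .
lift_definition cinner_hardy2 :: "hardy2 \<Rightarrow> hardy2 \<Rightarrow> complex" is cinner .
lift_definition norm_hardy2 :: "hardy2 \<Rightarrow> real" is norm .

definition "dist f g = norm (f - g :: hardy2)"
definition "sgn (f :: hardy2) = inverse (norm f) *\<^sub>R f"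
definition "(uniformity :: (hardy2 \<times> hardy2) filter) =
  (INF e\<in>{0 <..}. principal {(x, y). dist x y < e})"
definition "open (U :: hardy2 set) \<longleftrightarrow>
  (\<forall>x\<in>U. \<forall>\<^sub>F (x', y) in uniformity. x' = x \<longrightarrow> y \<in> U)"

instance
proof
  fix f g h :: hardy2 and c d :: complex and r s :: real
  show "f + g + h = f + (g + h)"
    by transfer (simp add: add.assoc)
  show "f + g = g + f"
    by transfer (simp add: add.commute)
  show "0 + f = f"
    by transfer (simp)
  show "- f + f = 0"
    by transfer (simp)
  show "f - g = f + - g"
    by transfer (simp)
  show "r *\<^sub>R (f + g) = r *\<^sub>R f + r *\<^sub>R g"
    by transfer (rule scaleR_add_right)
  show "(r + s) *\<^sub>R f = r *\<^sub>R f + s *\<^sub>R f"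
    by transfer (rule scaleR_add_left)
  show "r *\<^sub>R s *\<^sub>R f = (r * s) *\<^sub>R f"
    by transfer (simp)
  show "1 *\<^sub>R f = f"
    by transfer (simp)
  show "c *\<^sub>C (f + g) = c *\<^sub>C f + c *\<^sub>C g"
    by transfer (rule scaleC_add_right)
  show "(c + d) *\<^sub>C f = c *\<^sub>C f + d *\<^sub>C f"
    by transfer (rule scaleC_add_left)
  show "c *\<^sub>C (d *\<^sub>C f) = (c * d) *\<^sub>C f"
    by transfer (rule scaleC_scaleC)
  show "complex_of_real r *\<^sub>C f = r *\<^sub>R f"
    by transfer (rule scaleC_of_real)
  show "norm (c *\<^sub>C f) = cmod c * norm f"
    by transfer (rule norm_scaleC)
  show "norm f = 0 \<longleftrightarrow> f = 0"
    by transfer (simp)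
  show "norm (f + g) \<le> norm f + norm g"
    by transfer (rule norm_triangle_ineq)
  show "norm (r *\<^sub>R f) = \<bar>r\<bar> * norm f"
    by transfer (simp)
  show "inner f g = inner g f"
    by transfer (rule inner_commute)
  show "inner (f + g) h = inner f h + inner g h"
    by transfer (rule inner_add_left)
  show "inner (r *\<^sub>R f) g = r * inner f g"
    by transfer (simp)
  show "0 \<le> inner f f"
    by transfer (simp)
  show "inner f f = 0 \<longleftrightarrow> f = 0"
    by transfer (simp)
  show "norm f = sqrt (inner f f)"
    by transfer (rule norm_eq_sqrt_inner)
  show "cinner f g = cnj (cinner g f)"
    by transfer (rule cinner_commute)
  show "cinner (f + g) h = cinner f h + cinner g h"
    by transfer (rule cinner_add_left)
  show "cinner (c *\<^sub>C f) g = c * cinner f g"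
    by transfer (rule cinner_scaleC_left)
  show "Re (cinner f g) = inner f g"
    by transfer (rule Re_cinner)
qed (simp_all only: dist_hardy2_def sgn_hardy2_def uniformity_hardy2_def open_hardy2_def)

end

text \<open>The orthogonal projection of \<^term>\<open>g\<close> onto the Hardy space is the unique element of that
  space whose difference from \<^term>\<open>g\<close> is orthogonal to the whole space.\<close>

definition riesz_proj :: "circle_L2 \<Rightarrow> hardy2" where
  "riesz_proj g = (THE h. \<forall>k. cinner (g - hardy2_to_L2 h) (hardy2_to_L2 k) = 0)"

definition toeplitz :: "(complex \<Rightarrow> complex) \<Rightarrow> hardy2 \<Rightarrow> hardy2" where
  "toeplitz F f = riesz_proj (circle_mult F (hardy2_to_L2 f))"

end

theory Submission
  imports Defs
begin

text \<open>The numerical range \<open>W\<close> of \<open>T = T\<^sub>F\<close> is convex (\<open>convex_numerical_range\<close>), so if \<open>0\<close> is not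
  an interior point of \<open>W\<close>, then \<open>W\<close> lies in a closed half-plane with \<open>0\<close> on its boundary
  (\<open>convex_in_half_plane\<close>). Hence there is a unimodular \<open>c = e^(i\<theta>)\<close> for which \<open>A = c T\<close> is accretive,
  that is, \<open>Re \<langle>A x, x\<rangle> \<ge> 0\<close> for all \<open>x\<close>. A semigroup through \<open>A\<close>, multiplied by \<open>e^(-i\<theta>t)\<close>, is a semigroup
  through \<open>T\<close> (\<open>C0_embeddable_unimodular\<close>). There are two cases.

  If \<open>F\<close> is not almost everywhere zero, the semigroup consists of the fractional powers of \<open>A\<close>. For an
  accretive \<open>A\<close> the operators \<open>R = (1 + A)^(-1)\<close> and \<open>B = A R = 1 - R\<close> are contractions, and \<open>A = B R^(-1)\<close>.
  Powers of \<open>B = 1 - R\<close> and of \<open>R = 1 - B\<close> with exponent \<open>t \<ge> 0\<close> are given by the binomial series, which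
  converges absolutely on contractions; the law of exponents is Vandermonde's identity. Since \<open>R\<close> is
  invertible, \<open>A\<^sup>t = B\<^sup>t R^(n-t) (1 + A)\<^sup>n\<close> with any integer \<open>n \<ge> t\<close>. As \<open>t\<close> tends to \<open>0\<close>, the operators
  \<open>A\<^sup>t B\<close> tend to \<open>B\<close> in norm and \<open>A\<^sup>t\<close> stays bounded, so \<open>A\<^sup>t\<close> tends to the identity strongly on the
  closure of the range of \<open>A\<close> (\<open>accretive_C0_embeddable\<close>).

  The range of \<open>A\<close> is dense: by accretivity, an \<open>f\<close> orthogonal to it satisfies \<open>A f = 0\<close>, so \<open>f\<close> lies in
  the kernels of \<open>T\<close> and of its adjoint. Testing both against the functions \<open>z\<^sup>n f\<close> shows that all Fourier
  coefficients of \<open>F |f|\<^sup>2\<close> vanish, whence \<open>F f = 0\<close> (\<open>symbol_times_common_kernel\<close>). The functions in the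
  Hardy space annihilated by \<open>F\<close> form a closed subspace that is stable under multiplication by \<open>z\<close>, and
  under division by \<open>z\<close> whenever the quotient stays in the Hardy space. If it is not trivial, it contains
  some \<open>\<phi> \<noteq> 0\<close> orthogonal to all its elements that vanish at the origin. Then \<open>\<phi>\<close> is orthogonal to
  \<open>z\<^sup>n \<phi>\<close> for \<open>n \<ge> 1\<close>, so \<open>|\<phi>|\<close> is a nonzero constant on the circle and \<open>F = 0\<close>
  (\<open>hardy_multiplier_kernel\<close>).

  If \<open>F = 0\<close> almost everywhere, then \<open>T = 0\<close>, and a semigroup that vanishes at time \<open>1\<close> is needed. On
  \<open>L\<^sup>2\<close> of the circle, cut open at the point \<open>1\<close>, there is the nilpotent shift: rotate by \<open>2 \<pi> t\<close> and drop
  what crosses the cut. Orthonormal bases identify \<open>L\<^sup>2\<close> of the circle with the Hardy space and carry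
  the shift over (\<open>zero_C0_embeddable\<close>).

  Underlying all this are the completeness of \<open>L\<^sup>2\<close> of the circle and the fact that an integrable
  function is determined by its Fourier coefficients (\<open>vanishing_coeffs_AE_zero\<close>).\<close>

section \<open>Orthogonal projection in real Hilbert spaces\<close>

text \<open>A minimizing sequence for the distance from \<open>x\<close> to \<open>S\<close> is Cauchy by the parallelogram law. Its limit
  \<open>y\<close> attains the distance, and a first-order variation of \<open>y\<close> inside \<open>S\<close> shows that \<open>x - y\<close> is orthogonal to
  \<open>S\<close>.\<close>

lemma closed_subspace_projection:
  fixes S :: "'a::{real_inner,complete_space} set"
  assumes S: "subspace S" "closed S"
  shows "\<exists>y\<in>S. \<forall>z\<in>S. inner (x - y) z = 0"
proof -
  define d where "d = (INF y\<in>S. (norm (x - y))\<^sup>2)"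
  have ne: "S \<noteq> {}" using subspace_0[OF S(1)] by auto
  have bdd: "bdd_below ((\<lambda>y. (norm (x - y))\<^sup>2) ` S)" by (rule bdd_belowI[of _ 0]) auto
  have d_le: "d \<le> (norm (x - y))\<^sup>2" if "y \<in> S" for y
    unfolding d_def by (rule cINF_lower[OF bdd that])
  have "\<exists>y\<in>S. (norm (x - y))\<^sup>2 < d + inverse (real (Suc n))" for n
    using cINF_less_iff[OF ne bdd, of "d + inverse (real (Suc n))"] unfolding d_def[symmetric]
    by (simp add: of_nat_0_less_iff del: of_nat_Suc)
  then obtain u where u: "\<And>n. u n \<in> S" "\<And>n. (norm (x - u n))\<^sup>2 < d + inverse (real (Suc n))"
    by metis
  \<comment> \<open>Parallelogram law: the midpoint of \<open>u m\<close> and \<open>u n\<close> lies in \<open>S\<close>, so its squared distance from \<open>x\<close> is at least \<open>d\<close>.\<close>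
  have near: "(norm (u m - u n))\<^sup>2 \<le> 2 * (inverse (real (Suc m)) + inverse (real (Suc n)))" for m n
  proof -
    have "(1/2) *\<^sub>R (u m + u n) \<in> S"
      using S(1) u(1) by (intro subspace_scale subspace_add)
    then have 1: "d \<le> (norm (x - (1/2) *\<^sub>R (u m + u n)))\<^sup>2" by (rule d_le)
    have "(norm (u m - u n))\<^sup>2 =
        2 * (norm (x - u m))\<^sup>2 + 2 * (norm (x - u n))\<^sup>2 - 4 * (norm (x - (1/2) *\<^sub>R (u m + u n)))\<^sup>2"
      by (simp add: power2_norm_eq_inner inner_diff_left inner_diff_right inner_add_left
          inner_add_right inner_commute algebra_simps)
    with 1 u(2)[of m] u(2)[of n] show ?thesis by (simp add: algebra_simps)
  qed
  have "Cauchy u"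
  proof (rule metric_CauchyI)
    fix e :: real assume e: "0 < e"
    obtain N where N: "inverse (real (Suc N)) < e\<^sup>2 / 4"
      using reals_Archimedean[of "e\<^sup>2 / 4"] e by auto
    show "\<exists>M. \<forall>m\<ge>M. \<forall>n\<ge>M. dist (u m) (u n) < e"
    proof (intro exI allI impI)
      fix m n assume "N \<le> m" "N \<le> n"
      then have "inverse (real (Suc m)) \<le> inverse (real (Suc N))"
          "inverse (real (Suc n)) \<le> inverse (real (Suc N))"
        by (auto intro!: le_imp_inverse_le)
      then have "(norm (u m - u n))\<^sup>2 < e\<^sup>2" using near[of m n] N by argo
      then show "dist (u m) (u n) < e" using e by (simp add: dist_norm power2_less_imp_less)
    qed
  qed
  then obtain y where y: "u \<longlonglongrightarrow> y" using Cauchy_convergent_iff convergent_def by blast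
  have yS: "y \<in> S" using closed_sequentially[OF S(2) u(1) y] .
  have "(norm (x - y))\<^sup>2 \<le> d"
  proof (rule LIMSEQ_le)
    show "(\<lambda>n. (norm (x - u n))\<^sup>2) \<longlonglongrightarrow> (norm (x - y))\<^sup>2" by (intro tendsto_intros y)
    show "(\<lambda>n. d + inverse (real (Suc n))) \<longlonglongrightarrow> d"
      by (rule LIMSEQ_inverse_real_of_nat_add)
    show "\<exists>N. \<forall>n\<ge>N. (norm (x - u n))\<^sup>2 \<le> d + inverse (real (Suc n))"
      using u(2) less_imp_le by blast
  qed
  then have min: "(norm (x - y))\<^sup>2 \<le> (norm (x - w))\<^sup>2" if "w \<in> S" for w
    using d_le[OF that] by linarith
  have "inner (x - y) z = 0" if z: "z \<in> S" for z
  proof (cases "z = 0")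
    case False
    \<comment> \<open>The minimizer of the distance from \<open>x\<close> along the line \<open>y + t z\<close>.\<close>
    define t where "t = inner (x - y) z / (norm z)\<^sup>2"
    have "y + t *\<^sub>R z \<in> S" using S(1) yS z by (intro subspace_add subspace_scale)
    then have "(norm (x - y))\<^sup>2 \<le> (norm ((x - y) - t *\<^sub>R z))\<^sup>2"
      unfolding diff_diff_eq by (rule min)
    also have "(norm ((x - y) - t *\<^sub>R z))\<^sup>2
        = (norm (x - y))\<^sup>2 + t\<^sup>2 * (norm z)\<^sup>2 - 2 * t * inner (x - y) z"
      using dot_norm_neg[of "x - y" "t *\<^sub>R z"] by (simp add: power_mult_distrib)
    finally have "0 \<le> t\<^sup>2 * (norm z)\<^sup>2 - 2 * t * inner (x - y) z" by simp
    also have "\<dots> = - (inner (x - y) z)\<^sup>2 / (norm z)\<^sup>2"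
      using False by (simp add: t_def power2_eq_square field_simps)
    finally show ?thesis using False by (simp add: divide_le_0_iff)
  qed simp
  with yS show ?thesis by blast
qed

lemma closed_subspace_eq_UNIV:
  fixes S :: "'a::{real_inner,complete_space} set"
  assumes "subspace S" "closed S" and orth: "\<And>y. (\<And>z. z \<in> S \<Longrightarrow> inner y z = 0) \<Longrightarrow> y = 0"
  shows "S = UNIV"
proof -
  have "x \<in> S" for x
  proof -
    obtain y where "y \<in> S" "\<forall>z\<in>S. inner (x - y) z = 0"
      using closed_subspace_projection[OF assms(1,2)] by blast
    with orth[of "x - y"] show ?thesis by simp
  qed
  then show ?thesis by auto
qed

lemma subspace_closure:
  fixes S :: "'a::real_normed_vector set"
  assumes "subspace S" shows "subspace (closure S)"
proof (rule subspaceI)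
  show "0 \<in> closure S" using assms subspace_0 closure_subset by blast
next
  fix x y assume "x \<in> closure S" "y \<in> closure S"
  then obtain u v where "\<And>n. u n \<in> S" "u \<longlonglongrightarrow> x" "\<And>n. v n \<in> S" "v \<longlonglongrightarrow> y"
    unfolding closure_sequential by blast
  then show "x + y \<in> closure S"
    unfolding closure_sequential
    by (intro exI[of _ "\<lambda>n. u n + v n"]) (auto intro: tendsto_add subspace_add[OF assms])
next
  fix c :: real and x assume "x \<in> closure S"
  then obtain u where "\<And>n. u n \<in> S" "u \<longlonglongrightarrow> x"
    unfolding closure_sequential by blast
  then show "c *\<^sub>R x \<in> closure S"
    unfolding closure_sequential
    by (intro exI[of _ "\<lambda>n. c *\<^sub>R u n"]) (auto intro: tendsto_scaleR subspace_scale[OF assms])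
qed

section \<open>Complex inner products\<close>

lemma cinner_add_right: "cinner x (y + z) = cinner x y + cinner x (z::'a::complex_inner)"
  by (metis cinner_add_left cinner_commute complex_cnj_add)

lemma cinner_scaleC_right: "cinner x (c *\<^sub>C y) = cnj c * cinner x (y::'a::complex_inner)"
  by (metis cinner_commute cinner_scaleC_left complex_cnj_mult)

lemma scaleC_minus1: "(-1) *\<^sub>C x = - (x::'a::complex_normed_vector)"
  using scaleC_of_real[of "-1" x] by simp

lemma scaleC_1 [simp]: "1 *\<^sub>C x = (x::'a::complex_normed_vector)"
  using scaleC_of_real[of 1 x] by simp

lemma scaleC_0 [simp]: "0 *\<^sub>C x = (0::'a::complex_normed_vector)"
  using scaleC_of_real[of 0 x] by simp

lemma cinner_minus_left: "cinner (- x) y = - cinner x (y::'a::complex_inner)"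
  using cinner_scaleC_left[of "-1" x y] by (simp add: scaleC_minus1)

lemma cinner_minus_right: "cinner x (- y) = - cinner x (y::'a::complex_inner)"
  using cinner_scaleC_right[of x "-1" y] by (simp add: scaleC_minus1)

lemma cinner_diff_left: "cinner (x - y) z = cinner x z - cinner y (z::'a::complex_inner)"
  using cinner_add_left[of x "- y" z] by (simp add: cinner_minus_left)

lemma cinner_diff_right: "cinner x (y - z) = cinner x y - cinner x (z::'a::complex_inner)"
  using cinner_add_right[of x y "- z"] by (simp add: cinner_minus_right)

lemma cinner_zero_left [simp]: "cinner 0 (x::'a::complex_inner) = 0"
  using cinner_diff_left[of x x x] by simp

lemma cinner_zero_right [simp]: "cinner (x::'a::complex_inner) 0 = 0"
  using cinner_diff_right[of x x x] by simp

text \<open>A set closed under multiplication by \<open>\<i>\<close> is orthogonal for the complex inner product as soon as it is for the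
  real one; this is how the real projection theorem is applied to complex subspaces.\<close>

lemma cinner_eq_inner: "cinner x y = Complex (inner x y) (inner x (\<i> *\<^sub>C (y::'a::complex_inner)))"
proof -
  have "inner x (\<i> *\<^sub>C y) = Im (cinner x y)"
    by (simp flip: Re_cinner add: cinner_scaleC_right)
  then show ?thesis by (simp add: complex_eq_iff Re_cinner)
qed

lemma cinner_self: "cinner x x = complex_of_real ((norm (x::'a::complex_inner))\<^sup>2)"
proof -
  have "Im (cinner x x) = 0" using cinner_commute[of x x] by (simp add: complex_eq_iff)
  then show ?thesis by (simp add: complex_eq_iff Re_cinner power2_norm_eq_inner)
qed

lemma bounded_linear_cinner:
  "bounded_linear (\<lambda>x::'a::complex_inner. cinner x y)" "bounded_linear (\<lambda>y. cinner x (y::'a))"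
proof -
  have 1: "norm (cinner x y) \<le> norm x * norm y" for x y :: 'a
  proof -
    \<comment> \<open>A phase that makes the product real reduces the Cauchy--Schwarz inequality to the real one.\<close>
    obtain c where c: "cmod c = 1" "c * cinner x y = complex_of_real (cmod (cinner x y))"
    proof (cases "cinner x y = 0")
      case False
      show ?thesis
      proof (rule that[of "cnj (sgn (cinner x y))"])
        show "cmod (cnj (sgn (cinner x y))) = 1" using False by (simp add: norm_sgn)
        have "cnj (cinner x y) * cinner x y = (complex_of_real (cmod (cinner x y)))\<^sup>2"
          by (subst mult.commute) (simp flip: complex_norm_square)
        then show "cnj (sgn (cinner x y)) * cinner x y = complex_of_real (cmod (cinner x y))"
          using False by (simp add: sgn_eq power2_eq_square)
      qed
    qed (use that[of 1] in auto)
    have "cmod (cinner x y) = Re (cinner (c *\<^sub>C x) y)" using c(2) by (simp add: cinner_scaleC_left)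
    also have "\<dots> \<le> norm (c *\<^sub>C x) * norm y" by (simp add: Re_cinner norm_cauchy_schwarz)
    finally show ?thesis using c(1) by (simp add: norm_scaleC)
  qed
  show "bounded_linear (\<lambda>x. cinner x y)"
    by (rule bounded_linear_intro[where K = "norm y"])
      (auto simp: cinner_add_left 1 mult.commute cinner_scaleC_left scaleR_conv_of_real simp flip: scaleC_of_real)
  show "bounded_linear (\<lambda>y. cinner x y)"
    by (rule bounded_linear_intro[where K = "norm x"])
      (auto simp: cinner_add_right 1 mult.commute[of "norm x"] cinner_scaleC_right scaleR_conv_of_real simp flip: scaleC_of_real intro: order.trans[OF 1])
qed

lemma cinner_ext: "(\<And>z. cinner x z = cinner y z) \<Longrightarrow> x = (y::'a::complex_inner)"
  using cinner_self[of "x - y"] by (simp add: cinner_diff_left)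

lemma bounded_linear_scaleC: "bounded_linear (\<lambda>x::'a::complex_normed_vector. c *\<^sub>C x)"
  by (rule bounded_linear_intro[where K = "cmod c"])
    (auto simp: scaleC_add_right norm_scaleC mult.commute scaleC_scaleC simp flip: scaleC_of_real)

lemma bounded_linear_scaleC_left: "bounded_linear (\<lambda>c. c *\<^sub>C (x::'a::complex_normed_vector))"
  by (rule bounded_linear_intro[where K = "norm x"])
    (auto simp: scaleC_add_left norm_scaleC scaleC_scaleC scaleR_conv_of_real simp flip: scaleC_of_real)

lemma bounded_clinear_compose:
  "bounded_clinear f \<Longrightarrow> bounded_clinear g \<Longrightarrow> bounded_clinear (\<lambda>x. f (g x))"
  unfolding bounded_clinear_def by (auto intro: bounded_linear_compose)

section \<open>Absolute sums of binomial coefficients\<close>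

text \<open>Passing from \<open>k\<close> to \<open>k + 1\<close> multiplies the coefficient by \<open>(a - k) / (k + 1)\<close>, which is nonpositive for
  \<open>k \<ge> a\<close>: from there on the signs alternate. The factor \<open>s\<close> fixes which of the two alternating patterns occurs.\<close>

lemma gbinomial_alternating_sign:
  fixes a s :: real
  assumes "a \<le> real m" "0 \<le> s * ((-1) ^ m * (a gchoose m))" "m \<le> k"
  shows "0 \<le> s * ((-1) ^ k * (a gchoose k))"
  using assms(3)
proof (induction k rule: dec_induct)
  case (step k)
  have "real (Suc k) * (a gchoose Suc k) = (a - real k) * (a gchoose k)"
    using gbinomial_mult_1[of a k] by (simp add: algebra_simps)
  then have "- s * (-1) ^ k * (real (Suc k) * (a gchoose Suc k))
      = - s * (-1) ^ k * ((a - real k) * (a gchoose k))"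
    by (rule arg_cong)
  then have "real (Suc k) * (s * ((-1) ^ Suc k * (a gchoose Suc k)))
      = (real k - a) * (s * ((-1) ^ k * (a gchoose k)))"
    by (simp add: mult_ac left_diff_distrib right_diff_distrib del: of_nat_Suc)
  also have "\<dots> \<ge> 0" using step.hyps assms(1) by (intro mult_nonneg_nonneg[OF _ step.IH]) auto
  finally show ?case
    by (metis mult_le_cancel_left_pos mult_zero_right of_nat_0_less_iff zero_less_Suc)
qed (use assms in auto)

lemma gbinomial_alternating_sum:
  "(\<Sum>k\<le>n. (-1) ^ k * (a gchoose k)) = (- 1) ^ n * (a - 1 gchoose n)" for a :: real
  using gbinomial_sum_lower_neg[of a n] by (simp add: mult.commute)

text \<open>For \<open>0 \<le> u \<le> 1\<close> all terms \<open>(-1)\<^sup>k (u gchoose k)\<close> with \<open>k \<ge> 1\<close> are nonpositive, so the sum of absolute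
  values is \<open>2\<close> minus the alternating sum, and the latter has a closed form that is nonnegative.\<close>

lemma sum_abs_gbinomial_le:
  fixes u :: real
  assumes u: "0 \<le> u" "u \<le> 1"
  shows "(\<Sum>k\<le>n. \<bar>u gchoose k\<bar>) \<le> 2"
proof -
  have abs: "\<bar>u gchoose k\<bar> = (if k = 0 then 2 else 0) - (-1) ^ k * (u gchoose k)" for k
  proof (cases "k = 0")
    case False
    have "0 \<le> -1 * ((-1) ^ k * (u gchoose k))"
      by (rule gbinomial_alternating_sign[where m = 1]) (use u False in auto)
    then have "- ((-1) ^ k * (u gchoose k)) = \<bar>(-1) ^ k * (u gchoose k)\<bar>" by simp
    then show ?thesis using False by (simp add: abs_mult)
  qed auto
  have "0 \<le> 1 * ((-1) ^ n * (u - 1 gchoose n))"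
    by (rule gbinomial_alternating_sign[where m = 0]) (use u in auto)
  then show ?thesis
    unfolding abs sum_subtractf gbinomial_alternating_sum by simp
qed

text \<open>The binomial series with exponent \<open>1 + u\<close> depends continuously on \<open>u\<close> at \<open>0\<close>, in the \<open>\<ell>\<^sup>1\<close> norm of the
  coefficients. Again the signs of the terms with \<open>k \<ge> 2\<close> alternate, so a telescoping sum gives the bound.\<close>

lemma sum_abs_gbinomial_diff_le:
  fixes u :: real
  assumes u: "\<bar>u\<bar> < 1"
  shows "(\<Sum>k\<le>n. \<bar>(1 + u gchoose k) - (1 gchoose k)\<bar>) \<le> 2 * \<bar>u\<bar>"
proof (cases "u = 0 \<or> n = 0")
  case False
  \<comment> \<open>The terms with \<open>k \<ge> 2\<close> have the sign of \<open>(-1)\<^sup>k u\<close>.\<close>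
  define s where "s = sgn u"
  have su: "s * u = \<bar>u\<bar>" and s: "\<bar>s\<bar> = 1" using False by (auto simp: s_def sgn_if)
  have abs: "\<bar>(1 + u gchoose k) - (1 gchoose k)\<bar> =
      s * ((-1) ^ k * (1 + u gchoose k)) + (if k = 0 then - s else 0) + (if k = 1 then s + 2 * \<bar>u\<bar> else 0)" for k
  proof -
    consider "k = 0" | "k = 1" | "2 \<le> k" by linarith
    then show ?thesis
    proof cases
      case 2
      then show ?thesis using su by (simp add: algebra_simps)
    next
      case 3
      have one: "(1 gchoose k) = (0::real)"
        using 3 binomial_gbinomial[of 1 k, where ?'a = real] by (simp add: binomial_eq_0)
      have pos: "0 \<le> s * ((-1) ^ k * (1 + u gchoose k))"
      proof (cases "0 < u")
        case True
        show ?thesis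
        proof (rule gbinomial_alternating_sign[where m = 2])
          show "0 \<le> s * ((- 1)\<^sup>2 * (1 + u gchoose 2))"
            using True by (simp add: s_def gbinomial_prod_rev numeral_2_eq_2)
        qed (use u 3 in auto)
      next
        case False
        with \<open>\<not> (u = 0 \<or> n = 0)\<close> have "u < 0" by auto
        then have "s = -1" by (simp add: s_def)
        show ?thesis
        proof (rule gbinomial_alternating_sign[where m = 1])
          show "0 \<le> s * ((- 1) ^ 1 * (1 + u gchoose 1))"
            using u unfolding \<open>s = -1\<close> by simp
          show "1 + u \<le> real 1" using \<open>u < 0\<close> by simp
          show "1 \<le> k" using 3 by simp
        qed
      qed
      have "\<bar>1 + u gchoose k\<bar> = \<bar>s * ((-1) ^ k * (1 + u gchoose k))\<bar>"
        by (simp add: abs_mult s)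
      also have "\<dots> = s * ((-1) ^ k * (1 + u gchoose k))" by (rule abs_of_nonneg[OF pos])
      finally have "\<bar>1 + u gchoose k\<bar> = s * ((-1) ^ k * (1 + u gchoose k))" .
      with 3 one show ?thesis by simp
    qed auto
  qed
  have "0 \<le> - s * ((-1) ^ n * (u gchoose n))"
  proof (cases "0 < u")
    case True
    then have "s = 1" by (simp add: s_def)
    show ?thesis
    proof (rule gbinomial_alternating_sign[where m = 1])
      show "0 \<le> - s * ((- 1) ^ 1 * (u gchoose 1))" using True unfolding \<open>s = 1\<close> by simp
      show "u \<le> real 1" using u by simp
      show "1 \<le> n" using False by simp
    qed
  next
    case uneg: False
    with False have "s = -1" by (simp add: s_def)
    show ?thesis
    proof (rule gbinomial_alternating_sign[where m = 0])
      show "0 \<le> - s * ((- 1) ^ 0 * (u gchoose 0))" unfolding \<open>s = -1\<close> by simp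
      show "u \<le> real 0" using uneg by simp
    qed simp
  qed
  moreover have "(\<Sum>k\<le>n. if k = 1 then s + 2 * \<bar>u\<bar> else 0) = s + 2 * \<bar>u\<bar>" using False by simp
  ultimately show ?thesis
    unfolding abs sum.distrib sum_distrib_left[symmetric] gbinomial_alternating_sum by simp
qed (auto simp: binomial_gbinomial)

text \<open>Exponents in \<open>[0, 1]\<close> have bounded partial sums; Pascal's rule raises the exponent by one.\<close>

lemma summable_abs_gbinomial:
  assumes "0 \<le> (t::real)" shows "summable (\<lambda>k. \<bar>t gchoose k\<bar>)"
proof -
  have frac: "summable (\<lambda>k. \<bar>u gchoose k\<bar>)" if u: "0 \<le> u" "u \<le> 1" for u :: real
  proof (rule summableI_nonneg_bounded[where x = 2])
    fix n
    have "(\<Sum>k<n. \<bar>u gchoose k\<bar>) \<le> (\<Sum>k\<le>n. \<bar>u gchoose k\<bar>)" by (intro sum_mono2) auto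
    with sum_abs_gbinomial_le[OF u, of n] show "(\<Sum>k<n. \<bar>u gchoose k\<bar>) \<le> 2" by linarith
  qed auto
  have "summable (\<lambda>k. \<bar>u + real n gchoose k\<bar>)" if u: "0 \<le> u" "u \<le> 1" for u :: real and n
  proof (induction n)
    case (Suc n)
    let ?a = "u + real n"
    have "summable (\<lambda>k. \<bar>?a gchoose k\<bar> + \<bar>?a gchoose Suc k\<bar>)"
      by (intro summable_add Suc summable_Suc_iff[of "\<lambda>k. \<bar>?a gchoose k\<bar>", THEN iffD2])
    then have "summable (\<lambda>k. \<bar>?a + 1 gchoose Suc k\<bar>)"
      by (rule summable_comparison_test') (simp add: gbinomial_Suc_Suc)
    moreover have "?a + 1 = u + real (Suc n)" by simp
    ultimately show ?case
      using summable_Suc_iff[of "\<lambda>k. \<bar>u + real (Suc n) gchoose k\<bar>"] by simp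
  qed (use frac u in auto)
  from this[of "frac t" "nat \<lfloor>t\<rfloor>"] assms show ?thesis
    using frac_lt_1[of t] by (simp add: frac_def)
qed

section \<open>Binomial series in Banach algebras\<close>

text \<open>The power \<open>(1 + c)\<^sup>t\<close>.\<close>

definition binomial_power :: "'a::{real_normed_algebra,monoid_mult,banach} \<Rightarrow> real \<Rightarrow> 'a" where
  "binomial_power c t = (\<Sum>k. (t gchoose k) *\<^sub>R c ^ k)"

text \<open>Only the powers of \<open>c\<close> enter the series, so they are required to be bounded, and not \<open>c\<close> itself to have
  norm less than \<open>1\<close>: the series is needed on the boundary of its disk of convergence.\<close>

context
  fixes c :: "'a::{real_normed_algebra,monoid_mult,banach}"
  assumes power_bounded: "\<And>k. norm (c ^ k) \<le> 1"
begin

lemma summable_norm_scaled_powers: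
  assumes "summable (\<lambda>k. \<bar>f k\<bar>)"
  shows "summable (\<lambda>k. norm (f k *\<^sub>R c ^ k))"
  by (rule summable_comparison_test'[OF assms, of 0]) (simp add: mult_left_le power_bounded)

lemma norm_suminf_scaled_powers_le:
  assumes "\<And>n. (\<Sum>k\<le>n. \<bar>f k\<bar>) \<le> K"
  shows "norm (\<Sum>k. f k *\<^sub>R c ^ k) \<le> K"
proof -
  have le: "(\<Sum>k<n. \<bar>f k\<bar>) \<le> K" for n
    by (rule order.trans[OF sum_mono2 assms[of n]]) auto
  have s: "summable (\<lambda>k. \<bar>f k\<bar>)"
    by (rule summableI_nonneg_bounded[OF _ le]) auto
  have "norm (\<Sum>k. f k *\<^sub>R c ^ k) \<le> (\<Sum>k. norm (f k *\<^sub>R c ^ k))"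
    by (rule summable_norm[OF summable_norm_scaled_powers[OF s]])
  also have "\<dots> \<le> (\<Sum>k. \<bar>f k\<bar>)"
    by (rule suminf_le[OF _ summable_norm_scaled_powers[OF s] s]) (simp add: mult_left_le power_bounded)
  also have "\<dots> \<le> K" by (rule suminf_le_const[OF s le])
  finally show ?thesis .
qed

lemma summable_norm_binomial_power: "0 \<le> t \<Longrightarrow> summable (\<lambda>k. norm ((t gchoose k) *\<^sub>R c ^ k))"
  by (rule summable_norm_scaled_powers[OF summable_abs_gbinomial])

lemma summable_binomial_power: "0 \<le> t \<Longrightarrow> summable (\<lambda>k. (t gchoose k) *\<^sub>R c ^ k)"
  by (rule summable_norm_cancel[OF summable_norm_binomial_power])

text \<open>The Cauchy product of the two series has the coefficients of \<open>t + s\<close> by Vandermonde's identity.\<close>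

lemma binomial_power_add:
  assumes "0 \<le> t" "0 \<le> s"
  shows "binomial_power c (t + s) = binomial_power c t * binomial_power c s"
proof -
  have "binomial_power c t * binomial_power c s =
      (\<Sum>k. \<Sum>i\<le>k. ((t gchoose i) *\<^sub>R c ^ i) * ((s gchoose (k - i)) *\<^sub>R c ^ (k - i)))"
    unfolding binomial_power_def using assms by (intro Cauchy_product summable_norm_binomial_power)
  also have "(\<lambda>k. \<Sum>i\<le>k. ((t gchoose i) *\<^sub>R c ^ i) * ((s gchoose (k - i)) *\<^sub>R c ^ (k - i)))
      = (\<lambda>k. (t + s gchoose k) *\<^sub>R c ^ k)"
  proof
    fix k
    have "(\<Sum>i\<le>k. ((t gchoose i) *\<^sub>R c ^ i) * ((s gchoose (k - i)) *\<^sub>R c ^ (k - i)))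
        = (\<Sum>i\<le>k. ((t gchoose i) * (s gchoose (k - i))) *\<^sub>R c ^ k)"
      by (rule sum.cong) (auto simp flip: power_add)
    also have "\<dots> = (t + s gchoose k) *\<^sub>R c ^ k"
      by (simp only: scaleR_sum_left[symmetric] atLeast0AtMost[symmetric] gbinomial_Vandermonde)
    finally show "(\<Sum>i\<le>k. ((t gchoose i) *\<^sub>R c ^ i) * ((s gchoose (k - i)) *\<^sub>R c ^ (k - i)))
        = (t + s gchoose k) *\<^sub>R c ^ k" .
  qed
  finally show ?thesis by (simp add: binomial_power_def)
qed

lemma binomial_power_commute:
  assumes "x * c = c * x" "0 \<le> t"
  shows "x * binomial_power c t = binomial_power c t * x"
proof -
  have "x * c ^ k = c ^ k * x" for k
    using power_commuting_commutes[of c x k] assms(1) by metis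
  then show ?thesis
    unfolding binomial_power_def
    using suminf_mult[OF summable_binomial_power[OF assms(2)], of x]
      suminf_mult2[OF summable_binomial_power[OF assms(2)], of x] by simp
qed

lemma norm_binomial_power_le: "0 \<le> t \<Longrightarrow> t \<le> 1 \<Longrightarrow> norm (binomial_power c t) \<le> 2"
  unfolding binomial_power_def by (rule norm_suminf_scaled_powers_le[OF sum_abs_gbinomial_le])

lemma binomial_power_near_one: "\<bar>u\<bar> < 1 \<Longrightarrow> norm (binomial_power c (1 + u) - binomial_power c 1) \<le> 2 * \<bar>u\<bar>"
  unfolding binomial_power_def
  by (subst suminf_diff) (auto intro!: summable_binomial_power norm_suminf_scaled_powers_le
      sum_abs_gbinomial_diff_le simp flip: scaleR_diff_left)

end

lemma binomial_power_0: "binomial_power c 0 = 1"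
  unfolding binomial_power_def by (subst suminf_finite[of "{0}"]) (auto simp: gbinomial_0_left)

lemma binomial_power_1: "binomial_power c 1 = 1 + c"
proof -
  have "(1 gchoose k) = (0::real)" if "k \<notin> {0,1}" for k
    using that binomial_gbinomial[of 1 k, where ?'a = real] by (simp add: binomial_eq_0)
  then show ?thesis unfolding binomial_power_def by (subst suminf_finite[of "{0,1}"]) auto
qed

lemma binomial_power_of_nat:
  assumes "\<And>k. norm (c ^ k) \<le> 1"
  shows "binomial_power c (real n) = (1 + c) ^ n"
  by (induction n) (simp_all add: binomial_power_0 binomial_power_add[OF assms] binomial_power_1)

section \<open>The Banach algebra of bounded operators\<close>

text \<open>Composition makes the bounded operators a Banach algebra. The class instance needs a type of its own, since
  bounded linear functions between possibly different spaces carry no multiplication.\<close>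

typedef (overloaded) 'a endo = "UNIV :: ('a::real_normed_vector \<Rightarrow>\<^sub>L 'a) set" ..

setup_lifting type_definition_endo

instantiation endo :: (real_normed_vector) "{real_normed_algebra,monoid_mult}"
begin

lift_definition zero_endo :: "'a endo" is 0 .
lift_definition plus_endo :: "'a endo \<Rightarrow> 'a endo \<Rightarrow> 'a endo" is "(+)" .
lift_definition minus_endo :: "'a endo \<Rightarrow> 'a endo \<Rightarrow> 'a endo" is "(-)" .
lift_definition uminus_endo :: "'a endo \<Rightarrow> 'a endo" is uminus .
lift_definition scaleR_endo :: "real \<Rightarrow> 'a endo \<Rightarrow> 'a endo" is scaleR .
lift_definition one_endo :: "'a endo" is id_blinfun .
lift_definition times_endo :: "'a endo \<Rightarrow> 'a endo \<Rightarrow> 'a endo" is blinfun_compose .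
lift_definition norm_endo :: "'a endo \<Rightarrow> real" is norm .
definition "dist f g = norm (f - g :: 'a endo)"
definition "sgn (f :: 'a endo) = inverse (norm f) *\<^sub>R f"
definition "(uniformity :: ('a endo \<times> 'a endo) filter) =
  (INF e\<in>{0 <..}. principal {(x, y). dist x y < e})"
definition "open (U :: 'a endo set) \<longleftrightarrow>
  (\<forall>x\<in>U. \<forall>\<^sub>F (x', y) in uniformity. x' = x \<longrightarrow> y \<in> U)"

instance
proof
  fix f g h :: "'a endo" and r s :: real
  show "f + g + h = f + (g + h)" by transfer (simp add: add.assoc)
  show "f + g = g + f" by transfer (simp add: add.commute)
  show "0 + f = f" by transfer simp
  show "- f + f = 0" by transfer simp
  show "f - g = f + - g" by transfer simp
  show "r *\<^sub>R (f + g) = r *\<^sub>R f + r *\<^sub>R g" by transfer (rule scaleR_add_right)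
  show "(r + s) *\<^sub>R f = r *\<^sub>R f + s *\<^sub>R f" by transfer (rule scaleR_add_left)
  show "r *\<^sub>R s *\<^sub>R f = (r * s) *\<^sub>R f" by transfer simp
  show "1 *\<^sub>R f = f" by transfer simp
  show "f * g * h = f * (g * h)" by transfer (rule blinfun_eqI, simp)
  show "(f + g) * h = f * h + g * h" by transfer (rule blinfun_eqI, simp add: blinfun.add_left)
  show "f * (g + h) = f * g + f * h"
    by transfer (rule blinfun_eqI, simp add: blinfun.add_left blinfun.add_right)
  show "r *\<^sub>R f * g = r *\<^sub>R (f * g)" by transfer (rule blinfun_eqI, simp add: blinfun.scaleR_left)
  show "f * r *\<^sub>R g = r *\<^sub>R (f * g)"
    by transfer (rule blinfun_eqI, simp add: blinfun.scaleR_left blinfun.scaleR_right)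
  show "1 * f = f" "f * 1 = f" by (transfer, rule blinfun_eqI, simp)+
  show "norm f = 0 \<longleftrightarrow> f = 0" by transfer simp
  show "norm (f + g) \<le> norm f + norm g" by transfer (rule norm_triangle_ineq)
  show "norm (r *\<^sub>R f) = \<bar>r\<bar> * norm f" by transfer simp
  show "norm (f * g) \<le> norm f * norm g" by transfer (rule norm_blinfun_compose)
qed (simp_all only: dist_endo_def sgn_endo_def uniformity_endo_def open_endo_def)

end

instance endo :: (banach) banach
proof
  fix X :: "nat \<Rightarrow> 'a endo" assume X: "Cauchy X"
  have "Cauchy (\<lambda>n. Rep_endo (X n))"
    using X by (simp add: Cauchy_def dist_norm norm_endo.rep_eq minus_endo.rep_eq)
  then obtain L where "(\<lambda>n. Rep_endo (X n)) \<longlonglongrightarrow> L"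
    using Cauchy_convergent_iff convergent_def by blast
  then have "X \<longlonglongrightarrow> Abs_endo L"
    by (simp add: LIMSEQ_iff norm_endo.rep_eq minus_endo.rep_eq Abs_endo_inverse)
  then show "convergent X" by (auto simp: convergent_def)
qed

lift_definition endo_apply :: "'a::real_normed_vector endo \<Rightarrow> 'a \<Rightarrow> 'a" is blinfun_apply .

lift_definition endo_of :: "('a::real_normed_vector \<Rightarrow> 'a) \<Rightarrow> 'a endo" is Blinfun .

lemma bounded_linear_endo_apply: "bounded_linear (endo_apply f)"
  by transfer (rule blinfun.bounded_linear_right)

lemma endo_apply_of: "bounded_linear f \<Longrightarrow> endo_apply (endo_of f) = f"
  by transfer (rule bounded_linear_Blinfun_apply)

lemma endo_eqI: "(\<And>x. endo_apply f x = endo_apply g x) \<Longrightarrow> f = g"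
  by transfer (rule blinfun_eqI)

lemma endo_apply_simps [simp]:
  "endo_apply (f + g) x = endo_apply f x + endo_apply g x"
  "endo_apply (f - g) x = endo_apply f x - endo_apply g x"
  "endo_apply (- f) x = - endo_apply f x"
  "endo_apply (f * g) x = endo_apply f (endo_apply g x)"
  "endo_apply 1 x = x"
  by (transfer, simp add: blinfun.bilinear_simps)+

lemma norm_endo_apply: "norm (endo_apply f x) \<le> norm f * norm x"
  by transfer (rule norm_blinfun)

lemma norm_endo_bound: "0 \<le> b \<Longrightarrow> (\<And>x. norm (endo_apply f x) \<le> b * norm x) \<Longrightarrow> norm f \<le> b"
  by transfer (rule norm_blinfun_bound)

lemma norm_endo_power_le: "norm f \<le> 1 \<Longrightarrow> norm (f ^ n) \<le> 1" for f :: "'a::real_normed_vector endo"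
proof (induction n)
  case 0
  show ?case by (simp add: norm_endo_bound)
next
  case (Suc n)
  have "norm (f ^ Suc n) \<le> norm f * norm (f ^ n)" by (simp add: norm_mult_ineq)
  also have "\<dots> \<le> 1" using Suc by (intro mult_le_one) auto
  finally show ?case .
qed

section \<open>Fractional powers of bounded accretive operators\<close>

text \<open>For a family of uniformly bounded operators it suffices to check strong convergence to the identity on a set
  with dense span.\<close>

lemma strong_limit_subspace:
  fixes S :: "real \<Rightarrow> 'a::real_normed_vector \<Rightarrow> 'a"
  assumes lin: "\<And>t. 0 < t \<Longrightarrow> t < 1 \<Longrightarrow> bounded_linear (S t)"
    and bd: "\<And>t x. 0 < t \<Longrightarrow> t < 1 \<Longrightarrow> norm (S t x) \<le> K * norm x"
  shows "subspace {x. ((\<lambda>t. S t x) \<longlongrightarrow> x) (at_right 0)}" (is "subspace ?D")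
    and "closed {x. ((\<lambda>t. S t x) \<longlongrightarrow> x) (at_right 0)}"
proof -
  have ev: "\<forall>\<^sub>F t in at_right 0. 0 < t \<and> t < (1::real)"
    by (rule eventually_at_rightI[of 0 1]) auto
  show "subspace ?D"
  proof (rule subspaceI)
    show "0 \<in> ?D"
      by (auto intro!: tendsto_eventually eventually_mono[OF ev]
          dest!: lin intro: linear_0 bounded_linear.linear)
  next
    fix x y assume "x \<in> ?D" "y \<in> ?D"
    then have "((\<lambda>t. S t x + S t y) \<longlongrightarrow> x + y) (at_right 0)" by (auto intro: tendsto_add)
    moreover have "\<forall>\<^sub>F t in at_right 0. S t x + S t y = S t (x + y)"
      using ev by eventually_elim (metis lin linear_add bounded_linear.linear)
    ultimately show "x + y \<in> ?D" by (auto elim: Lim_transform_eventually)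
  next
    fix c :: real and x assume "x \<in> ?D"
    then have "((\<lambda>t. c *\<^sub>R S t x) \<longlongrightarrow> c *\<^sub>R x) (at_right 0)" by (auto intro: tendsto_intros)
    moreover have "\<forall>\<^sub>F t in at_right 0. c *\<^sub>R S t x = S t (c *\<^sub>R x)"
      using ev by eventually_elim (metis lin linear_scale bounded_linear.linear)
    ultimately show "c *\<^sub>R x \<in> ?D" by (auto elim: Lim_transform_eventually)
  qed
  show "closed ?D"
    unfolding closed_sequential_limits
  proof (intro allI impI, elim conjE)
    fix X x assume X: "\<forall>n. X n \<in> ?D" "X \<longlonglongrightarrow> x"
    have "((\<lambda>t. S t x) \<longlongrightarrow> x) (at_right 0)"
    proof (rule tendstoI)
      fix e :: real assume e: "0 < e"
      define d where "d = e / (2 * (\<bar>K\<bar> + 1))"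
      have d: "0 < d" using e by (simp add: d_def)
      have Kd: "(\<bar>K\<bar> + 1) * d = e / 2" by (simp add: d_def field_simps)
      obtain n where n: "norm (x - X n) < d"
        using LIMSEQ_D[OF X(2) d] by (metis norm_minus_commute order_refl)
      have "((\<lambda>t. S t (X n)) \<longlongrightarrow> X n) (at_right 0)" using X(1) by auto
      then have "\<forall>\<^sub>F t in at_right 0. dist (S t (X n)) (X n) < e / 2"
        using e by (intro tendstoD) auto
      with ev show "\<forall>\<^sub>F t in at_right 0. dist (S t x) x < e"
      proof eventually_elim
        case (elim t)
        have "S t x = S t (x - X n) + S t (X n)"
          using linear_add[OF bounded_linear.linear[OF lin], of t "x - X n" "X n"] elim by simp
        then have "norm (S t x - x) \<le> norm (S t (x - X n)) + norm (S t (X n) - X n) + norm (x - X n)"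
          using norm_triangle_ineq[of "S t (x - X n) + (S t (X n) - X n)" "X n - x"]
            norm_triangle_ineq[of "S t (x - X n)" "S t (X n) - X n"] norm_minus_commute[of x "X n"]
          by simp
        also have "norm (S t (x - X n)) \<le> \<bar>K\<bar> * norm (x - X n)"
          using bd[of t "x - X n"] elim mult_right_mono[of K "\<bar>K\<bar>" "norm (x - X n)"] by force
        also have "\<bar>K\<bar> * norm (x - X n) + norm (S t (X n) - X n) + norm (x - X n)
            = (\<bar>K\<bar> + 1) * norm (x - X n) + norm (S t (X n) - X n)"
          by (simp add: algebra_simps)
        also have "(\<bar>K\<bar> + 1) * norm (x - X n) \<le> (\<bar>K\<bar> + 1) * d"
          using n by (intro mult_left_mono) auto
        finally show ?case using elim Kd by (simp add: dist_norm)
      qed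
    qed
    then show "x \<in> ?D" by simp
  qed
qed

text \<open>The roles are \<open>r = (1 + A)^(-1)\<close>, \<open>b = A r\<close> and \<open>g = 1 + A\<close>, so that \<open>b g = A\<close>.\<close>

locale fractional_powers =
  fixes b r g :: "'a::{real_normed_algebra,monoid_mult,banach}"
  assumes power_b: "norm (b ^ k) \<le> 1" and power_r: "norm (r ^ k) \<le> 1"
    and b_eq: "b = 1 - r" and rg: "r * g = 1" and gr: "g * r = 1"
begin

text \<open>With \<open>n\<close> the least integer not below \<open>t\<close>, this is \<open>b\<^sup>t r^(n-t) g\<^sup>n\<close>, where \<open>r^(n-t) g\<^sup>n\<close> plays the part of
  \<open>r^(-t)\<close>; the negative power of \<open>r\<close> has no binomial series of its own.\<close>

definition frac_power :: "real \<Rightarrow> 'a" where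
  "frac_power t = binomial_power (- r) t * binomial_power (- b) (real (nat \<lceil>t\<rceil>) - t) * g ^ nat \<lceil>t\<rceil>"

lemma r_eq: "r = 1 - b"
  by (simp add: b_eq)

lemma power_minus_le: "norm (c ^ k) \<le> 1 \<Longrightarrow> norm ((- c) ^ k) \<le> 1" for c :: 'a
proof -
  have "(- c) ^ k = c ^ k \<or> (- c) ^ k = - (c ^ k)"
    by (induction k) auto
  then show "norm (c ^ k) \<le> 1 \<Longrightarrow> norm ((- c) ^ k) \<le> 1" by auto
qed

lemmas power_minus_b = power_minus_le[OF power_b]
lemmas power_minus_r = power_minus_le[OF power_r]

text \<open>Everything in sight is built from \<open>r\<close> by sums, limits and inversion. Used both inside the algebra and for
  scalar multiplication by complex numbers, which gives the complex linearity of the powers.\<close>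

lemma commute_if_commute_r:
  assumes "x * r = r * x"
  shows "x * b = b * x" "x * g = g * x"
    "0 \<le> t \<Longrightarrow> x * binomial_power (- r) t = binomial_power (- r) t * x"
    "0 \<le> t \<Longrightarrow> x * binomial_power (- b) t = binomial_power (- b) t * x"
    "x * g ^ k = g ^ k * x"
proof -
  show b: "x * b = b * x" using assms by (simp add: b_eq algebra_simps)
  have "x * g = g * r * x * g" by (simp add: gr)
  also have "\<dots> = g * (r * x) * g" by (simp only: mult.assoc)
  also have "\<dots> = g * x * (r * g)" unfolding assms[symmetric] by (simp only: mult.assoc)
  finally show g: "x * g = g * x" by (simp add: rg)
  then show "x * g ^ k = g ^ k * x" using power_commuting_commutes[of g x k] by simp
  show "0 \<le> t \<Longrightarrow> x * binomial_power (- r) t = binomial_power (- r) t * x"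
    using assms by (intro binomial_power_commute power_minus_r) auto
  show "0 \<le> t \<Longrightarrow> x * binomial_power (- b) t = binomial_power (- b) t * x"
    using b by (intro binomial_power_commute power_minus_b) auto
qed

lemma binomial_power_minus_b_commute: "0 \<le> t \<Longrightarrow> binomial_power (- b) t * r = r * binomial_power (- b) t"
  using commute_if_commute_r(4)[of r t] by simp

lemma g_power_commute: "g ^ k * r = r * g ^ k"
  using commute_if_commute_r(5)[of r k] by simp

lemma r_power_g_power: "r ^ k * g ^ k = 1"
proof (induction k)
  case (Suc k)
  have "r ^ Suc k * g ^ Suc k = r ^ k * (r * g) * g ^ k"
    unfolding power_Suc2[of r] power_Suc[of g] by (simp only: mult.assoc)
  then show ?case by (simp add: rg Suc)
qed simp

text \<open>Enlarging \<open>n\<close> by \<open>j\<close> inserts \<open>r\<^sup>j g\<^sup>j = 1\<close>. This freedom is what makes the law of exponents work, as rounding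
  up is not additive.\<close>

lemma frac_power_eq:
  assumes "0 < t" "t \<le> real n"
  shows "frac_power t = binomial_power (- r) t * binomial_power (- b) (real n - t) * g ^ n"
proof -
  define m where "m = nat \<lceil>t\<rceil>"
  define j where "j = n - m"
  have m: "t \<le> real m" "n = m + j" using assms by (auto simp: m_def j_def)
  have "binomial_power (- b) (real n - t) = binomial_power (- b) ((real m - t) + real j)" using m by (simp add: algebra_simps)
  also have "\<dots> = binomial_power (- b) (real m - t) * r ^ j"
    using m binomial_power_of_nat[OF power_minus_b, of j] by (subst binomial_power_add[OF power_minus_b]) (auto simp: r_eq)
  finally have "binomial_power (- b) (real n - t) * g ^ n = binomial_power (- b) (real m - t) * (r ^ j * g ^ j) * g ^ m"
    using m(2) by (simp add: mult.assoc add.commute flip: power_add)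
  then show ?thesis by (simp add: frac_power_def m_def[symmetric] r_power_g_power mult.assoc)
qed

lemma frac_power_add:
  assumes t: "0 < t" and s: "0 < s"
  shows "frac_power t * frac_power s = frac_power (t + s)"
proof -
  define n m where "n = nat \<lceil>t\<rceil>" and "m = nat \<lceil>s\<rceil>"
  have nm: "t \<le> real n" "s \<le> real m" by (simp_all add: n_def m_def real_nat_ceiling_ge)
  let ?P = "binomial_power (- r)" and ?Q = "binomial_power (- b)"
  have gP: "g ^ n * ?P s = ?P s * g ^ n"
    using commute_if_commute_r(3)[OF g_power_commute] s by simp
  have gQ: "g ^ n * ?Q (real m - s) = ?Q (real m - s) * g ^ n"
    using commute_if_commute_r(4)[OF g_power_commute] nm by simp
  have PQ: "?Q (real n - t) * ?P s = ?P s * ?Q (real n - t)"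
    using commute_if_commute_r(3)[OF binomial_power_minus_b_commute, of "real n - t" s] nm s by simp
  have "frac_power t * frac_power s =
      ?P t * ?Q (real n - t) * (g ^ n * ?P s) * ?Q (real m - s) * g ^ m"
    unfolding frac_power_def n_def m_def by (simp add: mult.assoc)
  also have "\<dots> = ?P t * (?Q (real n - t) * ?P s) * (g ^ n * ?Q (real m - s)) * g ^ m"
    by (simp only: gP mult.assoc)
  also have "\<dots> = (?P t * ?P s) * (?Q (real n - t) * ?Q (real m - s)) * (g ^ n * g ^ m)"
    by (simp only: gQ PQ mult.assoc)
  also have "?P t * ?P s = ?P (t + s)" using t s by (simp add: binomial_power_add[OF power_minus_r])
  also have "?Q (real n - t) * ?Q (real m - s) = ?Q (real (n + m) - (t + s))"
    using nm by (subst binomial_power_add[OF power_minus_b, symmetric]) (auto simp: algebra_simps)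
  also have "g ^ n * g ^ m = g ^ (n + m)" by (simp add: power_add)
  finally show ?thesis using nm t s by (subst frac_power_eq[of "t + s" "n + m"]) auto
qed

lemma frac_power_1: "frac_power 1 = b * g"
  by (simp add: frac_power_def binomial_power_0 binomial_power_1) (simp add: b_eq)

lemma frac_power_commute:
  assumes "x * r = r * x" "0 < t"
  shows "x * frac_power t = frac_power t * x"
proof -
  have "x * frac_power t = binomial_power (- r) t * x * binomial_power (- b) (real (nat \<lceil>t\<rceil>) - t) * g ^ nat \<lceil>t\<rceil>"
    unfolding frac_power_def using commute_if_commute_r(3)[OF assms(1), of t] assms(2) by (simp flip: mult.assoc)
  also have "\<dots> = binomial_power (- r) t * (x * binomial_power (- b) (real (nat \<lceil>t\<rceil>) - t)) * g ^ nat \<lceil>t\<rceil>"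
    by (simp only: mult.assoc)
  also have "x * binomial_power (- b) (real (nat \<lceil>t\<rceil>) - t) = binomial_power (- b) (real (nat \<lceil>t\<rceil>) - t) * x"
    by (rule commute_if_commute_r(4)[OF assms(1)]) (simp add: real_nat_ceiling_ge)
  finally show ?thesis by (simp add: commute_if_commute_r(5)[OF assms(1)] frac_power_def mult.assoc)
qed

lemma frac_power_less_1:
  "0 < t \<Longrightarrow> t < 1 \<Longrightarrow> frac_power t = binomial_power (- r) t * binomial_power (- b) (1 - t) * g"
  using frac_power_eq[of t 1] by simp

lemma norm_frac_power_le:
  assumes "0 < t" "t < 1"
  shows "norm (frac_power t) \<le> 4 * norm g"
proof -
  have "norm (frac_power t) \<le> norm (binomial_power (- r) t) * norm (binomial_power (- b) (1 - t)) * norm g"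
    unfolding frac_power_less_1[OF assms]
    by (meson norm_mult_ineq order_trans mult_right_mono norm_ge_zero)
  also have "\<dots> \<le> 2 * 2 * norm g"
    using assms norm_binomial_power_le[OF power_minus_r, of t] norm_binomial_power_le[OF power_minus_b, of "1 - t"]
    by (intro mult_right_mono mult_mono) auto
  finally show ?thesis by simp
qed

text \<open>For \<open>0 < t < 1\<close> the product is \<open>b^(1+t) r^(1-t) g\<close>, and both exponents approach \<open>1\<close>, where the binomial
  series is continuous in norm. At exponent \<open>0\<close> it need not be, which is why the factor \<open>b\<close> is there.\<close>

lemma frac_power_mult_b_tendsto: "((\<lambda>t. frac_power t * b) \<longlongrightarrow> b) (at_right 0)"
proof -
  have ev: "\<forall>\<^sub>F t in at_right 0. 0 < t \<and> t < (1::real)"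
    by (rule eventually_at_rightI[of 0 1]) auto
  have z: "((\<lambda>t::real. 2 * \<bar>t\<bar>) \<longlongrightarrow> 0) (at_right 0)" by (auto intro!: tendsto_eq_intros)
  have 1: "((\<lambda>t. binomial_power (- r) (1 + t)) \<longlongrightarrow> b) (at_right 0)"
  proof (rule LIM_zero_cancel, rule Lim_null_comparison[OF _ z])
    show "\<forall>\<^sub>F t in at_right 0. norm (binomial_power (- r) (1 + t) - b) \<le> 2 * \<bar>t\<bar>"
      using ev
    proof eventually_elim
      case (elim t)
      then show ?case using binomial_power_near_one[OF power_minus_r, of t] by (simp add: binomial_power_1 b_eq)
    qed
  qed
  have 2: "((\<lambda>t. binomial_power (- b) (1 - t)) \<longlongrightarrow> r) (at_right 0)"
  proof (rule LIM_zero_cancel, rule Lim_null_comparison[OF _ z])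
    show "\<forall>\<^sub>F t in at_right 0. norm (binomial_power (- b) (1 - t) - r) \<le> 2 * \<bar>t\<bar>"
      using ev
    proof eventually_elim
      case (elim t)
      then show ?case using binomial_power_near_one[OF power_minus_b, of "- t"] by (simp add: binomial_power_1 r_eq)
    qed
  qed
  have "((\<lambda>t. binomial_power (- r) (1 + t) * binomial_power (- b) (1 - t) * g) \<longlongrightarrow> b * r * g) (at_right 0)"
    by (intro tendsto_intros 1 2)
  also have "b * r * g = b" by (simp add: mult.assoc rg)
  finally show ?thesis
  proof (rule Lim_transform_eventually)
    show "\<forall>\<^sub>F t in at_right 0. binomial_power (- r) (1 + t) * binomial_power (- b) (1 - t) * g = frac_power t * b"
      using ev
    proof eventually_elim
      case (elim t)
      have br: "b * r = r * b" by (simp add: b_eq algebra_simps)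
      have "frac_power t * b = b * frac_power t" using frac_power_commute[OF br] elim by simp
      also have "\<dots> = b * binomial_power (- r) t * binomial_power (- b) (1 - t) * g"
        using elim by (simp add: frac_power_less_1 mult.assoc)
      also have "b * binomial_power (- r) t = binomial_power (- r) (1 + t)"
        using elim by (subst binomial_power_add[OF power_minus_r]) (auto simp: binomial_power_1 b_eq)
      finally show ?case by simp
    qed
  qed
qed

end

text \<open>Accretivity gives \<open>\<parallel>x + A x\<parallel>\<^sup>2 \<ge> \<parallel>x\<parallel>\<^sup>2 + \<parallel>A x\<parallel>\<^sup>2\<close>. So \<open>1 + A\<close> is bounded below and has closed range;
  a vector \<open>y\<close> orthogonal to the range satisfies \<open>\<parallel>y\<parallel>\<^sup>2 + \<langle>A y, y\<rangle> = 0\<close> and vanishes.\<close>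

lemma accretive_resolvent:
  fixes A :: "'a::{real_inner,complete_space} \<Rightarrow> 'a"
  assumes A: "bounded_linear A" and acc: "\<And>x. 0 \<le> inner (A x) x"
  shows "bij (\<lambda>x. x + A x)" "norm x \<le> norm (x + A x)" "norm (A x) \<le> norm (x + A x)"
proof -
  let ?G = "\<lambda>x. x + A x"
  have G: "bounded_linear ?G" by (intro bounded_linear_add A bounded_linear_ident)
  have sq: "(norm (?G x))\<^sup>2 = (norm x)\<^sup>2 + (norm (A x))\<^sup>2 + 2 * inner (A x) x" for x
    by (simp add: power2_norm_eq_inner inner_add_left inner_add_right inner_commute)
  show le: "norm x \<le> norm (?G x)" for x
    by (rule power2_le_imp_le) (use acc[of x] in \<open>auto simp: sq\<close>)
  show "norm (A x) \<le> norm (?G x)"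
    by (rule power2_le_imp_le) (use acc[of x] in \<open>auto simp: sq\<close>)
  have "inj ?G"
    using le linear_injective_0[OF bounded_linear.linear[OF G]] by (metis norm_le_zero_iff norm_zero)
  moreover have "range ?G = UNIV"
  proof (rule closed_subspace_eq_UNIV)
    show "subspace (range ?G)"
      using bounded_linear.linear[OF G] by (simp add: linear_subspace_image)
    show "closed (range ?G)"
      using complete_isometric_image[OF zero_less_one subspace_UNIV G] le complete_UNIV complete_imp_closed
      by auto
    fix y assume "\<And>z. z \<in> range ?G \<Longrightarrow> inner y z = 0"
    then have "inner y (y + A y) = 0" by blast
    then have "(norm y)\<^sup>2 + inner (A y) y = 0"
      by (simp add: inner_add_right inner_commute power2_norm_eq_inner)
    with acc[of y] show "y = 0" by (smt (verit) zero_le_power2 power_eq_0_iff norm_eq_zero)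
  qed
  ultimately show "bij ?G" by (simp add: bij_def)
qed

text \<open>The semigroup of fractional powers. The range of \<open>b = A (1 + A)^(-1)\<close> is the range of \<open>A\<close>, which is where
  strong continuity at \<open>0\<close> comes from.\<close>

theorem accretive_C0_embeddable:
  fixes A :: "'a::{complex_inner,banach} \<Rightarrow> 'a"
  assumes A: "bounded_clinear A" and acc: "\<And>x. 0 \<le> Re (cinner (A x) x)"
    and dense: "closure (range A) = UNIV"
  shows "\<exists>S. C0_semigroup S \<and> S 1 = A"
proof -
  have lA: "bounded_linear A" and scA: "\<And>c x. A (c *\<^sub>C x) = c *\<^sub>C A x"
    using A by (auto simp: bounded_clinear_def)
  note res = accretive_resolvent[OF lA acc[unfolded Re_cinner]]
  define G where "G = (\<lambda>x. x + A x)"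
  have lG: "bounded_linear G" unfolding G_def by (intro bounded_linear_add lA bounded_linear_ident)
  define R where "R = inv G"
  have "bij G" using res(1) by (simp add: G_def)
  then have GR: "G (R x) = x" and RG: "R (G x) = x" for x
    by (simp_all add: R_def bij_is_inj bij_is_surj surj_f_inv_f inv_f_f)
  have lR: "bounded_linear R"
  proof (rule bounded_linear_intro[where K = 1])
    fix x y :: 'a and c :: real
    show "R (x + y) = R x + R y"
      using linear_add[OF bounded_linear.linear[OF lG], of "R x" "R y"] by (metis GR RG)
    show "R (c *\<^sub>R x) = c *\<^sub>R R x"
      using linear_scale[OF bounded_linear.linear[OF lG], of c "R x"] by (metis GR RG)
    show "norm (R x) \<le> norm x * 1" using res(2)[of "R x"] GR[of x] by (simp add: G_def)
  qed
  define r g b where "r = endo_of R" and "g = endo_of G" and "b = 1 - r"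
  have ar: "endo_apply r = R" and ag: "endo_apply g = G"
    unfolding r_def g_def by (simp_all add: endo_apply_of lR lG)
  have ab: "endo_apply b x = A (R x)" for x
  proof -
    have "x = R x + A (R x)" using GR[of x] by (simp add: G_def)
    then show ?thesis by (simp add: b_def ar algebra_simps)
  qed
  interpret fractional_powers b r g
  proof
    have "norm r \<le> 1"
      using res(2)[of "R x" for x] GR by (intro norm_endo_bound) (auto simp: ar G_def)
    then show "norm (r ^ k) \<le> 1" for k by (rule norm_endo_power_le)
    have "norm b \<le> 1"
      using res(3)[of "R x" for x] GR by (intro norm_endo_bound) (auto simp: ab G_def)
    then show "norm (b ^ k) \<le> 1" for k by (rule norm_endo_power_le)
    show "r * g = 1" "g * r = 1" by (auto intro!: endo_eqI simp: ar ag GR RG)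
  qed (rule b_def)
  let ?S = "\<lambda>t. endo_apply (frac_power t)"
  have lim: "((\<lambda>t. ?S t x) \<longlongrightarrow> x) (at_right 0)" for x
  proof -
    let ?D = "{x. ((\<lambda>t. ?S t x) \<longlongrightarrow> x) (at_right 0)}"
    have bd: "norm (?S t x) \<le> 4 * norm g * norm x" if "0 < t" "t < 1" for t x
      using norm_endo_apply[of "frac_power t" x] norm_frac_power_le[OF that]
      by (meson mult_right_mono norm_ge_zero order_trans)
    have "closed ?D"
      by (rule strong_limit_subspace(2)[OF bounded_linear_endo_apply bd])
    moreover have "range A \<subseteq> ?D"
    proof
      fix y assume "y \<in> range A"
      then obtain z where "y = A z" by blast
      then have y: "y = endo_apply b (G z)" by (simp add: ab RG)
      have "((\<lambda>t. endo_apply (frac_power t * b) (G z)) \<longlongrightarrow> endo_apply b (G z)) (at_right 0)"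
      proof (rule LIM_zero_cancel, rule Lim_null_comparison)
        show "((\<lambda>t. norm (frac_power t * b - b) * norm (G z)) \<longlongrightarrow> 0) (at_right 0)"
          using LIM_zero[OF frac_power_mult_b_tendsto]
          by (intro tendsto_mult_left_zero tendsto_norm_zero)
        show "\<forall>\<^sub>F t in at_right 0. norm (endo_apply (frac_power t * b) (G z) - endo_apply b (G z))
            \<le> norm (frac_power t * b - b) * norm (G z)"
          using norm_endo_apply[of "frac_power t * b - b" "G z" for t]
          by (intro always_eventually) simp
      qed
      then show "y \<in> ?D" by (simp add: y)
    qed
    ultimately have "closure (range A) \<subseteq> ?D" by (intro closure_minimal)
    then show ?thesis using dense by blast
  qed
  have clin: "?S t (c *\<^sub>C x) = c *\<^sub>C ?S t x" if "0 < t" for t c x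
  proof -
    define U where "U = endo_of (\<lambda>x::'a. c *\<^sub>C x)"
    have U: "endo_apply U = (\<lambda>x. c *\<^sub>C x)" by (simp add: U_def endo_apply_of bounded_linear_scaleC)
    have "R (c *\<^sub>C x) = c *\<^sub>C R x" for x
    proof -
      have "G (c *\<^sub>C R x) = c *\<^sub>C x" by (metis G_def GR scA scaleC_add_right)
      then show ?thesis by (metis RG)
    qed
    then have "U * r = r * U" by (intro endo_eqI) (simp add: U ar)
    from frac_power_commute[OF this that] have "endo_apply (U * frac_power t) x = endo_apply (frac_power t * U) x"
      by simp
    then show ?thesis by (simp add: U)
  qed
  have "C0_semigroup ?S"
    unfolding C0_semigroup_def bounded_clinear_def
  proof (intro conjI allI impI)
    fix t s :: real assume "0 < t" "0 < s"
    then show "?S t \<circ> ?S s = ?S (t + s)" by (auto simp flip: frac_power_add)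
  next
    fix x show "((\<lambda>t. norm (?S t x - x)) \<longlongrightarrow> 0) (at_right 0)"
      using lim[of x] by (simp add: tendsto_norm_zero LIM_zero)
  qed (simp_all add: bounded_linear_endo_apply clin)
  moreover have "?S 1 = A" by (auto simp: frac_power_1 ab ag RG)
  ultimately show ?thesis by blast
qed

text \<open>Together with \<open>\<langle>A x, y\<rangle> = 0\<close> for all \<open>x\<close>, accretivity at \<open>y - d A y\<close> reads
  \<open>0 \<le> - d \<parallel>A y\<parallel>\<^sup>2 + O(d\<^sup>2)\<close>, which is false for small \<open>d > 0\<close> unless \<open>A y = 0\<close>.\<close>

lemma accretive_orthogonal_range_kernel:
  fixes A :: "'a::real_inner \<Rightarrow> 'a"
  assumes A: "linear A" and acc: "\<And>x. 0 \<le> inner (A x) x" and y: "\<And>x. inner (A x) y = 0"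
  shows "A y = 0"
proof (rule ccontr)
  assume nz: "A y \<noteq> 0"
  define K where "K = inner (A (A y)) (A y) + 1"
  have K: "0 < K" using acc[of "A y"] by (simp add: K_def)
  define d where "d = (norm (A y))\<^sup>2 / K"
  have d: "0 < d" using nz K by (simp add: d_def)
  have dK: "(norm (A y))\<^sup>2 = d * K" using K by (simp add: d_def)
  have "0 \<le> inner (A (y - d *\<^sub>R A y)) (y - d *\<^sub>R A y)" by (rule acc)
  also have "\<dots> = - d * (norm (A y))\<^sup>2 + d\<^sup>2 * inner (A (A y)) (A y)"
    by (simp add: linear_diff[OF A] linear_scale[OF A] inner_diff_left inner_diff_right y
        power2_norm_eq_inner algebra_simps) (simp add: power2_eq_square)
  also have "\<dots> = d * (d * (K - 1) - d * K)"
    unfolding dK by (simp add: K_def power2_eq_square algebra_simps)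
  also have "\<dots> = - d\<^sup>2" by (simp add: power2_eq_square algebra_simps)
  finally show False using d by simp
qed

text \<open>Write \<open>c = e^(i\<theta>)\<close> and multiply the semigroup at time \<open>t\<close> by \<open>e^(i\<theta>t)\<close>.\<close>

lemma C0_embeddable_unimodular:
  fixes A :: "'a::complex_normed_vector \<Rightarrow> 'a"
  assumes A: "C0_embeddable A" and c: "cmod c = 1"
  shows "C0_embeddable (\<lambda>x. c *\<^sub>C A x)"
proof -
  obtain S where S: "C0_semigroup S" "S 1 = A" using A by (auto simp: C0_embeddable_def)
  define \<theta> where "\<theta> = Arg c"
  have "c \<noteq> 0" using c by auto
  then have c_eq: "cis \<theta> = c" using c by (simp add: \<theta>_def cis_Arg sgn_eq)
  have lin: "bounded_clinear (S t)" if "0 < t" for t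
    using S(1) that by (simp add: C0_semigroup_def)
  have scale: "S t (a *\<^sub>C x) = a *\<^sub>C S t x" if "0 < t" for t a x
    using lin[OF that] by (simp add: bounded_clinear_def)
  have add: "S t (S s x) = S (t + s) x" if "0 < t" "0 < s" for t s x
    using S(1) that unfolding C0_semigroup_def by (metis comp_apply)
  have "bounded_clinear (\<lambda>x::'a. a *\<^sub>C x)" for a
    by (simp add: bounded_clinear_def bounded_linear_scaleC scaleC_scaleC mult.commute)
  note lin' = bounded_clinear_compose[OF this lin]
  have "C0_semigroup (\<lambda>t x. cis (\<theta> * t) *\<^sub>C S t x)"
    unfolding C0_semigroup_def
  proof (intro conjI allI impI)
    fix t s :: real assume "0 < t" "0 < s"
    then show "(\<lambda>x. cis (\<theta> * t) *\<^sub>C S t x) \<circ> (\<lambda>x. cis (\<theta> * s) *\<^sub>C S s x)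
        = (\<lambda>x. cis (\<theta> * (t + s)) *\<^sub>C S (t + s) x)"
      by (simp add: fun_eq_iff scale scaleC_scaleC add cis_mult distrib_left)
  next
    fix x
    have "((\<lambda>t. norm (S t x - x) + cmod (cis (\<theta> * t) - 1) * norm x) \<longlongrightarrow> 0) (at_right 0)"
    proof -
      have "continuous_on UNIV (\<lambda>t. cmod (cis (\<theta> * t) - 1) * norm x)" by (intro continuous_intros)
      then have "isCont (\<lambda>t. cmod (cis (\<theta> * t) - 1) * norm x) 0" by (simp add: continuous_on_eq_continuous_at)
      then have "((\<lambda>t. cmod (cis (\<theta> * t) - 1) * norm x) \<longlongrightarrow> 0) (at_right 0)"
        by (auto simp: isCont_def filterlim_at_split)
      moreover have "((\<lambda>t. norm (S t x - x)) \<longlongrightarrow> 0) (at_right 0)"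
        using S(1) by (simp add: C0_semigroup_def)
      ultimately show ?thesis using tendsto_add by fastforce
    qed
    then show "((\<lambda>t. norm (cis (\<theta> * t) *\<^sub>C S t x - x)) \<longlongrightarrow> 0) (at_right 0)"
    proof (rule Lim_null_comparison[rotated])
      have "norm (cis (\<theta> * t) *\<^sub>C S t x - x) \<le> norm (S t x - x) + cmod (cis (\<theta> * t) - 1) * norm x" for t
      proof -
        have "cis (\<theta> * t) *\<^sub>C S t x - x = cis (\<theta> * t) *\<^sub>C (S t x - x) + (cis (\<theta> * t) - 1) *\<^sub>C x"
          using scaleC_add_left[of "cis (\<theta> * t) - 1" 1 x] scaleC_add_right[of "cis (\<theta> * t)" "S t x - x" x]
          by (simp add: algebra_simps)
        then show ?thesis
          using norm_triangle_ineq[of "cis (\<theta> * t) *\<^sub>C (S t x - x)" "(cis (\<theta> * t) - 1) *\<^sub>C x"]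
          by (simp add: norm_scaleC)
      qed
      then show "\<forall>\<^sub>F t in at_right 0. norm (norm (cis (\<theta> * t) *\<^sub>C S t x - x))
          \<le> norm (S t x - x) + cmod (cis (\<theta> * t) - 1) * norm x"
        by simp
    qed
  qed (rule lin')
  then show ?thesis
    unfolding C0_embeddable_def using S(2) c_eq by (intro exI[of _ "\<lambda>t x. cis (\<theta> * t) *\<^sub>C S t x"]) auto
qed

section \<open>The Toeplitz--Hausdorff theorem\<close>

text \<open>Given two values \<open>a\<close> and \<open>b\<close>, an affine change of \<open>T\<close> turns them into \<open>0\<close> and \<open>1\<close>. After adjusting the phase
  of one of the two vectors, the form is real along the segment joining them, and the intermediate value theorem
  applies to its normalized values.\<close>

theorem convex_numerical_range:
  fixes T :: "'a::complex_inner \<Rightarrow> 'a"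
  assumes "bounded_clinear T"
  shows "convex (numerical_range T)"
proof -
  have T_add: "T (x + y) = T x + T y" and T_scale: "T (c *\<^sub>C x) = c *\<^sub>C T x" for x y c
    using assms by (auto simp: bounded_clinear_def linear_add bounded_linear.linear)
  have seg: "(1 - s) * a + s * b \<in> numerical_range T"
    if ab: "a \<in> numerical_range T" "b \<in> numerical_range T" and s: "0 \<le> s" "s \<le> 1" for a b :: complex and s :: real
  proof (cases "a = b")
    case True
    then show ?thesis using ab by (simp add: algebra_simps)
  next
    case False
    obtain x y where x: "norm x = 1" "a = cinner (T x) x" and y: "norm y = 1" "b = cinner (T y) y"
      using ab unfolding numerical_range_def by blast
    \<comment> \<open>The sesquilinear form of \<open>(T - a) / (b - a)\<close>, with value \<open>0\<close> at \<open>x\<close> and \<open>1\<close> at \<open>y\<close>.\<close>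
    define q where "q u v = (cinner (T u) v - a * cinner u v) / (b - a)" for u v
    have q_add: "q (u + u') v = q u v + q u' v" "q v (u + u') = q v u + q v u'" for u u' v
      by (simp_all add: q_def T_add cinner_add_left cinner_add_right field_simps add_divide_distrib diff_divide_distrib)
    have q_scale: "q (c *\<^sub>C u) v = c * q u v" "q v (c *\<^sub>C u) = cnj c * q v u" for c u v
      by (simp_all add: q_def T_scale cinner_scaleC_left cinner_scaleC_right algebra_simps diff_divide_distrib)
    have qx: "q x x = 0" using x by (simp add: q_def cinner_self)
    have qy: "q y y = 1" using y False by (simp add: q_def cinner_self)
    define w where "w = q y x - cnj (q x y)"
    \<comment> \<open>The phase for which the mixed terms of the form add up to a real number.\<close>
    define l where "l = (if w = 0 then 1 else cnj (sgn w))"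
    have l: "cmod l = 1" by (simp add: l_def norm_sgn)
    have lw: "Im (l * w) = 0" by (simp add: l_def sgn_eq complex_mult_cnj)
    define k where "k = Re (l * q y x + cnj l * q x y)"
    have k: "l * q y x + cnj l * q x y = complex_of_real k"
      using lw by (simp add: complex_eq_iff k_def w_def algebra_simps)
    define z where "z r = complex_of_real (1 - r) *\<^sub>C x + (complex_of_real r * l) *\<^sub>C y" for r
    have qz: "q (z r) (z r) = complex_of_real (r\<^sup>2 + r * (1 - r) * k)" for r
    proof -
      have "q (z r) (z r) = complex_of_real (1 - r) * complex_of_real r * (l * q y x + cnj l * q x y)
          + (complex_of_real r)\<^sup>2 * (l * cnj l)"
        by (simp add: z_def q_add q_scale qx qy power2_eq_square algebra_simps)
      also have "l * cnj l = 1" using l by (simp flip: complex_norm_square)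
      finally show ?thesis by (simp add: k algebra_simps)
    qed
    \<comment> \<open>A zero of \<open>z\<close> would make \<open>x\<close> and \<open>y\<close> differ by a phase only, so that the form would agree at both.\<close>
    have z_nz: "z r \<noteq> 0" if r: "0 \<le> r" "r \<le> 1" for r
    proof
      assume 0: "z r = 0"
      then have x': "complex_of_real (1 - r) *\<^sub>C x = (- (complex_of_real r * l)) *\<^sub>C y"
        unfolding z_def using scaleC_add_left[of "complex_of_real r * l" "- (complex_of_real r * l)" y]
        by (simp add: eq_neg_iff_add_eq_0) (metis add.commute add_left_cancel)
      then have "norm (complex_of_real (1 - r) *\<^sub>C x) = norm ((- (complex_of_real r * l)) *\<^sub>C y)" by simp
      then have r2: "r = 1/2" using r x y l by (simp add: norm_scaleC norm_mult del: of_real_diff)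
      have "q (complex_of_real (1 - r) *\<^sub>C x) (complex_of_real (1 - r) *\<^sub>C x) = 0"
        by (simp add: q_scale qx)
      moreover have "q ((- (complex_of_real r * l)) *\<^sub>C y) ((- (complex_of_real r * l)) *\<^sub>C y) \<noteq> 0"
        using l r2 by (auto simp: q_scale qy)
      ultimately show False using x' by simp
    qed
    define h where "h r = (r\<^sup>2 + r * (1 - r) * k) / (norm (z r))\<^sup>2" for r
    have cont: "continuous_on {0..1} h"
    proof -
      have "continuous_on {0..1} z"
        unfolding z_def
        by (intro continuous_intros bounded_linear.continuous_on[OF bounded_linear_scaleC_left])
      then show ?thesis unfolding h_def by (intro continuous_intros) (auto simp: z_nz)
    qed
    have "h 0 = 0" "h 1 = 1" using x y l by (auto simp: h_def z_def norm_scaleC)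
    then obtain r where r: "0 \<le> r" "r \<le> 1" "h r = s"
      using IVT'[of h 0 s 1] cont s by auto
    define v where "v = complex_of_real (inverse (norm (z r))) *\<^sub>C z r"
    have nz: "norm (z r) \<noteq> 0" using z_nz r by simp
    have v: "norm v = 1" using nz by (simp add: v_def norm_scaleC norm_inverse)
    have "q v v = complex_of_real s"
      using nz r by (simp add: v_def q_scale qz h_def power2_eq_square field_simps)
    then have "cinner (T v) v - a = s * (b - a)"
      using v False by (simp add: q_def cinner_self field_simps)
    then have "cinner (T v) v = (1 - s) * a + s * b" by (simp add: algebra_simps)
    with v show ?thesis by (auto simp: numerical_range_def intro!: exI[of _ v])
  qed
  show ?thesis
    unfolding convex_alt using seg by (auto simp: scaleR_conv_of_real)
qed

text \<open>If \<open>W\<close> has no interior, it lies on a line and one side of a parallel line through \<open>0\<close> contains it. Otherwise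
  separate \<open>0\<close> from the interior, whose closure contains \<open>W\<close>.\<close>

lemma convex_in_half_plane:
  fixes W :: "complex set"
  assumes "convex W" "0 \<notin> interior W"
  obtains c where "cmod c = 1" "\<And>w. w \<in> W \<Longrightarrow> 0 \<le> Re (c * w)"
proof -
  obtain a where a: "a \<noteq> 0" "\<And>w. w \<in> W \<Longrightarrow> 0 \<le> inner a w"
  proof (cases "interior W = {}")
    case True
    then obtain a b where ab: "a \<noteq> 0" "W \<subseteq> {x. inner a x = b}"
      using empty_interior_subset_hyperplane[OF assms(1)] by blast
    show ?thesis
      by (rule that[of "if 0 \<le> b then a else - a"]) (use ab in auto)
  next
    case False
    then obtain a b where ab: "a \<noteq> 0" "\<forall>x\<in>{0}. inner a x \<le> b" "\<forall>x\<in>interior W. b \<le> inner a x"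
      using separating_hyperplane_sets[of "{0}" "interior W"] assms convex_interior by auto
    then have "interior W \<subseteq> {x. inner a x \<ge> 0}" by force
    then have "closure (interior W) \<subseteq> {x. inner a x \<ge> 0}"
      by (intro closure_minimal closed_halfspace_ge)
    then have "W \<subseteq> {x. inner a x \<ge> 0}"
      using convex_closure_interior[OF assms(1) False] closure_subset by blast
    with ab(1) show ?thesis by (intro that[of a]) auto
  qed
  show ?thesis
  proof (rule that[of "cnj (sgn a)"])
    show "cmod (cnj (sgn a)) = 1" using a by (simp add: norm_sgn)
    fix w assume "w \<in> W"
    then have "0 \<le> inner a w / norm a" using a by simp
    also have "inner a w / norm a = Re (cnj (sgn a) * w)"
      by (simp add: sgn_eq inner_complex_def add_divide_distrib)
    finally show "0 \<le> Re (cnj (sgn a) * w)" .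
  qed
qed

section \<open>Uniqueness of Fourier coefficients on the circle\<close>

lemma sets_circle_measure [simp, measurable_cong]: "sets circle_measure = sets borel"
  and space_circle_measure [simp]: "space circle_measure = UNIV"
  by (simp_all add: circle_measure_def)

lemma nn_integral_circle_measure:
  assumes [measurable]: "g \<in> borel_measurable borel"
  shows "(\<integral>\<^sup>+z. g z \<partial>circle_measure) =
    (\<integral>\<^sup>+x. g (cis x) * indicator {0..2*pi} x \<partial>lborel) / ennreal (2 * pi)"
proof -
  have [measurable]: "cis \<in> borel_measurable borel"
    by (intro borel_measurable_continuous_onI continuous_intros)
  have "(\<integral>\<^sup>+z. g z \<partial>circle_measure) = (\<integral>\<^sup>+x. g (cis x) \<partial>uniform_measure lborel {0..2*pi})"
    unfolding circle_measure_def by (intro nn_integral_distr) (auto intro: cis_borel_measurable)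
  then show ?thesis
    by (simp add: nn_integral_uniform_measure)
qed

interpretation circle: finite_measure circle_measure
proof (rule finite_measureI)
  have "emeasure circle_measure (space circle_measure) = (\<integral>\<^sup>+z. 1 \<partial>circle_measure)" by simp
  also have "\<dots> < \<infinity>"
    by (subst nn_integral_circle_measure) (auto simp: ennreal_divide_eq_top_iff)
  finally show "emeasure circle_measure (space circle_measure) \<noteq> \<infinity>" by simp
qed

lemma measure_circle: "measure circle_measure UNIV = 1"
proof -
  have "emeasure circle_measure UNIV = (\<integral>\<^sup>+z. 1 \<partial>circle_measure)" by simp
  also have "\<dots> = 1"
    by (subst nn_integral_circle_measure) (auto intro: ennreal_divide_self)
  finally show ?thesis by (simp add: measure_def)
qed

lemma AE_circle_norm: "AE z in circle_measure. cmod z = 1"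
  unfolding circle_measure_def
  by (subst AE_distr_iff) (use cis_borel_measurable in auto)

lemma borel_measurable_powi [measurable]: "(\<lambda>z::complex. z powi n) \<in> borel_measurable borel"
  using powi_borel_measurable[of n] by simp

lemma integrable_circle_mult:
  assumes h: "integrable circle_measure h" and [measurable]: "g \<in> borel_measurable borel"
    and bd: "AE z in circle_measure. cmod (g z) \<le> B"
  shows "integrable circle_measure (\<lambda>z. g z * h z)"
proof (rule Bochner_Integration.integrable_bound)
  show "integrable circle_measure (\<lambda>z. B * cmod (h z))" using h by simp
  show "(\<lambda>z. g z * h z) \<in> borel_measurable circle_measure"
    using borel_measurable_integrable[OF h] by measurable
  show "AE z in circle_measure. cmod (g z * h z) \<le> norm (B * cmod (h z))"
    using bd by eventually_elim
      (auto simp: norm_mult abs_mult intro!: mult_right_mono)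
qed

text \<open>The \<open>n\<close>-th integral is the Fourier coefficient of index \<open>- n\<close>, as \<open>z\<^sup>n\<close> is the conjugate of
  \<open>z^(-n)\<close> on the circle.\<close>

definition vanishing_coeffs :: "(complex \<Rightarrow> complex) \<Rightarrow> bool" where
  "vanishing_coeffs h \<longleftrightarrow> integrable circle_measure h \<and>
     (\<forall>n::int. (LINT z|circle_measure. z powi n * h z) = 0)"

lemma integrable_powi_mult:
  "integrable circle_measure h \<Longrightarrow> integrable circle_measure (\<lambda>z. z powi n * h z)"
  by (rule integrable_circle_mult[where B = 1]) (use AE_circle_norm in \<open>auto simp: norm_power_int\<close>)

lemma AE_powi_add: "AE z in circle_measure. z powi m * z powi n = z powi (m + n :: int)"
  using AE_circle_norm by eventually_elim (subst power_int_add, auto)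

lemma vanishing_coeffs_add:
  assumes "vanishing_coeffs f" "vanishing_coeffs g" shows "vanishing_coeffs (\<lambda>z. f z + g z)"
  using assms by (auto simp: vanishing_coeffs_def distrib_left integrable_powi_mult)

lemma vanishing_coeffs_scale:
  assumes "vanishing_coeffs f" shows "vanishing_coeffs (\<lambda>z. c * f z)"
  unfolding vanishing_coeffs_def
proof (intro conjI allI)
  show "integrable circle_measure (\<lambda>z. c * f z)" using assms by (simp add: vanishing_coeffs_def)
  fix n
  have "(\<lambda>z. z powi n * (c * f z)) = (\<lambda>z. c * (z powi n * f z))" by (simp add: mult.left_commute)
  then show "(LINT z|circle_measure. z powi n * (c * f z)) = 0"
    using assms by (simp add: vanishing_coeffs_def)
qed

lemma vanishing_coeffs_cong:
  assumes "AE z in circle_measure. f z = g z" "vanishing_coeffs f" "g \<in> borel_measurable borel"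
  shows "vanishing_coeffs g"
proof -
  have m[measurable]: "f \<in> borel_measurable borel"  "g \<in> borel_measurable borel"
    using assms(2,3) borel_measurable_integrable[of circle_measure f] by (auto simp: vanishing_coeffs_def)
  have "integrable circle_measure g"
    using assms(1,2) by (subst integrable_cong_AE[where g = f]) (auto simp: vanishing_coeffs_def)
  moreover have "(LINT z|circle_measure. z powi n * g z) = (LINT z|circle_measure. z powi n * f z)" for n
    by (rule integral_cong_AE) (use assms(1) in auto)
  ultimately show ?thesis using assms(2) by (simp add: vanishing_coeffs_def)
qed

lemma vanishing_coeffs_shift:
  assumes "vanishing_coeffs h" shows "vanishing_coeffs (\<lambda>z. z powi k * h z)"
proof -
  have [measurable]: "h \<in> borel_measurable borel"
    using assms borel_measurable_integrable[of circle_measure h] by (auto simp: vanishing_coeffs_def)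
  have "(LINT z|circle_measure. z powi n * (z powi k * h z)) = (LINT z|circle_measure. z powi (n + k) * h z)" for n
    by (rule integral_cong_AE) (use AE_powi_add[of n k] in \<open>auto elim!: eventually_mono simp flip: mult.assoc\<close>)
  then show ?thesis using assms by (auto simp: vanishing_coeffs_def integrable_powi_mult)
qed

text \<open>On the circle \<open>Re z\<close> and \<open>Im z\<close> are combinations of \<open>z\<close> and \<open>z^(-1)\<close>, and multiplication by these only
  shifts coefficients. Because the claim is that multiplication by \<open>p\<close> preserves the vanishing of all coefficients,
  it passes to products of polynomials at once.\<close>

lemma vanishing_coeffs_polynomial:
  assumes "real_polynomial_function p" "vanishing_coeffs h"
  shows "vanishing_coeffs (\<lambda>z. complex_of_real (p z) * h z)"
  using assms
proof (induction arbitrary: h rule: real_polynomial_function.induct)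
  case (linear p)
  have [measurable]: "h \<in> borel_measurable borel"
    using linear(2) borel_measurable_integrable[of circle_measure h] by (auto simp: vanishing_coeffs_def)
  have [measurable]: "p \<in> borel_measurable borel"
    using linear(1) by (intro borel_measurable_continuous_onI) (simp add: linear_continuous_on)
  define a b where "a = Complex (p 1 / 2) (- p \<i> / 2)" and "b = Complex (p 1 / 2) (p \<i> / 2)"
  have v: "vanishing_coeffs (\<lambda>z. a * (z powi 1 * h z) + b * (z powi (-1) * h z))"
    by (intro vanishing_coeffs_add vanishing_coeffs_scale vanishing_coeffs_shift linear(2))
  have p: "p z = Re z * p 1 + Im z * p \<i>" for z
  proof -
    have l: "Real_Vector_Spaces.linear p" using linear(1) by (rule bounded_linear.linear)
    have "z = Re z *\<^sub>R 1 + Im z *\<^sub>R \<i>" by (simp add: complex_eq_iff)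
    then have "p z = p (Re z *\<^sub>R 1 + Im z *\<^sub>R \<i>)" by (rule arg_cong)
    then show ?thesis by (simp only: linear_add[OF l] linear_scale[OF l] real_scaleR_def)
  qed
  have "AE z in circle_measure. a * (z powi 1 * h z) + b * (z powi (-1) * h z) = complex_of_real (p z) * h z"
    using AE_circle_norm
  proof eventually_elim
    case (elim z)
    have "z * cnj z = 1" using elim by (simp flip: complex_norm_square)
    then have inv: "z powi (-1) = cnj z"
      by (simp add: power_int_minus inverse_unique)
    have "a * z + b * cnj z = complex_of_real (p z)"
      by (simp add: p[of z] a_def b_def complex_eq_iff algebra_simps)
    then show ?case unfolding inv by (simp flip: mult.assoc distrib_right)
  qed
  then show ?case
    by (rule vanishing_coeffs_cong[OF _ v]) measurable
next
  case (const c)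
  then show ?case by (rule vanishing_coeffs_scale)
next
  case (add f g)
  then show ?case using vanishing_coeffs_add[OF add(3)[OF add(5)] add(4)[OF add(5)]] by (simp add: distrib_right)
next
  case (mult f g)
  then show ?case using mult(3)[OF mult(4)[OF mult(5)]] by (simp add: mult.assoc)
qed

text \<open>Stone--Weierstrass: approximate \<open>\<phi>\<close> uniformly on the circle by polynomials, whose integrals against \<open>h\<close> are
  zero.\<close>

lemma vanishing_coeffs_continuous:
  fixes \<phi> :: "complex \<Rightarrow> real"
  assumes \<phi>: "continuous_on UNIV \<phi>" and h: "vanishing_coeffs h"
  shows "(LINT z|circle_measure. complex_of_real (\<phi> z) * h z) = 0"
proof (rule ccontr)
  let ?I = "LINT z|circle_measure. complex_of_real (\<phi> z) * h z"
  assume "?I \<noteq> 0"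
  define K where "K = (LINT z|circle_measure. cmod (h z)) + 1"
  have hi: "integrable circle_measure h" using h by (simp add: vanishing_coeffs_def)
  have K: "0 < K" by (auto simp: K_def intro!: add_nonneg_pos)
  define e where "e = cmod ?I / (2 * K)"
  have e: "0 < e" using \<open>?I \<noteq> 0\<close> K by (simp add: e_def)
  have [measurable]: "\<phi> \<in> borel_measurable borel"
    using \<phi> by (rule borel_measurable_continuous_onI)
  obtain p where p: "real_polynomial_function p" "\<And>z. z \<in> sphere 0 1 \<Longrightarrow> \<bar>\<phi> z - p z\<bar> < e"
    using Stone_Weierstrass_real_polynomial_function[of "sphere 0 1" \<phi> e]
      continuous_on_subset[OF \<phi>] e by auto
  have [measurable]: "p \<in> borel_measurable borel"
    using p(1) by (intro borel_measurable_continuous_onI continuous_real_polymonial_function continuous_at_imp_continuous_on ballI)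
  have v: "vanishing_coeffs (\<lambda>z. complex_of_real (p z) * h z)"
    using vanishing_coeffs_polynomial[OF p(1) h] .
  then have pi: "integrable circle_measure (\<lambda>z. complex_of_real (p z) * h z)"
    and p0: "(LINT z|circle_measure. complex_of_real (p z) * h z) = 0"
    using conjunct1[OF v[unfolded vanishing_coeffs_def]]
      conjunct2[OF v[unfolded vanishing_coeffs_def], THEN spec[of _ 0]] by simp_all
  have AEp: "AE z in circle_measure. \<bar>\<phi> z - p z\<bar> \<le> e"
    using AE_circle_norm by eventually_elim (use p(2) less_imp_le in auto)
  have di: "integrable circle_measure (\<lambda>z. complex_of_real (\<phi> z - p z) * h z)"
    by (rule integrable_circle_mult[OF hi, where B = e]) (use AEp in \<open>auto simp del: of_real_diff\<close>)
  have "?I = (LINT z|circle_measure. complex_of_real (\<phi> z - p z) * h z + complex_of_real (p z) * h z)"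
    by (intro Bochner_Integration.integral_cong) (auto simp: algebra_simps)
  also have "\<dots> = (LINT z|circle_measure. complex_of_real (\<phi> z - p z) * h z)"
    using di pi p0 by (subst Bochner_Integration.integral_add) auto
  finally have I: "?I = (LINT z|circle_measure. complex_of_real (\<phi> z - p z) * h z)" .
  have "cmod (LINT z|circle_measure. complex_of_real (\<phi> z - p z) * h z)
      \<le> (LINT z|circle_measure. cmod (complex_of_real (\<phi> z - p z) * h z))"
    by (rule integral_norm_bound)
  also have "\<dots> \<le> (LINT z|circle_measure. e * cmod (h z))"
  proof (rule integral_mono_AE)
    show "AE z in circle_measure. cmod (complex_of_real (\<phi> z - p z) * h z) \<le> e * cmod (h z)"
      using AEp by eventually_elim
        (simp only: norm_mult norm_of_real, rule mult_right_mono, auto)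
  qed (use di hi in auto)
  also have "\<dots> \<le> e * K" using e hi by (simp add: K_def)
  also have "\<dots> = cmod ?I / 2" using K by (simp add: e_def)
  finally show False using \<open>?I \<noteq> 0\<close> unfolding I by simp
qed

text \<open>The indicator of a closed set is a bounded pointwise limit of continuous functions; closed sets generate the
  Borel sets and are stable under intersection.\<close>

lemma vanishing_coeffs_set:
  assumes h: "vanishing_coeffs h" and "A \<in> sets borel"
  shows "(LINT z:A|circle_measure. h z) = 0"
proof -
  have hi: "integrable circle_measure h" using h by (simp add: vanishing_coeffs_def)
  have [measurable]: "h \<in> borel_measurable borel"
    using borel_measurable_integrable[OF hi] by simp
  have set_i: "set_integrable circle_measure A h" if "A \<in> sets borel" for A
    using integrable_mult_indicator[OF _ hi, of A] that by (simp add: set_integrable_def)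
  have total: "(LINT z|circle_measure. h z) = 0"
    using h by (auto simp: vanishing_coeffs_def dest: spec[of _ 0])
  have cl: "(LINT z:A|circle_measure. h z) = 0" if A: "closed A" for A :: "complex set"
  proof (cases "A = {}")
    case False
    have [measurable]: "A \<in> sets borel" using A by simp
    have hm: "h \<in> borel_measurable circle_measure" using hi by simp
    define \<phi> where "\<phi> n z = max 0 (1 - real n * infdist z A)" for n z
    have cont: "continuous_on UNIV (\<phi> n)" for n
      unfolding \<phi>_def by (intro continuous_intros)
    have m: "\<phi> n \<in> borel_measurable borel" for n
      using cont by (rule borel_measurable_continuous_onI)
    have lim: "(\<lambda>n. \<phi> n z) \<longlonglongrightarrow> indicator A z" for z
    proof (cases "z \<in> A")
      case True
      then show ?thesis by (simp add: \<phi>_def)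
    next
      case zA: False
      have d: "0 < infdist z A" using infdist_pos_not_in_closed[OF A False zA] .
      obtain N where N: "1 < real N * infdist z A" using reals_Archimedean3[OF d] by blast
      have ge: "1 \<le> real n * infdist z A" if "N \<le> n" for n
        using order.trans[OF less_imp_le[OF N] mult_right_mono[of "real N" "real n" "infdist z A"]] that d
        by simp
      then have "\<phi> n z = 0" if "N \<le> n" for n
        using ge[OF that] by (simp add: \<phi>_def max_def)
      then show ?thesis using zA
        by (intro tendsto_eventually) (auto simp: eventually_sequentially)
    qed
    have "(\<lambda>n. LINT z|circle_measure. complex_of_real (\<phi> n z) * h z) \<longlonglongrightarrow>
        (LINT z|circle_measure. complex_of_real (indicator A z) * h z)"
    proof (rule integral_dominated_convergence[where w = "\<lambda>z. cmod (h z)"])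
      show "AE z in circle_measure. (\<lambda>n. complex_of_real (\<phi> n z) * h z) \<longlonglongrightarrow> complex_of_real (indicator A z) * h z"
        using lim by (intro always_eventually allI tendsto_intros)
      show "AE z in circle_measure. cmod (complex_of_real (\<phi> n z) * h z) \<le> cmod (h z)" for n
        by (intro always_eventually allI) (auto simp: \<phi>_def norm_mult infdist_nonneg intro!: mult_left_le_one_le)
      show "(\<lambda>z. complex_of_real (indicator A z) * h z) \<in> borel_measurable circle_measure"
        using hm by measurable
      show "(\<lambda>z. complex_of_real (\<phi> n z) * h z) \<in> borel_measurable circle_measure" for n
        using m[of n] hm by measurable
    qed (use hi in auto)
    then have "(LINT z|circle_measure. complex_of_real (indicator A z) * h z) = 0"
      using vanishing_coeffs_continuous[OF cont h] by (simp add: LIMSEQ_unique)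
    then show ?thesis by (simp add: set_lebesgue_integral_def scaleR_conv_of_real)
  qed (simp add: set_lebesgue_integral_def)
  have "Int_stable {A :: complex set. closed A}" by (auto simp: Int_stable_def)
  moreover have "{A :: complex set. closed A} \<subseteq> Pow UNIV" by simp
  moreover have "A \<in> sigma_sets UNIV {A. closed A}"
    using assms(2) by (simp add: borel_eq_closed)
  ultimately show ?thesis
  proof (induction rule: sigma_sets_induct_disjoint)
    case (basic A)
    then show ?case using cl by simp
  next
    case (compl A)
    then have [measurable]: "A \<in> sets borel" by (simp add: borel_eq_closed)
    have "(LINT z:(A \<union> (UNIV - A))|circle_measure. h z) = (LINT z:A|circle_measure. h z) + (LINT z:(UNIV - A)|circle_measure. h z)"
      by (rule set_integral_Un) (auto intro!: set_i)
    then show ?case using compl total by (simp add: set_lebesgue_integral_def)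
  next
    case (union A)
    then have m: "A i \<in> sets borel" for i by (auto simp: borel_eq_closed)
    have "(LINT z:(\<Union>i. A i)|circle_measure. h z) = (\<Sum>i. LINT z:A i|circle_measure. h z)"
      using union(1) m by (intro lebesgue_integral_countable_add) (auto intro!: set_i simp: disjoint_family_on_def)
    then show ?case using union by simp
  qed (simp add: set_lebesgue_integral_def)
qed

theorem vanishing_coeffs_AE_zero:
  assumes h: "vanishing_coeffs h"
  shows "AE z in circle_measure. h z = 0"
proof -
  have hi: "integrable circle_measure h" using h by (simp add: vanishing_coeffs_def)
  have set_i: "integrable circle_measure (\<lambda>z. indicator A z *\<^sub>R h z)" if "A \<in> sets borel" for A
    using integrable_mult_indicator[OF _ hi, of A] that by simp
  have "(LINT z:A|circle_measure. Re (h z)) = Re (LINT z:A|circle_measure. h z)"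
      "(LINT z:A|circle_measure. Im (h z)) = Im (LINT z:A|circle_measure. h z)" if "A \<in> sets borel" for A
    using integral_Re[OF set_i[OF that]] integral_Im[OF set_i[OF that]] by (simp_all add: set_lebesgue_integral_def)
  then have z: "(LINT z:A|circle_measure. Re (h z)) = 0" "(LINT z:A|circle_measure. Im (h z)) = 0"
    if "A \<in> sets borel" for A
    using vanishing_coeffs_set[OF h that] that by simp_all
  have "AE z in circle_measure. Re (h z) = 0"
    by (rule density_unique_real) (use hi z in \<open>auto simp: set_lebesgue_integral_def\<close>)
  moreover have "AE z in circle_measure. Im (h z) = 0"
    by (rule density_unique_real) (use hi z in \<open>auto simp: set_lebesgue_integral_def\<close>)
  ultimately show ?thesis by eventually_elim (simp add: complex_eq_iff)
qed

section \<open>Completeness of L2 of the circle\<close>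

lemma circle_L2_cases:
  obtains f where "f \<in> circle_sqint" "x = abs_circle_L2 f"
  by (induction x rule: circle_L2.abs_induct) auto

lemma circle_sqint_measurable: "f \<in> circle_sqint \<Longrightarrow> f \<in> borel_measurable borel"
  by (auto simp: circle_sqint_def)

lemma abs_circle_L2_eq:
  assumes "f \<in> circle_sqint" "g \<in> circle_sqint"
  shows "abs_circle_L2 f = abs_circle_L2 g \<longleftrightarrow> (AE z in circle_measure. f z = g z)"
  using Quotient_rel[OF Quotient_circle_L2, of f g] assms by auto

lemma circle_L2_operations:
  assumes "f \<in> circle_sqint" "g \<in> circle_sqint"
  shows "abs_circle_L2 f + abs_circle_L2 g = abs_circle_L2 (\<lambda>z. f z + g z)"
    and "abs_circle_L2 f - abs_circle_L2 g = abs_circle_L2 (\<lambda>z. f z - g z)"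
    and "c *\<^sub>C abs_circle_L2 f = abs_circle_L2 (\<lambda>z. c * f z)"
    and "cinner (abs_circle_L2 f) (abs_circle_L2 g) = (LINT z|circle_measure. f z * cnj (g z))"
  using assms by (simp_all add: plus_circle_L2.abs_eq minus_circle_L2.abs_eq scaleC_circle_L2.abs_eq
      cinner_circle_L2_def circle_cinner.abs_eq)

lemma circle_mult_abs:
  "F \<in> circle_Linf \<Longrightarrow> f \<in> circle_sqint \<Longrightarrow> circle_mult F (abs_circle_L2 f) = abs_circle_L2 (\<lambda>z. F z * f z)"
  by (simp add: circle_mult.abs_eq)

lemma norm_circle_L2_sq:
  assumes "f \<in> circle_sqint"
  shows "(norm (abs_circle_L2 f))\<^sup>2 = (LINT z|circle_measure. (cmod (f z))\<^sup>2)"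
proof -
  have "complex_of_real ((norm (abs_circle_L2 f))\<^sup>2) = (LINT z|circle_measure. f z * cnj (f z))"
    using assms by (simp only: cinner_self[symmetric] circle_L2_operations)
  also have "\<dots> = complex_of_real (LINT z|circle_measure. (cmod (f z))\<^sup>2)"
    by (simp only: complex_norm_square[symmetric] integral_complex_of_real)
  finally show ?thesis by (simp only: of_real_eq_iff)
qed

lemma nn_integral_circle_L2:
  assumes "f \<in> circle_sqint"
  shows "(\<integral>\<^sup>+z. ennreal ((cmod (f z))\<^sup>2) \<partial>circle_measure) = ennreal ((norm (abs_circle_L2 f))\<^sup>2)"
  unfolding norm_circle_L2_sq[OF assms] using assms
  by (intro nn_integral_eq_integral) (auto simp: circle_sqint_def)

lemma circle_sqintI:
  assumes [measurable]: "f \<in> borel_measurable borel"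
    and "(\<integral>\<^sup>+z. ennreal ((cmod (f z))\<^sup>2) \<partial>circle_measure) < \<infinity>"
  shows "f \<in> circle_sqint"
  unfolding circle_sqint_def using assms by (auto intro!: integrableI_bounded)

lemma norm_circle_L2_le:
  assumes "f \<in> circle_sqint" "0 \<le> e"
    and "(\<integral>\<^sup>+z. ennreal ((cmod (f z))\<^sup>2) \<partial>circle_measure) \<le> ennreal (e\<^sup>2)"
  shows "norm (abs_circle_L2 f) \<le> e"
proof (rule power2_le_imp_le[OF _ assms(2)])
  show "(norm (abs_circle_L2 f))\<^sup>2 \<le> e\<^sup>2"
    using assms(3) unfolding nn_integral_circle_L2[OF assms(1)] by (simp add: ennreal_le_iff)
qed

lemma circle_sqint_integrable_self:
  assumes "f \<in> circle_sqint" shows "integrable circle_measure f"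
  using circle_sqint_integrable[OF assms circle_sqint_powi[of 0]] by simp

text \<open>Integrate \<open>|w| \<le> (e + |w|\<^sup>2 / e) / 2\<close> over the circle, whose total mass is \<open>1\<close>.\<close>

lemma circle_L1_le_L2:
  assumes f: "f \<in> circle_sqint" and e: "0 < e" "norm (abs_circle_L2 f) \<le> e"
  shows "(LINT z|circle_measure. cmod (f z)) \<le> e"
proof -
  have i: "integrable circle_measure (\<lambda>z. (cmod (f z))\<^sup>2)" using f by (simp add: circle_sqint_def)
  have pt: "cmod w \<le> (e + (cmod w)\<^sup>2 / e) / 2" for w
    using e zero_le_power2[of "cmod w - e"] by (simp add: field_simps power2_eq_square)
  have "(LINT z|circle_measure. cmod (f z)) \<le> (LINT z|circle_measure. (e + (cmod (f z))\<^sup>2 / e) / 2)"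
    by (rule integral_mono) (use i circle_sqint_integrable_self[OF f] pt in auto)
  also have "\<dots> = (e + (norm (abs_circle_L2 f))\<^sup>2 / e) / 2"
    using i by (simp add: measure_circle norm_circle_L2_sq[OF f])
  also have "\<dots> \<le> (e + e\<^sup>2 / e) / 2"
    using e by (intro divide_right_mono add_left_mono power_mono) auto
  finally show ?thesis using e by (simp add: power2_eq_square)
qed

text \<open>Riesz--Fischer. A Cauchy sequence in \<open>L\<^sup>2\<close> is Cauchy in \<open>L\<^sup>1\<close> and so has an almost everywhere convergent
  subsequence; Fatou's lemma bounds the distance to its pointwise limit.\<close>

instance circle_L2 :: banach
proof
  fix X :: "nat \<Rightarrow> circle_L2" assume X: "Cauchy X"
  have "\<exists>f. f \<in> circle_sqint \<and> X n = abs_circle_L2 f" for n by (metis circle_L2_cases)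
  then obtain f where f: "\<And>n. f n \<in> circle_sqint" "\<And>n. X n = abs_circle_L2 (f n)" by metis
  have fm[measurable]: "f n \<in> borel_measurable borel" for n using f(1) by (rule circle_sqint_measurable)
  have diff: "X m - X n = abs_circle_L2 (\<lambda>z. f m z - f n z)" for m n
    by (simp add: f circle_L2_operations)
  have small: "\<exists>N. \<forall>m\<ge>N. \<forall>n\<ge>N. norm (abs_circle_L2 (\<lambda>z. f m z - f n z)) < e" if "0 < e" for e
    using CauchyD[OF X that] by (simp add: diff)
  \<comment> \<open>An almost everywhere convergent subsequence, from convergence in \<open>L\<^sup>1\<close>.\<close>
  obtain r where r: "strict_mono r" "AE z in circle_measure. Cauchy (\<lambda>i. f (r i) z)"
  proof (rule cauchy_L1_AE_cauchy_subseq[where M = circle_measure and s = f])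
    show "integrable circle_measure (f n)" for n by (rule circle_sqint_integrable_self[OF f(1)])
    fix e :: real assume e: "0 < e"
    from small[of "e/2"] e obtain N where
      N: "\<And>m n. N \<le> m \<Longrightarrow> N \<le> n \<Longrightarrow> norm (abs_circle_L2 (\<lambda>z. f m z - f n z)) < e / 2" by auto
    show "\<exists>N. \<forall>i\<ge>N. \<forall>j\<ge>N. (LINT x|circle_measure. cmod (f i x - f j x)) < e"
    proof (intro exI allI impI)
      fix i j assume "N \<le> i" "N \<le> j"
      from N[OF this] have "(LINT x|circle_measure. cmod (f i x - f j x)) \<le> e / 2"
        using e by (intro circle_L1_le_L2 circle_sqint_diff f(1)) auto
      then show "(LINT x|circle_measure. cmod (f i x - f j x)) < e" using e by simp
    qed
  qed
  define g where "g z = lim (\<lambda>i. f (r i) z)" for z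
  have gm[measurable]: "g \<in> borel_measurable borel"
    unfolding g_def by (rule borel_measurable_lim_metric) simp
  have lim: "AE z in circle_measure. (\<lambda>i. f (r i) z) \<longlonglongrightarrow> g z"
    using r(2) by eventually_elim (simp add: g_def Cauchy_convergent_iff convergent_LIMSEQ_iff)
  \<comment> \<open>Fatou's lemma along the subsequence.\<close>
  have bound: "(\<integral>\<^sup>+z. ennreal ((cmod (f n z - g z))\<^sup>2) \<partial>circle_measure) \<le> ennreal (e\<^sup>2)"
    if N: "\<And>m n. N \<le> m \<Longrightarrow> N \<le> n \<Longrightarrow> norm (abs_circle_L2 (\<lambda>z. f m z - f n z)) < e" and "N \<le> n" for n N e
  proof -
    have "(\<integral>\<^sup>+z. ennreal ((cmod (f n z - g z))\<^sup>2) \<partial>circle_measure)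
        = (\<integral>\<^sup>+z. liminf (\<lambda>i. ennreal ((cmod (f n z - f (r i) z))\<^sup>2)) \<partial>circle_measure)"
    proof (rule nn_integral_cong_AE)
      show "AE z in circle_measure. ennreal ((cmod (f n z - g z))\<^sup>2)
          = liminf (\<lambda>i. ennreal ((cmod (f n z - f (r i) z))\<^sup>2))"
        using lim
      proof eventually_elim
        case (elim z)
        then have "(\<lambda>i. ennreal ((cmod (f n z - f (r i) z))\<^sup>2)) \<longlonglongrightarrow> ennreal ((cmod (f n z - g z))\<^sup>2)"
          by (intro tendsto_intros)
        then show ?case by (intro lim_imp_Liminf[symmetric]) auto
      qed
    qed
    also have "\<dots> \<le> liminf (\<lambda>i. \<integral>\<^sup>+z. ennreal ((cmod (f n z - f (r i) z))\<^sup>2) \<partial>circle_measure)"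
      by (rule nn_integral_liminf) measurable
    also have "\<dots> \<le> ennreal (e\<^sup>2)"
    proof (rule Liminf_le)
      show "\<forall>\<^sub>F i in sequentially. (\<integral>\<^sup>+z. ennreal ((cmod (f n z - f (r i) z))\<^sup>2) \<partial>circle_measure) \<le> ennreal (e\<^sup>2)"
      proof (rule eventually_sequentiallyI)
        fix i assume "N \<le> i"
        then have "N \<le> r i" using seq_suble[OF r(1), of i] by simp
        from N[OF \<open>N \<le> n\<close> this] show "(\<integral>\<^sup>+z. ennreal ((cmod (f n z - f (r i) z))\<^sup>2) \<partial>circle_measure) \<le> ennreal (e\<^sup>2)"
          by (subst nn_integral_circle_L2) (auto intro!: circle_sqint_diff f(1) ennreal_leI power_mono)
      qed
    qed simp
    finally show ?thesis .
  qed
  have dsq: "(\<lambda>z. f n z - g z) \<in> circle_sqint"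
    if N: "\<And>m n. N \<le> m \<Longrightarrow> N \<le> n \<Longrightarrow> norm (abs_circle_L2 (\<lambda>z. f m z - f n z)) < e" and "N \<le> n" for n N e
    using order.strict_trans1[OF bound[OF N \<open>N \<le> n\<close>] ennreal_less_top] by (intro circle_sqintI) auto
  obtain N1 where N1: "\<And>m n. N1 \<le> m \<Longrightarrow> N1 \<le> n \<Longrightarrow> norm (abs_circle_L2 (\<lambda>z. f m z - f n z)) < 1"
    using small[of 1] by auto
  have g: "g \<in> circle_sqint"
    using circle_sqint_diff[OF f(1)[of N1] dsq[where N = N1 and n = N1 and e = 1]] N1 by simp
  have "X \<longlonglongrightarrow> abs_circle_L2 g"
  proof (rule LIMSEQ_I)
    fix e :: real assume e: "0 < e"
    from small[of "e/2"] e obtain N where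
      N: "\<And>m n. N \<le> m \<Longrightarrow> N \<le> n \<Longrightarrow> norm (abs_circle_L2 (\<lambda>z. f m z - f n z)) < e / 2" by auto
    show "\<exists>N. \<forall>n\<ge>N. norm (X n - abs_circle_L2 g) < e"
    proof (intro exI allI impI)
      fix n assume "N \<le> n"
      have "norm (abs_circle_L2 (\<lambda>z. f n z - g z)) \<le> e / 2"
        using bound[OF N \<open>N \<le> n\<close>] e by (intro norm_circle_L2_le dsq[OF N \<open>N \<le> n\<close>]) auto
      then show "norm (X n - abs_circle_L2 g) < e" using e by (simp add: f circle_L2_operations g)
    qed
  qed
  then show "convergent X" by (auto simp: convergent_def)
qed

section \<open>The trigonometric orthonormal basis\<close>

definition character :: "int \<Rightarrow> circle_L2" where
  "character n = abs_circle_L2 (\<lambda>z. z powi n)"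

lemma fourier_coeff_eq_cinner: "fourier_coeff x n = cinner x (character n)"
proof (cases x rule: circle_L2_cases)
  case (1 f)
  then show ?thesis
    by (simp add: character_def circle_L2_operations circle_sqint_powi fourier_coeff.abs_eq del: complex_cnj_power_int)
qed

lemma AE_cnj_powi: "AE z in circle_measure. cnj (z powi n) = z powi (- n)"
  using AE_circle_norm
proof eventually_elim
  case (elim z)
  have "z powi n * cnj (z powi n) = 1"
    using elim by (simp flip: complex_norm_square add: norm_power_int del: complex_cnj_power_int)
  then show ?case by (metis inverse_unique power_int_minus)
qed

lemma fourier_uniqueness:
  assumes "\<And>n. fourier_coeff x n = 0" shows "x = 0"
proof (cases x rule: circle_L2_cases)
  case (1 f)
  have [measurable]: "f \<in> borel_measurable borel" using 1 circle_sqint_measurable by auto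
  have "(LINT z|circle_measure. z powi n * f z) = 0" for n
  proof -
    have "(LINT z|circle_measure. z powi n * f z) = (LINT z|circle_measure. f z * cnj (z powi (- n)))"
      by (rule integral_cong_AE)
        (use AE_cnj_powi[of "-n"] in \<open>auto elim!: eventually_mono simp del: complex_cnj_power_int\<close>)
    also have "\<dots> = fourier_coeff x (- n)" using 1 by (simp add: fourier_coeff.abs_eq del: complex_cnj_power_int)
    finally show ?thesis using assms by simp
  qed
  then have "vanishing_coeffs f"
    using 1 circle_sqint_integrable_self by (simp add: vanishing_coeffs_def)
  from vanishing_coeffs_AE_zero[OF this] 1 show ?thesis
    by (simp add: zero_circle_L2.abs_eq abs_circle_L2_eq circle_sqint_zero)
qed

text \<open>On the interval \<open>[0, 2 \<pi>]\<close> the integrand is \<open>e^(ikx)\<close>, which for \<open>k \<noteq> 0\<close> has a periodic antiderivative.\<close>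

lemma integral_powi: "(LINT z|circle_measure. z powi k) = (if k = 0 then 1 else 0)"
proof (cases "k = 0")
  case True
  then show ?thesis by (simp add: measure_circle)
next
  case False
  have [measurable]: "cis \<in> borel_measurable borel"
    by (intro borel_measurable_continuous_onI continuous_intros)
  define F where "F x = - \<i> / of_int k * cis (of_int k * x)" for x
  have F: "(F has_vector_derivative cis (of_int k * x)) (at x within S)" for x S
  proof -
    have "((\<lambda>w. - \<i> / of_int k * exp (\<i> * (of_int k * w))) has_field_derivative
        exp (\<i> * (of_int k * complex_of_real x))) (at (complex_of_real x))"
      using False by (auto intro!: derivative_eq_intros)
    from has_vector_derivative_real_field[OF this] show ?thesis
      unfolding F_def[abs_def] by (simp add: cis_conv_exp)
  qed
  have "F (2 * pi) = F 0"
    by (simp add: F_def cis_conv_exp exp_eq_1 field_simps)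
  have "uniform_measure lborel {0..2*pi} = density lborel (\<lambda>x. ennreal (indicator {0..2*pi} x / (2 * pi)))"
    unfolding uniform_measure_def
    by (intro arg_cong[where f = "density lborel"] ext) (auto simp: indicator_def divide_ennreal simp flip: ennreal_1)
  then have "(LINT z|circle_measure. z powi k)
      = (LINT x|density lborel (\<lambda>x. ennreal (indicator {0..2*pi} x / (2 * pi))). cis x powi k)"
    unfolding circle_measure_def by (subst integral_distr) (auto intro: cis_borel_measurable)
  also have "\<dots> = (LINT x|lborel. (indicator {0..2*pi} x / (2 * pi)) *\<^sub>R (cis x powi k))"
    by (rule integral_density) auto
  also have "\<dots> = (LINT x|lborel. (1 / (2 * pi)) *\<^sub>R (indicator {0..2*pi} x *\<^sub>R cis (of_int k * x)))"
    by (intro Bochner_Integration.integral_cong) (auto simp: cis_power_int)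
  also have "\<dots> = (1 / (2 * pi)) *\<^sub>R (LINT x|lborel. indicator {0..2*pi} x *\<^sub>R cis (of_int k * x))"
    by (rule integral_scaleR_right)
  also have "(LINT x|lborel. indicator {0..2*pi} x *\<^sub>R cis (of_int k * x)) = F (2 * pi) - F 0"
    by (rule integral_FTC_Icc[OF _ F]) (auto intro!: continuous_intros)
  finally show ?thesis using \<open>F (2 * pi) = F 0\<close> False by simp
qed

lemma cinner_character: "cinner (character m) (character n) = (if m = n then 1 else 0)"
proof -
  have "cinner (character m) (character n) = (LINT z|circle_measure. z powi m * cnj (z powi n))"
    unfolding character_def by (rule circle_L2_operations(4)) (rule circle_sqint_powi)+
  also have "\<dots> = (LINT z|circle_measure. z powi (m + - n))"
  proof (rule integral_cong_AE)
    show "AE z in circle_measure. z powi m * cnj (z powi n) = z powi (m + - n)"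
      using AE_cnj_powi[of n] AE_powi_add[of m "-n"] by eventually_elim presburger
  qed (auto simp del: complex_cnj_power_int)
  finally show ?thesis by (simp add: integral_powi)
qed

section \<open>The Hardy space and Toeplitz operators\<close>

lemma range_hardy2_to_L2_iff: "x \<in> range hardy2_to_L2 \<longleftrightarrow> (\<forall>n<0. fourier_coeff x n = 0)"
proof
  show "x \<in> range hardy2_to_L2 \<Longrightarrow> \<forall>n<0. fourier_coeff x n = 0"
    using hardy2_to_L2 by blast
  assume "\<forall>n<0. fourier_coeff x n = 0"
  then have "hardy2_to_L2 (Abs_hardy2 x) = x" by (simp add: Abs_hardy2_inverse)
  then show "x \<in> range hardy2_to_L2" by (metis rangeI)
qed

lemma hardy2_to_L2_simps:
  "hardy2_to_L2 (x + y) = hardy2_to_L2 x + hardy2_to_L2 y"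
  "hardy2_to_L2 (x - y) = hardy2_to_L2 x - hardy2_to_L2 y"
  "hardy2_to_L2 (c *\<^sub>C x) = c *\<^sub>C hardy2_to_L2 x"
  "hardy2_to_L2 (r *\<^sub>R x) = r *\<^sub>R hardy2_to_L2 x"
  "hardy2_to_L2 0 = 0"
  by (simp_all add: plus_hardy2.rep_eq minus_hardy2.rep_eq scaleC_hardy2.rep_eq
      scaleR_hardy2.rep_eq zero_hardy2.rep_eq)

lemma cinner_hardy2: "cinner x y = cinner (hardy2_to_L2 x) (hardy2_to_L2 y)"
  by (simp add: cinner_hardy2.rep_eq)

lemma norm_hardy2: "norm x = norm (hardy2_to_L2 x)"
  by (simp add: norm_hardy2.rep_eq)

lemma closed_hardy2: "closed (range hardy2_to_L2)"
proof -
  have "range hardy2_to_L2 = (\<Inter>n\<in>{..<0}. {x. cinner x (character n) = 0})"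
    unfolding set_eq_iff range_hardy2_to_L2_iff fourier_coeff_eq_cinner by auto
  moreover have "closed {x. cinner x (character n) = 0}" for n
    by (intro closed_Collect_eq bounded_linear.continuous_on[OF bounded_linear_cinner(1)] continuous_intros)
  ultimately show ?thesis by auto
qed

lemma subspace_hardy2: "subspace (range hardy2_to_L2)"
  by (rule subspaceI) (auto simp flip: hardy2_to_L2_simps)

instance hardy2 :: banach
proof
  fix X :: "nat \<Rightarrow> hardy2" assume X: "Cauchy X"
  have "Cauchy (\<lambda>n. hardy2_to_L2 (X n))"
    using X by (simp add: Cauchy_def dist_norm norm_hardy2 hardy2_to_L2_simps)
  then obtain L where L: "(\<lambda>n. hardy2_to_L2 (X n)) \<longlonglongrightarrow> L"
    using Cauchy_convergent_iff convergent_def by blast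
  then have "L \<in> range hardy2_to_L2" by (intro closed_sequentially[OF closed_hardy2 _ L]) auto
  then obtain y where "L = hardy2_to_L2 y" by blast
  then have "X \<longlonglongrightarrow> y"
    using L by (simp add: LIMSEQ_iff norm_hardy2 hardy2_to_L2_simps)
  then show "convergent X" by (auto simp: convergent_def)
qed

lemma hardy2_scaleC_closed: "y \<in> range hardy2_to_L2 \<Longrightarrow> c *\<^sub>C y \<in> range hardy2_to_L2"
  by (auto simp flip: hardy2_to_L2_simps)

text \<open>The definite description is justified by the projection theorem, since the Hardy space is closed. From here on
  the projection is used through this identity alone.\<close>

lemma riesz_proj:
  "cinner (hardy2_to_L2 (riesz_proj g)) (hardy2_to_L2 k) = cinner g (hardy2_to_L2 k)"
proof -
  let ?P = "\<lambda>h. \<forall>k. cinner (g - hardy2_to_L2 h) (hardy2_to_L2 k) = 0"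
  obtain h where h: "\<forall>z\<in>range hardy2_to_L2. inner (g - hardy2_to_L2 h) z = 0"
    using closed_subspace_projection[OF subspace_hardy2 closed_hardy2, of g] by blast
  have "?P h"
  proof
    fix k
    show "cinner (g - hardy2_to_L2 h) (hardy2_to_L2 k) = 0"
      using bspec[OF h rangeI[of _ k]] bspec[OF h hardy2_scaleC_closed[OF rangeI[of _ k], of \<i>]]
      by (simp add: cinner_eq_inner complex_eq_iff)
  qed
  moreover have "h' = h" if "?P h'" for h'
  proof -
    have "cinner (hardy2_to_L2 (h' - h)) (hardy2_to_L2 (h' - h)) = 0"
      using spec[OF that, of "h' - h"] spec[OF \<open>?P h\<close>, of "h' - h"]
      by (simp add: hardy2_to_L2_simps cinner_diff_left)
    then show ?thesis by (simp add: cinner_self hardy2_to_L2_simps hardy2_to_L2_inject)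
  qed
  ultimately have "?P (riesz_proj g)" unfolding riesz_proj_def by (rule theI)
  then show ?thesis by (simp add: cinner_diff_left)
qed

lemma cinner_toeplitz:
  "cinner (toeplitz F f) g = cinner (circle_mult F (hardy2_to_L2 f)) (hardy2_to_L2 g)"
  by (simp add: cinner_hardy2 toeplitz_def riesz_proj)

lemma circle_mult_linear:
  assumes "F \<in> circle_Linf"
  shows "circle_mult F (x + y) = circle_mult F x + circle_mult F y"
    "circle_mult F (c *\<^sub>C x) = c *\<^sub>C circle_mult F x"
proof -
  obtain f g where "f \<in> circle_sqint" "x = abs_circle_L2 f" "g \<in> circle_sqint" "y = abs_circle_L2 g"
    by (metis circle_L2_cases)
  then show "circle_mult F (x + y) = circle_mult F x + circle_mult F y"
    "circle_mult F (c *\<^sub>C x) = c *\<^sub>C circle_mult F x"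
    using assms by (simp_all add: circle_mult_abs circle_L2_operations circle_sqint_add circle_sqint_scale
        circle_sqint_mult algebra_simps)
qed

lemma circle_mult_bounded:
  assumes F: "F \<in> circle_Linf"
  obtains C where "0 \<le> C" "\<And>x. norm (circle_mult F x) \<le> C * norm x"
proof -
  obtain C where C: "AE z in circle_measure. cmod (F z) \<le> C" using F by (auto simp: circle_Linf_def)
  have "norm (circle_mult F x) \<le> \<bar>C\<bar> * norm x" for x
  proof (cases x rule: circle_L2_cases)
    case (1 f)
    have [measurable]: "f \<in> borel_measurable borel" using 1 circle_sqint_measurable by auto
    have "(norm (circle_mult F x))\<^sup>2 = (LINT z|circle_measure. (cmod (F z * f z))\<^sup>2)"
      using 1 F by (simp add: circle_mult_abs norm_circle_L2_sq circle_sqint_mult)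
    also have "\<dots> \<le> (LINT z|circle_measure. \<bar>C\<bar>\<^sup>2 * (cmod (f z))\<^sup>2)"
    proof (rule integral_mono_AE)
      show "AE z in circle_measure. (cmod (F z * f z))\<^sup>2 \<le> \<bar>C\<bar>\<^sup>2 * (cmod (f z))\<^sup>2"
        using C by eventually_elim
          (auto simp: norm_mult power_mult_distrib intro!: mult_right_mono power_mono)
    qed (use 1 circle_sqint_mult[OF F 1(1)] in \<open>auto simp: circle_sqint_def\<close>)
    also have "\<dots> = (\<bar>C\<bar> * norm x)\<^sup>2"
      using 1 by (simp add: norm_circle_L2_sq power_mult_distrib)
    finally show ?thesis by (rule power2_le_imp_le) auto
  qed
  then show ?thesis by (intro that[of "\<bar>C\<bar>"]) auto
qed

lemma bounded_clinear_toeplitz: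
  assumes F: "F \<in> circle_Linf"
  shows "bounded_clinear (toeplitz F)"
proof -
  obtain C where C: "0 \<le> C" "\<And>x. norm (circle_mult F x) \<le> C * norm x"
    using circle_mult_bounded[OF F] by blast
  have add: "toeplitz F (x + y) = toeplitz F x + toeplitz F y" for x y
    by (rule cinner_ext) (simp add: cinner_toeplitz cinner_add_left hardy2_to_L2_simps circle_mult_linear[OF F])
  have scale: "toeplitz F (c *\<^sub>C x) = c *\<^sub>C toeplitz F x" for c x
    by (rule cinner_ext) (simp add: cinner_toeplitz cinner_scaleC_left hardy2_to_L2_simps circle_mult_linear[OF F])
  have "norm (toeplitz F x) \<le> C * norm x" for x
  proof (cases "toeplitz F x = 0")
    case False
    have "(norm (toeplitz F x))\<^sup>2 = inner (circle_mult F (hardy2_to_L2 x)) (hardy2_to_L2 (toeplitz F x))"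
      using cinner_toeplitz[of F x "toeplitz F x"]
      by (metis Re_cinner power2_norm_eq_inner)
    also have "\<dots> \<le> norm (circle_mult F (hardy2_to_L2 x)) * norm (toeplitz F x)"
      unfolding norm_hardy2[of "toeplitz F x"] by (rule norm_cauchy_schwarz)
    also have "\<dots> \<le> (C * norm x) * norm (toeplitz F x)"
      using C(2)[of "hardy2_to_L2 x"] by (intro mult_right_mono) (simp_all add: norm_hardy2[of x])
    finally show ?thesis using False by (simp add: power2_eq_square)
  qed (use C in auto)
  then have "bounded_linear (toeplitz F)"
    using scale[of "complex_of_real r" for r]
    by (intro bounded_linear_intro[where K = C]) (auto simp: add scaleC_of_real mult.commute)
  with scale show ?thesis by (simp add: bounded_clinear_def)
qed

section \<open>Density of the range\<close>

abbreviation zmult :: "int \<Rightarrow> circle_L2 \<Rightarrow> circle_L2" where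
  "zmult n \<equiv> circle_mult (\<lambda>z. z powi n)"

lemma powi_circle_Linf: "(\<lambda>z. z powi n) \<in> circle_Linf"
  unfolding circle_Linf_def
  by (auto simp: powi_borel_measurable norm_power_int
      intro!: exI[of _ 1] eventually_mono[OF AE_circle_norm])

lemma circle_mult_commute:
  assumes "F \<in> circle_Linf" "G \<in> circle_Linf"
  shows "circle_mult F (circle_mult G x) = circle_mult G (circle_mult F x)"
proof (cases x rule: circle_L2_cases)
  case (1 f)
  then show ?thesis
    using assms by (simp add: circle_mult_abs circle_sqint_mult mult.left_commute)
qed

lemma cinner_zmult: "cinner (zmult n x) y = cinner x (zmult (- n) y)"
proof -
  obtain f g where fg: "f \<in> circle_sqint" "x = abs_circle_L2 f" "g \<in> circle_sqint" "y = abs_circle_L2 g"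
    by (metis circle_L2_cases)
  have [measurable]: "f \<in> borel_measurable borel" "g \<in> borel_measurable borel"
    using fg circle_sqint_measurable by auto
  have "(LINT z|circle_measure. z powi n * f z * cnj (g z))
      = (LINT z|circle_measure. f z * cnj (z powi (- n) * g z))"
  proof (rule integral_cong_AE)
    show "AE z in circle_measure. z powi n * f z * cnj (g z) = f z * cnj (z powi (- n) * g z)"
      using AE_cnj_powi[of "- n"] by eventually_elim (simp del: complex_cnj_power_int)
  qed (auto simp del: complex_cnj_power_int)
  then show ?thesis
    using fg by (simp add: circle_mult_abs powi_circle_Linf circle_L2_operations
        circle_sqint_mult[OF powi_circle_Linf] del: complex_cnj_power_int complex_cnj_mult)
qed

lemma zmult_character: "zmult m (character n) = character (m + n)"
  unfolding character_def using AE_powi_add[of m n]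
  by (simp add: circle_mult_abs powi_circle_Linf circle_sqint_powi abs_circle_L2_eq
      circle_sqint_mult[OF powi_circle_Linf])

lemma fourier_coeff_zmult: "fourier_coeff (zmult m x) n = fourier_coeff x (n - m)"
  by (simp add: fourier_coeff_eq_cinner cinner_zmult zmult_character)

lemma circle_mult_zmult:
  "F \<in> circle_Linf \<Longrightarrow> circle_mult F (zmult n x) = zmult n (circle_mult F x)"
  by (rule circle_mult_commute[OF _ powi_circle_Linf])

lemma circle_mult_zero: "F \<in> circle_Linf \<Longrightarrow> circle_mult F 0 = 0"
  using circle_mult_linear(2)[of F 0 0] by simp

lemma cinner_zmult_integral:
  assumes "f \<in> circle_sqint" "g \<in> circle_sqint"
  shows "cinner (zmult n (abs_circle_L2 f)) (abs_circle_L2 g) = (LINT z|circle_measure. z powi n * (f z * cnj (g z)))"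
  using assms by (simp add: circle_mult_abs powi_circle_Linf circle_L2_operations
      circle_sqint_mult[OF powi_circle_Linf] mult.assoc)

lemma AE_mult_cnj_zero:
  assumes f: "f \<in> circle_sqint" and g: "g \<in> circle_sqint"
    and orth: "\<And>n. cinner (zmult n (abs_circle_L2 f)) (abs_circle_L2 g) = 0"
  shows "AE z in circle_measure. f z * cnj (g z) = 0"
  by (rule vanishing_coeffs_AE_zero)
    (use orth in \<open>simp add: vanishing_coeffs_def circle_sqint_integrable f g cinner_zmult_integral\<close>)

text \<open>For \<open>n \<ge> 0\<close> the function \<open>z\<^sup>n f\<close> lies in the Hardy space. The kernel of \<open>T\<^sub>F\<close> gives
  \<open>\<langle>F f, z\<^sup>n f\<rangle> = 0\<close> and that of the adjoint gives \<open>\<langle>F z\<^sup>n f, f\<rangle> = 0\<close>; together these are all Fourier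
  coefficients of \<open>F |f|\<^sup>2\<close>.\<close>

lemma symbol_times_common_kernel:
  assumes F: "F \<in> circle_Linf"
    and ker: "toeplitz F f = 0" and coker: "\<And>k. cinner (toeplitz F k) f = 0"
  shows "circle_mult F (hardy2_to_L2 f) = 0"
proof -
  let ?x = "hardy2_to_L2 f"
  have neg: "\<forall>n<0. fourier_coeff ?x n = 0" using hardy2_to_L2[of f] by simp
  have shift: "zmult n ?x \<in> range hardy2_to_L2" if "0 \<le> n" for n
    using neg that by (simp add: range_hardy2_to_L2_iff fourier_coeff_zmult)
  have orth: "cinner (zmult n (circle_mult F ?x)) ?x = 0" for n
  proof (cases "0 \<le> n")
    case True
    then obtain k where "zmult n ?x = hardy2_to_L2 k" using shift by blast
    then show ?thesis
      using coker[of k] by (simp add: cinner_toeplitz flip: circle_mult_zmult[OF F])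
  next
    case False
    then obtain k where "zmult (- n) ?x = hardy2_to_L2 k" using shift[of "- n"] by auto
    then show ?thesis
      using cinner_toeplitz[of F f k] ker by (simp add: cinner_zmult)
  qed
  obtain u where u: "u \<in> circle_sqint" "?x = abs_circle_L2 u" by (metis circle_L2_cases)
  have Fu: "(\<lambda>z. F z * u z) \<in> circle_sqint" using circle_sqint_mult[OF F u(1)] .
  have "AE z in circle_measure. F z * u z * cnj (u z) = 0"
    using AE_mult_cnj_zero[OF Fu u(1)] orth by (simp add: u(2) circle_mult_abs F u(1))
  then have "AE z in circle_measure. F z * u z = 0" by eventually_elim auto
  then show ?thesis
    by (simp add: u(2) circle_mult_abs F u(1) zero_circle_L2.abs_eq abs_circle_L2_eq Fu circle_sqint_zero)
qed

lemma subspace_closed_coeff_kernel: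
  assumes F: "F \<in> circle_Linf"
  shows "subspace {x. (\<forall>n\<in>N. fourier_coeff x n = 0) \<and> circle_mult F x = 0}"
    and "closed {x. (\<forall>n\<in>N. fourier_coeff x n = 0) \<and> circle_mult F x = 0}"
proof -
  have scaleR: "circle_mult F (r *\<^sub>R x) = r *\<^sub>R circle_mult F x" for r x
    using circle_mult_linear(2)[OF F, of "complex_of_real r" x] by (simp add: scaleC_of_real)
  show "subspace {x. (\<forall>n\<in>N. fourier_coeff x n = 0) \<and> circle_mult F x = 0}"
    by (rule subspaceI) (auto simp: fourier_coeff_zero fourier_coeff_add fourier_coeff_scaleR
        circle_mult_linear(1)[OF F] circle_mult_zero[OF F] scaleR)
  obtain C where C: "\<And>x. norm (circle_mult F x) \<le> C * norm x"
    using circle_mult_bounded[OF F] by blast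
  have "bounded_linear (circle_mult F)"
    by (rule bounded_linear_intro[where K = C])
      (use C in \<open>auto simp: circle_mult_linear(1)[OF F] scaleR mult.commute\<close>)
  then have "closed {x. circle_mult F x = 0}"
    by (intro closed_Collect_eq continuous_on_const)
      (rule bounded_linear.continuous_on[OF _ continuous_on_id])
  moreover have "closed {x. fourier_coeff x n = 0}" for n
    unfolding fourier_coeff_eq_cinner
    by (intro closed_Collect_eq bounded_linear.continuous_on[OF bounded_linear_cinner(1)] continuous_intros)
  moreover have eq: "{x. (\<forall>n\<in>N. fourier_coeff x n = 0) \<and> circle_mult F x = 0}
      = (\<Inter>n\<in>N. {x. fourier_coeff x n = 0}) \<inter> {x. circle_mult F x = 0}" by auto
  ultimately show "closed {x. (\<forall>n\<in>N. fourier_coeff x n = 0) \<and> circle_mult F x = 0}"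
    unfolding eq by (intro closed_Int closed_INT ballI)
qed

text \<open>A function of the Hardy space that vanishes on a set of positive measure is zero; \<open>F\<close> may be thought of as the
  indicator of that set. The proof is Helson's: pass to a \<open>\<phi>\<close> in the invariant subspace \<open>F x = 0\<close> that is
  orthogonal to \<open>z\<^sup>n \<phi>\<close> for all \<open>n \<ge> 1\<close>, so that \<open>|\<phi>|\<^sup>2\<close> has no nonconstant Fourier modes.\<close>

theorem hardy_multiplier_kernel:
  assumes F: "F \<in> circle_Linf" and x: "\<forall>n<0. fourier_coeff x n = 0" "circle_mult F x = 0" "x \<noteq> 0"
  shows "AE z in circle_measure. F z = 0"
proof -
  have "\<exists>k::nat. fourier_coeff x (int k) \<noteq> 0"
    using fourier_uniqueness[of x] x by (metis nonneg_int_cases not_less)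
  then obtain k :: nat where k: "fourier_coeff x (int k) \<noteq> 0" "\<And>j. j < k \<Longrightarrow> fourier_coeff x (int j) = 0"
    using exists_least_iff[of "\<lambda>k. fourier_coeff x (int k) \<noteq> 0"] by blast
  \<comment> \<open>Dividing by the leading power of \<open>z\<close> keeps \<open>x\<close> in the Hardy space and makes its mean nonzero.\<close>
  define y where "y = zmult (- int k) x"
  have y0: "fourier_coeff y 0 \<noteq> 0" using k(1) by (simp add: y_def fourier_coeff_zmult)
  have yneg: "fourier_coeff y n = 0" if "n < 0" for n
  proof (cases "n + int k < 0")
    case True
    then show ?thesis using x(1) by (simp add: y_def fourier_coeff_zmult)
  next
    case False
    then have "fourier_coeff x (int (nat (n + int k))) = 0" using that by (intro k(2)) linarith
    then show ?thesis using False by (simp add: y_def fourier_coeff_zmult)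
  qed
  have yF: "circle_mult F y = 0"
    unfolding y_def circle_mult_zmult[OF F] x(2) by (rule circle_mult_zero[OF powi_circle_Linf])
  \<comment> \<open>The annihilated functions in the Hardy space that vanish at the origin.\<close>
  define N where "N = {x. (\<forall>n\<in>{..0}. fourier_coeff x n = 0) \<and> circle_mult F x = 0}"
  obtain p where p: "p \<in> N" "\<forall>v\<in>N. inner (y - p) v = 0"
    using closed_subspace_projection[of N y] subspace_closed_coeff_kernel[OF F, of "{..0}"]
    unfolding N_def by blast
  define \<phi> where "\<phi> = y - p"
  have mult_diff: "circle_mult F (a - b) = circle_mult F a - circle_mult F b" for a b
    using circle_mult_linear(1)[OF F, of "a - b" b] by simp
  have \<phi>: "\<forall>n<0. fourier_coeff \<phi> n = 0" "circle_mult F \<phi> = 0" "fourier_coeff \<phi> 0 \<noteq> 0"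
    using p(1) yneg y0 yF by (auto simp: \<phi>_def N_def fourier_coeff_diff mult_diff)
  have orthN: "cinner \<phi> v = 0" if "v \<in> N" for v
  proof -
    have "\<i> *\<^sub>C v \<in> N"
      using that by (auto simp: N_def fourier_coeff_scaleC circle_mult_linear(2)[OF F]) (metis add_cancel_right_left scaleC_add_right)
    then show ?thesis
      using p(2) that unfolding \<phi>_def[symmetric] by (simp add: cinner_eq_inner complex_eq_iff)
  qed
  have orth: "cinner \<phi> (zmult n \<phi>) = 0" if "0 < n" for n
  proof (rule orthN)
    show "zmult n \<phi> \<in> N"
      using \<phi>(1,2) that by (simp add: N_def fourier_coeff_zmult circle_mult_zmult[OF F] circle_mult_zero[OF powi_circle_Linf])
  qed
  obtain w where w: "w \<in> circle_sqint" "\<phi> = abs_circle_L2 w" by (metis circle_L2_cases)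
  have orth': "cinner (zmult n \<phi>) \<phi> = 0" if "n \<noteq> 0" for n
  proof (cases "0 < n")
    case True
    then show ?thesis using orth[OF True] cinner_commute[of "zmult n \<phi>" \<phi>] by simp
  next
    case False
    then show ?thesis using that orth[of "- n"] by (simp add: cinner_zmult)
  qed
  define c where "c = complex_of_real ((norm \<phi>)\<^sup>2)"
  have c: "c \<noteq> 0" using \<phi>(3) by (auto simp: c_def fourier_coeff_zero)
  have "vanishing_coeffs (\<lambda>z. w z * cnj (w z) - c)"
    unfolding vanishing_coeffs_def
  proof (intro conjI allI)
    have i: "integrable circle_measure (\<lambda>z. w z * cnj (w z))" by (rule circle_sqint_integrable[OF w(1) w(1)])
    then show "integrable circle_measure (\<lambda>z. w z * cnj (w z) - c)" by simp
    fix n :: int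
    have ci: "integrable circle_measure (\<lambda>z. z powi n * c)"
      using circle_sqint_integrable_self[OF circle_sqint_powi[of n]] by simp
    have "(LINT z|circle_measure. z powi n * (w z * cnj (w z) - c))
        = (LINT z|circle_measure. z powi n * (w z * cnj (w z))) - (LINT z|circle_measure. z powi n * c)"
      unfolding right_diff_distrib by (rule Bochner_Integration.integral_diff[OF integrable_powi_mult[OF i] ci])
    also have "(LINT z|circle_measure. z powi n * c) = (if n = 0 then c else 0)"
      by (simp add: integral_powi)
    also have "(LINT z|circle_measure. z powi n * (w z * cnj (w z))) = cinner (zmult n \<phi>) \<phi>"
      by (simp add: w cinner_zmult_integral)
    also have "\<dots> = (if n = 0 then c else 0)"
    proof (cases "n = 0")
      case True
      have "zmult 0 \<phi> = \<phi>" using circle_mult_abs[OF powi_circle_Linf[of 0] w(1)] w(2) by simp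
      then show ?thesis using True by (simp add: c_def cinner_self)
    qed (simp add: orth')
    finally show "(LINT z|circle_measure. z powi n * (w z * cnj (w z) - c)) = 0" by simp
  qed
  then have "AE z in circle_measure. w z * cnj (w z) - c = 0" by (rule vanishing_coeffs_AE_zero)
  moreover have "AE z in circle_measure. F z * w z = 0"
    using \<phi>(2) by (simp add: w circle_mult_abs F zero_circle_L2.abs_eq abs_circle_L2_eq circle_sqint_mult circle_sqint_zero)
  ultimately show ?thesis by eventually_elim (use c in auto)
qed

corollary toeplitz_common_kernel_trivial:
  assumes F: "F \<in> circle_Linf" and nz: "\<not> (AE z in circle_measure. F z = 0)"
    and "toeplitz F f = 0" "\<And>k. cinner (toeplitz F k) f = 0"
  shows "f = 0"
proof (rule ccontr)
  assume "f \<noteq> 0"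
  then have "hardy2_to_L2 f \<noteq> 0" by (metis hardy2_to_L2_inject hardy2_to_L2_simps(5))
  with hardy_multiplier_kernel[OF F] symbol_times_common_kernel[OF F assms(3,4)] hardy2_to_L2[of f] nz
  show False by blast
qed

text \<open>A vector orthogonal to the range is in the kernel of \<open>T\<^sub>F\<close> by accretivity and in that of the adjoint by
  orthogonality.\<close>

theorem dense_range_accretive_toeplitz:
  assumes F: "F \<in> circle_Linf" and nz: "\<not> (AE z in circle_measure. F z = 0)"
    and c: "c \<noteq> 0" and acc: "\<And>x. 0 \<le> Re (c * cinner (toeplitz F x) x)"
  shows "closure (range (\<lambda>x. c *\<^sub>C toeplitz F x)) = UNIV"
proof (rule closed_subspace_eq_UNIV)
  let ?A = "\<lambda>x. c *\<^sub>C toeplitz F x"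
  have T: "bounded_linear (toeplitz F)" and Tc: "\<And>a x. toeplitz F (a *\<^sub>C x) = a *\<^sub>C toeplitz F x"
    using bounded_clinear_toeplitz[OF F] by (auto simp: bounded_clinear_def)
  have lin: "linear ?A"
    using bounded_linear_compose[OF bounded_linear_scaleC T] by (rule bounded_linear.linear)
  show "subspace (closure (range ?A))"
    using lin by (intro subspace_closure linear_subspace_image) auto
  show "closed (closure (range ?A))" by simp
  fix y assume y: "\<And>z. z \<in> closure (range ?A) \<Longrightarrow> inner y z = 0"
  then have A0: "inner (?A x) y = 0" for x
    using closure_subset[of "range ?A"] by (subst inner_commute) blast
  have "?A y = 0"
    by (rule accretive_orthogonal_range_kernel[OF lin _ A0])
      (use acc in \<open>simp flip: Re_cinner add: cinner_scaleC_left\<close>)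
  then have ker: "toeplitz F y = 0" using c by (metis norm_eq_zero norm_scaleC mult_eq_0_iff)
  moreover have "cinner (toeplitz F k) y = 0" for k
  proof -
    have "inner (toeplitz F (a *\<^sub>C k)) y = 0" for a
      using A0[of "(inverse c * a) *\<^sub>C k"] c by (simp add: Tc scaleC_scaleC flip: mult.assoc)
    from this[of 1] this[of \<i>] show ?thesis
      by (simp add: complex_eq_iff Tc cinner_scaleC_left flip: Re_cinner)
  qed
  ultimately show "y = 0" by (rule toeplitz_common_kernel_trivial[OF F nz])
qed

section \<open>The Hardy space as a copy of L2\<close>

lemma cinner_sum_left: "cinner (sum f A) y = (\<Sum>x\<in>A. cinner (f x) (y::'a::complex_inner))"
  by (induction A rule: infinite_finite_induct) (simp_all add: cinner_add_left)

lemma cinner_sum_right: "cinner y (sum f A) = (\<Sum>x\<in>A. cinner (y::'a::complex_inner) (f x))"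
  by (induction A rule: infinite_finite_induct) (simp_all add: cinner_add_right)

lemma norm_sum_orthonormal:
  fixes v :: "nat \<Rightarrow> 'a::complex_inner"
  assumes "\<And>m n. cinner (v m) (v n) = (if m = n then 1 else 0)" "finite A"
  shows "(norm (\<Sum>n\<in>A. a n *\<^sub>C v n))\<^sup>2 = (\<Sum>n\<in>A. (cmod (a n))\<^sup>2)"
proof -
  have "cinner (\<Sum>n\<in>A. a n *\<^sub>C v n) (\<Sum>n\<in>A. a n *\<^sub>C v n) = (\<Sum>n\<in>A. a n * cnj (a n))"
    using assms(2)
    by (simp add: cinner_sum_left cinner_sum_right cinner_scaleC_left cinner_scaleC_right assms(1) if_distrib cong: if_cong)
      (simp add: mult.commute)
  also have "\<dots> = complex_of_real (\<Sum>n\<in>A. (cmod (a n))\<^sup>2)"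
    by (simp only: of_real_sum complex_norm_square)
  finally show ?thesis unfolding cinner_self by (simp only: of_real_eq_iff)
qed

lemma bessel_inequality:
  fixes u :: "nat \<Rightarrow> 'a::complex_inner"
  assumes u: "\<And>m n. cinner (u m) (u n) = (if m = n then 1 else 0)" and "finite A"
  shows "(\<Sum>n\<in>A. (cmod (cinner x (u n)))\<^sup>2) \<le> (norm x)\<^sup>2"
proof -
  let ?s = "\<Sum>n\<in>A. cinner x (u n) *\<^sub>C u n"
  have "cinner x ?s = complex_of_real (\<Sum>n\<in>A. (cmod (cinner x (u n)))\<^sup>2)"
  proof -
    have "cinner x ?s = (\<Sum>n\<in>A. cinner x (u n) * cnj (cinner x (u n)))"
      by (simp add: cinner_sum_right cinner_scaleC_right mult.commute)
    also have "\<dots> = complex_of_real (\<Sum>n\<in>A. (cmod (cinner x (u n)))\<^sup>2)"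
      by (simp only: of_real_sum complex_norm_square)
    finally show ?thesis .
  qed
  then have xs: "inner x ?s = (\<Sum>n\<in>A. (cmod (cinner x (u n)))\<^sup>2)"
    by (simp flip: Re_cinner)
  have ss: "(norm ?s)\<^sup>2 = (\<Sum>n\<in>A. (cmod (cinner x (u n)))\<^sup>2)"
    by (rule norm_sum_orthonormal[OF u assms(2)])
  have "0 \<le> (norm (x - ?s))\<^sup>2" by simp
  also have "\<dots> = (norm x)\<^sup>2 + (norm ?s)\<^sup>2 - 2 * inner x ?s"
    by (simp add: power2_norm_eq_inner inner_diff_left inner_diff_right inner_commute)
  finally show ?thesis unfolding xs ss by simp
qed

text \<open>The series \<open>\<Sum>\<^sub>n \<langle>x, u\<^sub>n\<rangle> v\<^sub>n\<close> converges by Bessel's inequality. Since \<open>v\<close> is total, an identity between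
  vectors of the target space can be checked on coefficients, linearity of \<open>U\<close> included.\<close>

lemma orthonormal_transfer:
  fixes u :: "nat \<Rightarrow> 'a::complex_inner" and v :: "nat \<Rightarrow> 'b::{complex_inner,banach}"
  assumes u: "\<And>m n. cinner (u m) (u n) = (if m = n then 1 else 0)"
    and v: "\<And>m n. cinner (v m) (v n) = (if m = n then 1 else 0)"
    and total: "\<And>y. (\<And>n. cinner y (v n) = 0) \<Longrightarrow> y = 0"
  shows "\<exists>U. bounded_clinear U \<and> (\<forall>x k. cinner (U x) (v k) = cinner x (u k))"
proof -
  let ?a = "\<lambda>x n. cinner x (u n)"
  define U where "U x = (\<Sum>n. ?a x n *\<^sub>C v n)" for x
  have sums: "summable (\<lambda>n. ?a x n *\<^sub>C v n)" for x
  proof -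
    have "summable (\<lambda>n. (cmod (?a x n))\<^sup>2)"
      by (rule summableI_nonneg_bounded[where x = "(norm x)\<^sup>2"]) (auto intro!: bessel_inequality u)
    show ?thesis
      unfolding summable_Cauchy
    proof (intro allI impI)
      fix e :: real assume e: "0 < e"
      then obtain N where N: "\<And>m n. N \<le> m \<Longrightarrow> norm (\<Sum>k\<in>{m..<n}. (cmod (?a x k))\<^sup>2) < e\<^sup>2"
        using \<open>summable (\<lambda>n. (cmod (?a x n))\<^sup>2)\<close> unfolding summable_Cauchy by (metis zero_less_power)
      show "\<exists>N. \<forall>m\<ge>N. \<forall>n. norm (\<Sum>k\<in>{m..<n}. ?a x k *\<^sub>C v k) < e"
      proof (intro exI allI impI)
        fix m n assume "N \<le> m"
        have "(norm (\<Sum>k\<in>{m..<n}. ?a x k *\<^sub>C v k))\<^sup>2 = (\<Sum>k\<in>{m..<n}. (cmod (?a x k))\<^sup>2)"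
          by (rule norm_sum_orthonormal[OF v]) simp
        also have "\<dots> < e\<^sup>2" using N[OF \<open>N \<le> m\<close>, of n] by simp
        finally show "norm (\<Sum>k\<in>{m..<n}. ?a x k *\<^sub>C v k) < e" using e by (simp add: power2_less_imp_less)
      qed
    qed
  qed
  have coeff: "cinner (U x) (v k) = ?a x k" for x k
  proof -
    have "(\<lambda>n. cinner (?a x n *\<^sub>C v n) (v k)) sums cinner (U x) (v k)"
      unfolding U_def by (rule bounded_linear.sums[OF bounded_linear_cinner(1) summable_sums[OF sums]])
    moreover have "(\<lambda>n. cinner (?a x n *\<^sub>C v n) (v k)) = (\<lambda>n. if n = k then ?a x k else 0)"
      by (auto simp: cinner_scaleC_left v)
    ultimately show ?thesis using sums_unique2 sums_single[of k "\<lambda>_. ?a x k"] by fastforce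
  qed
  have ext: "y = y'" if "\<And>n. cinner y (v n) = cinner y' (v n)" for y y'
    using total[of "y - y'"] that by (simp add: cinner_diff_left)
  have bd: "norm (U x) \<le> norm x" for x
  proof (rule LIMSEQ_le_const2)
    show "(\<lambda>n. norm (\<Sum>k<n. ?a x k *\<^sub>C v k)) \<longlonglongrightarrow> norm (U x)"
      unfolding U_def by (intro tendsto_norm summable_LIMSEQ sums)
    have "norm (\<Sum>k<n. ?a x k *\<^sub>C v k) \<le> norm x" for n
      by (rule power2_le_imp_le) (auto simp: norm_sum_orthonormal[OF v] bessel_inequality[OF u])
    then show "\<exists>N. \<forall>n\<ge>N. norm (\<Sum>k<n. ?a x k *\<^sub>C v k) \<le> norm x" by blast
  qed
  have add: "U (x + y) = U x + U y" for x y by (rule ext) (simp add: coeff cinner_add_left)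
  have scale: "U (c *\<^sub>C x) = c *\<^sub>C U x" for c x by (rule ext) (simp add: coeff cinner_scaleC_left)
  have "bounded_linear U"
    using scale[of "complex_of_real r" for r] bd
    by (intro bounded_linear_intro[where K = 1]) (auto simp: add scaleC_of_real)
  with coeff scale show ?thesis by (auto simp: bounded_clinear_def)
qed

definition hardy_character :: "nat \<Rightarrow> hardy2" where
  "hardy_character n = Abs_hardy2 (character (int n))"

lemma hardy_character_rep: "hardy2_to_L2 (hardy_character n) = character (int n)"
  unfolding hardy_character_def
  by (rule Abs_hardy2_inverse) (simp add: fourier_coeff_eq_cinner cinner_character)

text \<open>Match the basis of \<open>L\<^sup>2\<close> indexed by the integers with that of the Hardy space indexed by the naturals, by any
  bijection between the index sets. The two maps are inverse to each other because both are determined by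
  coefficients.\<close>

lemma hardy2_isomorphic_L2:
  obtains U :: "circle_L2 \<Rightarrow> hardy2" and V :: "hardy2 \<Rightarrow> circle_L2"
  where "bounded_clinear U" "bounded_clinear V" "\<And>x. U (V x) = x" "\<And>x. V (U x) = x"
proof -
  let ?u = "\<lambda>n. character (int_decode n)" and ?v = hardy_character
  have u: "cinner (?u m) (?u n) = (if m = n then 1 else 0)" for m n
    by (simp add: cinner_character int_decode_eq)
  have v: "cinner (?v m) (?v n) = (if m = n then 1 else 0)" for m n
    by (simp add: cinner_hardy2 hardy_character_rep cinner_character)
  have tu: "x = 0" if "\<And>n. cinner x (?u n) = 0" for x
    using that[of "int_encode n" for n] by (intro fourier_uniqueness) (simp add: fourier_coeff_eq_cinner)
  have tv: "x = 0" if "\<And>n. cinner x (?v n) = 0" for x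
  proof -
    have "fourier_coeff (hardy2_to_L2 x) n = 0" for n
    proof (cases "0 \<le> n")
      case True
      then show ?thesis using that[of "nat n"] by (simp add: cinner_hardy2 hardy_character_rep fourier_coeff_eq_cinner)
    next
      case False
      then show ?thesis using hardy2_to_L2[of x] by simp
    qed
    then have "hardy2_to_L2 x = 0" by (rule fourier_uniqueness)
    then show ?thesis by (metis hardy2_to_L2_inject hardy2_to_L2_simps(5))
  qed
  obtain U where U: "bounded_clinear U" "\<And>x k. cinner (U x) (?v k) = cinner x (?u k)"
    using orthonormal_transfer[OF u v tv] by blast
  obtain V where V: "bounded_clinear V" "\<And>x k. cinner (V x) (?u k) = cinner x (?v k)"
    using orthonormal_transfer[OF v u tu] by blast
  show ?thesis
  proof (rule that[OF U(1) V(1)])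
    show "U (V x) = x" for x
      using tv[of "U (V x) - x"] by (simp add: cinner_diff_left U V)
    show "V (U x) = x" for x
      using tu[of "V (U x) - x"] by (simp add: cinner_diff_left U V)
  qed
qed

section \<open>A nilpotent semigroup\<close>

text \<open>Rotation of the graph by the angle \<open>a\<close>, with zero in place of whatever has crossed the cut along the positive
  axis. The inequality is strict so that the set on which the function survives is open. The general codomain covers
  both functions and their squared moduli.\<close>

definition cut_rotate :: "real \<Rightarrow> (complex \<Rightarrow> 'b::zero) \<Rightarrow> complex \<Rightarrow> 'b" where
  "cut_rotate a f z = (if a < Arg2pi z then f (z * cis (- a)) else 0)"

lemma Arg2pi_mult_cis:
  assumes "0 < a" "a < Arg2pi z"
  shows "Arg2pi (z * cis (- a)) = Arg2pi z - a"
proof (rule Arg2pi_unique[where r = "cmod z"])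
  have "z \<noteq> 0" using assms by auto
  then show "0 < cmod z" by simp
  have "z = complex_of_real (cmod z) * cis (Arg2pi z)"
    using Arg2pi_eq[of z] by (simp add: cis_conv_exp)
  then have "z * cis (- a) = complex_of_real (cmod z) * (cis (Arg2pi z) * cis (- a))"
    by (metis mult.assoc)
  then show "complex_of_real (cmod z) * exp (\<i> * complex_of_real (Arg2pi z - a)) = z * cis (- a)"
    unfolding cis_conv_exp[symmetric] by (simp add: cis_mult)
  show "0 \<le> Arg2pi z - a" "Arg2pi z - a < 2 * pi" using assms Arg2pi_lt_2pi[of z] by auto
qed

text \<open>In terms of the angle \<open>x \<in> [0, 2 \<pi>)\<close> the operation is translation by \<open>a\<close> with zero filled in from the left.\<close>

lemma cut_rotate_cut_rotate:
  "0 < a \<Longrightarrow> 0 < b \<Longrightarrow> cut_rotate a (cut_rotate b f) = cut_rotate (a + b) f"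
  by (rule ext) (auto simp: cut_rotate_def Arg2pi_mult_cis mult.assoc cis_mult)

lemma measurable_cut_rotate [measurable]:
  fixes f :: "complex \<Rightarrow> 'b::{zero,topological_space}"
  assumes [measurable]: "f \<in> borel_measurable borel"
  shows "cut_rotate a f \<in> borel_measurable borel"
proof -
  have [measurable]: "{z. a < Arg2pi z} \<in> sets borel" using open_Arg2pi2pi_gt by simp
  have "cut_rotate a f = (\<lambda>z. if z \<in> {z. a < Arg2pi z} then f (z * cis (- a)) else 0)"
    by (auto simp: cut_rotate_def)
  moreover have "(\<lambda>z. if z \<in> {z. a < Arg2pi z} then f (z * cis (- a)) else 0) \<in> borel_measurable borel"
    by (rule measurable_If_set) auto
  ultimately show ?thesis by (simp only:)
qed

text \<open>In the angle variable this is a translation on the line followed by enlarging the domain of integration. The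
  point \<open>2 \<pi>\<close>, whose argument is \<open>0\<close> and not \<open>2 \<pi>\<close>, contributes nothing on the left.\<close>

lemma nn_integral_cut_rotate_le:
  fixes g :: "complex \<Rightarrow> ennreal"
  assumes [measurable]: "g \<in> borel_measurable borel" and a: "0 < a"
  shows "(\<integral>\<^sup>+z. cut_rotate a g z \<partial>circle_measure) \<le> (\<integral>\<^sup>+z. g z \<partial>circle_measure)"
proof -
  have [measurable]: "cis \<in> borel_measurable borel"
    by (intro borel_measurable_continuous_onI continuous_intros)
  have "(\<integral>\<^sup>+x. cut_rotate a g (cis x) * indicator {0..2*pi} x \<partial>lborel)
      \<le> (\<integral>\<^sup>+x. g (cis (x - a)) * indicator {0..2*pi} (x - a) \<partial>lborel)"
  proof (rule nn_integral_mono)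
    fix x :: real
    show "cut_rotate a g (cis x) * indicator {0..2*pi} x \<le> g (cis (x - a)) * indicator {0..2*pi} (x - a)"
    proof (cases "0 \<le> x \<and> x < 2 * pi \<and> a < x")
      case True
      then have "Arg2pi (cis x) = x" by (simp add: cis_conv_exp Arg2pi_exp)
      with True a show ?thesis by (simp add: cut_rotate_def cis_mult)
    next
      case False
      have "x \<in> {0..2*pi} \<Longrightarrow> \<not> a < Arg2pi (cis x)"
      proof (cases "x = 2 * pi")
        case True
        then have "cis x = 1" by simp
        then have "Arg2pi (cis x) = 0" using Arg2pi_of_real[of 1] by simp
        then show ?thesis using a by simp
      next
        case neq: False
        assume "x \<in> {0..2*pi}"
        with neq have "Arg2pi (cis x) = x" by (simp add: cis_conv_exp Arg2pi_exp)
        with False neq \<open>x \<in> {0..2*pi}\<close> show ?thesis by simp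
      qed
      then have "cut_rotate a g (cis x) * indicator {0..2*pi} x = 0"
        by (auto simp: cut_rotate_def split: split_indicator)
      then show ?thesis by (rule ord_eq_le_trans[OF _ zero_le])
    qed
  qed
  also have "\<dots> = (\<integral>\<^sup>+x. g (cis x) * indicator {0..2*pi} x \<partial>lborel)"
    by (subst nn_integral_real_affine[where c = 1 and t = "-a" and f = "\<lambda>x. g (cis x) * indicator {0..2*pi} x"])
      (auto simp: algebra_simps)
  finally show ?thesis
    by (simp add: nn_integral_circle_measure divide_right_mono_ennreal)
qed

text \<open>Apply the integral inequality to \<open>|f - g|\<close>.\<close>

lemma AE_cut_rotate_cong:
  fixes f g :: "complex \<Rightarrow> complex"
  assumes [measurable]: "f \<in> borel_measurable borel" "g \<in> borel_measurable borel"
    and eq: "AE z in circle_measure. f z = g z" and a: "0 < a"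
  shows "AE z in circle_measure. cut_rotate a f z = cut_rotate a g z"
proof -
  define h :: "complex \<Rightarrow> ennreal" where "h z = ennreal (cmod (f z - g z))" for z
  have [measurable]: "h \<in> borel_measurable borel" unfolding h_def by measurable
  have "(\<integral>\<^sup>+z. h z \<partial>circle_measure) = 0"
    using eq by (subst nn_integral_0_iff_AE) (auto simp: h_def elim: eventually_mono)
  then have "(\<integral>\<^sup>+z. cut_rotate a h z \<partial>circle_measure) = 0"
    using nn_integral_cut_rotate_le[of h a] a by simp
  then have "AE z in circle_measure. cut_rotate a h z = 0"
    by (subst (asm) nn_integral_0_iff_AE) auto
  then show ?thesis
    by eventually_elim (auto simp: cut_rotate_def h_def ennreal_eq_0_iff split: if_splits)
qed

lemma ennreal_cmod_cut_rotate: "ennreal ((cmod (cut_rotate a f z))\<^sup>2) = cut_rotate a (\<lambda>z. ennreal ((cmod (f z))\<^sup>2)) z"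
  by (simp add: cut_rotate_def)

lemma cut_rotate_sqint:
  assumes f: "f \<in> circle_sqint" and a: "0 < a"
  shows "cut_rotate a f \<in> circle_sqint"
    and "(\<integral>\<^sup>+z. ennreal ((cmod (cut_rotate a f z))\<^sup>2) \<partial>circle_measure)
      \<le> (\<integral>\<^sup>+z. ennreal ((cmod (f z))\<^sup>2) \<partial>circle_measure)"
proof -
  have [measurable]: "f \<in> borel_measurable borel" using f by (rule circle_sqint_measurable)
  show le: "(\<integral>\<^sup>+z. ennreal ((cmod (cut_rotate a f z))\<^sup>2) \<partial>circle_measure)
      \<le> (\<integral>\<^sup>+z. ennreal ((cmod (f z))\<^sup>2) \<partial>circle_measure)"
    unfolding ennreal_cmod_cut_rotate by (rule nn_integral_cut_rotate_le) (use a in auto)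
  also have "\<dots> < \<infinity>" unfolding nn_integral_circle_L2[OF f] by simp
  finally show "cut_rotate a f \<in> circle_sqint" by (intro circle_sqintI) auto
qed

lift_definition truncated_rotation :: "real \<Rightarrow> circle_L2 \<Rightarrow> circle_L2" is
  "\<lambda>a f. if 0 < a then cut_rotate a f else f"
proof goal_cases
  case (1 a f g)
  then have fg: "f \<in> circle_sqint" "g \<in> circle_sqint" and eq: "AE z in circle_measure. f z = g z"
    by auto
  show ?case
  proof (cases "0 < a")
    case True
    with AE_cut_rotate_cong[OF circle_sqint_measurable[OF fg(1)] circle_sqint_measurable[OF fg(2)] eq True]
    show ?thesis by (simp add: cut_rotate_sqint fg)
  qed (use fg eq in simp)
qed

lemma truncated_rotation_abs:
  "f \<in> circle_sqint \<Longrightarrow> 0 < a \<Longrightarrow> truncated_rotation a (abs_circle_L2 f) = abs_circle_L2 (cut_rotate a f)"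
  by (simp add: truncated_rotation.abs_eq)

lemma truncated_rotation_linear:
  assumes "0 < a"
  shows "truncated_rotation a (x + y) = truncated_rotation a x + truncated_rotation a y"
    "truncated_rotation a (c *\<^sub>C x) = c *\<^sub>C truncated_rotation a x"
proof -
  obtain f g where "f \<in> circle_sqint" "x = abs_circle_L2 f" "g \<in> circle_sqint" "y = abs_circle_L2 g"
    by (metis circle_L2_cases)
  moreover have "cut_rotate a (\<lambda>z. f z + g z) = (\<lambda>z. cut_rotate a f z + cut_rotate a g z)"
    "cut_rotate a (\<lambda>z. c * f z) = (\<lambda>z. c * cut_rotate a f z)" for f g :: "complex \<Rightarrow> complex"
    by (auto simp: cut_rotate_def)
  ultimately show "truncated_rotation a (x + y) = truncated_rotation a x + truncated_rotation a y"
    "truncated_rotation a (c *\<^sub>C x) = c *\<^sub>C truncated_rotation a x"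
    using assms by (simp_all add: truncated_rotation_abs circle_L2_operations circle_sqint_add
        circle_sqint_scale cut_rotate_sqint)
qed

lemma norm_truncated_rotation_le:
  assumes "0 < a" shows "norm (truncated_rotation a x) \<le> norm x"
proof (cases x rule: circle_L2_cases)
  case (1 f)
  then show ?thesis
    using assms cut_rotate_sqint[OF 1(1) assms]
    by (simp add: truncated_rotation_abs) (rule norm_circle_L2_le, auto simp: nn_integral_circle_L2)
qed

lemma bounded_clinear_truncated_rotation:
  assumes "0 < a" shows "bounded_clinear (truncated_rotation a)"
proof -
  have "bounded_linear (truncated_rotation a)"
    using truncated_rotation_linear(2)[OF assms, of "complex_of_real r" for r]
    by (intro bounded_linear_intro[where K = 1])
      (auto simp: truncated_rotation_linear(1) assms scaleC_of_real norm_truncated_rotation_le)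
  then show ?thesis by (simp add: bounded_clinear_def truncated_rotation_linear(2) assms)
qed

lemma truncated_rotation_add:
  assumes "0 < a" "0 < b"
  shows "truncated_rotation a (truncated_rotation b x) = truncated_rotation (a + b) x"
proof (cases x rule: circle_L2_cases)
  case (1 f)
  then show ?thesis
    using assms by (simp add: truncated_rotation_abs cut_rotate_sqint cut_rotate_cut_rotate)
qed

lemma truncated_rotation_full_turn: "truncated_rotation (2 * pi) x = 0"
proof (cases x rule: circle_L2_cases)
  case (1 f)
  moreover have "\<not> 2 * pi < Arg2pi z" for z using Arg2pi_lt_2pi[of z] by simp
  then have "cut_rotate (2 * pi) f = (\<lambda>_. 0)" by (simp add: cut_rotate_def fun_eq_iff)
  ultimately show ?thesis by (simp add: truncated_rotation_abs zero_circle_L2.abs_eq)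
qed

lemma nn_integral_Arg2pi_le:
  assumes "0 < a"
  shows "(\<integral>\<^sup>+z. indicator {z. Arg2pi z \<le> a} z \<partial>circle_measure) \<le> ennreal a"
proof -
  have [measurable]: "{z. Arg2pi z \<le> a} \<in> sets borel" using closed_Arg2pi2pi_le by simp
  have "(\<integral>\<^sup>+z. indicator {z. Arg2pi z \<le> a} z \<partial>circle_measure)
      = (\<integral>\<^sup>+x. indicator {z. Arg2pi z \<le> a} (cis x) * indicator {0..2*pi} x \<partial>lborel) / ennreal (2 * pi)"
    by (rule nn_integral_circle_measure) simp
  also have "\<dots> \<le> (\<integral>\<^sup>+x. indicator ({0..a} \<union> {2*pi}) x \<partial>lborel) / ennreal (2 * pi)"
  proof (intro divide_right_mono_ennreal nn_integral_mono)
    fix x :: real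
    show "indicator {z. Arg2pi z \<le> a} (cis x) * indicator {0..2*pi} x \<le> (indicator ({0..a} \<union> {2*pi}) x :: ennreal)"
    proof (cases "0 \<le> x \<and> x < 2 * pi")
      case True
      then have "Arg2pi (cis x) = x" by (simp add: cis_conv_exp Arg2pi_exp)
      then show ?thesis by (auto split: split_indicator)
    qed (auto split: split_indicator)
  qed
  also have "(\<integral>\<^sup>+x. indicator ({0..a} \<union> {2*pi}) x \<partial>lborel) \<le> ennreal a"
    using emeasure_subadditive[of "{0..a}" lborel "{2*pi}"] assms by simp
  also have "ennreal a / ennreal (2 * pi) \<le> ennreal a"
    using assms pi_ge_two by (simp add: divide_ennreal divide_le_eq)
  finally show ?thesis by (simp add: divide_right_mono_ennreal)
qed

text \<open>Outside the arc of length \<open>a\<close> that is cut off, the rotated character differs from the original by the constant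
  factor \<open>e^(-ina)\<close>; on the arc the difference has modulus \<open>1\<close>.\<close>

lemma truncated_rotation_character_tendsto:
  "((\<lambda>a. truncated_rotation a (character n)) \<longlongrightarrow> character n) (at_right 0)"
proof (rule LIM_zero_cancel, rule Lim_null_comparison)
  let ?b = "\<lambda>a. sqrt ((cmod (cis (of_int n * (- a)) - 1))\<^sup>2 + a)"
  show "(?b \<longlongrightarrow> 0) (at_right 0)"
  proof -
    have "continuous_on UNIV ?b" by (intro continuous_intros)
    then have "isCont ?b 0" by (simp add: continuous_on_eq_continuous_at)
    then have "(?b \<longlongrightarrow> ?b 0) (at 0)" by (simp add: isCont_def)
    then show ?thesis by (simp add: filterlim_at_split)
  qed
  have "norm (truncated_rotation a (character n) - character n) \<le> ?b a" if a: "0 < a" for a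
  proof -
    let ?e = "\<lambda>z::complex. z powi n"
    let ?c = "cmod (cis (of_int n * (- a)) - 1)"
    have [measurable]: "{z. Arg2pi z \<le> a} \<in> sets borel" using closed_Arg2pi2pi_le by simp
    have eq: "truncated_rotation a (character n) - character n = abs_circle_L2 (\<lambda>z. cut_rotate a ?e z - ?e z)"
      using a by (simp add: character_def truncated_rotation_abs circle_sqint_powi circle_L2_operations cut_rotate_sqint)
    have "(\<integral>\<^sup>+z. ennreal ((cmod (cut_rotate a ?e z - ?e z))\<^sup>2) \<partial>circle_measure)
        \<le> (\<integral>\<^sup>+z. ennreal (?c\<^sup>2) + indicator {z. Arg2pi z \<le> a} z \<partial>circle_measure)"
    proof (rule nn_integral_mono_AE)
      show "AE z in circle_measure. ennreal ((cmod (cut_rotate a ?e z - ?e z))\<^sup>2)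
          \<le> ennreal (?c\<^sup>2) + indicator {z. Arg2pi z \<le> a} z"
        using AE_circle_norm
      proof eventually_elim
        case (elim z)
        show ?case
        proof (cases "a < Arg2pi z")
          case True
          have "cut_rotate a ?e z - ?e z = z powi n * (cis (of_int n * (- a)) - 1)"
            using True by (simp add: cut_rotate_def power_int_mult_distrib cis_power_int algebra_simps)
          then have "cmod (cut_rotate a ?e z - ?e z) = ?c"
            using elim by (simp add: norm_mult norm_power_int)
          then show ?thesis by simp
        next
          case False
          then have "ennreal ((cmod (cut_rotate a ?e z - ?e z))\<^sup>2) = 1"
            using elim by (simp add: cut_rotate_def norm_power_int)
          then show ?thesis using False by simp
        qed
      qed
    qed
    also have "\<dots> = ennreal (?c\<^sup>2) * emeasure circle_measure UNIV
        + (\<integral>\<^sup>+z. indicator {z. Arg2pi z \<le> a} z \<partial>circle_measure)"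
      by (subst nn_integral_add) auto
    also have "\<dots> \<le> ennreal (?c\<^sup>2) + ennreal a"
      using nn_integral_Arg2pi_le[OF a] by (simp add: circle.emeasure_eq_measure measure_circle)
    also have "\<dots> = ennreal ((?b a)\<^sup>2)" using a by (simp flip: ennreal_plus)
    finally show ?thesis
      unfolding eq using a by (intro norm_circle_L2_le circle_sqint_diff cut_rotate_sqint circle_sqint_powi) auto
  qed
  then show "\<forall>\<^sub>F a in at_right 0. norm (truncated_rotation a (character n) - character n) \<le> ?b a"
    by (intro eventually_at_rightI[of 0 1]) auto
qed

lemma truncated_rotation_tendsto:
  "((\<lambda>a. truncated_rotation a x) \<longlongrightarrow> x) (at_right 0)"
proof -
  let ?D = "{x. ((\<lambda>a. truncated_rotation a x) \<longlongrightarrow> x) (at_right 0)}"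
  have scale: "c *\<^sub>C x \<in> ?D" if "x \<in> ?D" for c x
  proof -
    have "((\<lambda>a. c *\<^sub>C truncated_rotation a x) \<longlongrightarrow> c *\<^sub>C x) (at_right 0)"
      using that by (auto intro: bounded_linear.tendsto[OF bounded_linear_scaleC])
    moreover have "\<forall>\<^sub>F a in at_right 0. c *\<^sub>C truncated_rotation a x = truncated_rotation a (c *\<^sub>C x)"
      by (rule eventually_at_rightI[of 0 1]) (auto simp: truncated_rotation_linear)
    ultimately show ?thesis by (auto elim: Lim_transform_eventually)
  qed
  have "?D = UNIV"
  proof (rule closed_subspace_eq_UNIV)
    have lin: "bounded_linear (truncated_rotation a)" if "0 < a" for a
      using bounded_clinear_truncated_rotation[OF that] by (simp add: bounded_clinear_def)
    show "subspace ?D" "closed ?D"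
      using strong_limit_subspace[of truncated_rotation 1] lin norm_truncated_rotation_le by simp_all
    fix y assume y: "\<And>z. z \<in> ?D \<Longrightarrow> inner y z = 0"
    have "character n \<in> ?D" for n using truncated_rotation_character_tendsto by simp
    then have "cinner y (character n) = 0" for n
      using y scale by (simp add: cinner_eq_inner complex_eq_iff)
    then show "y = 0" by (intro fourier_uniqueness) (simp add: fourier_coeff_eq_cinner)
  qed
  then show ?thesis by blast
qed

text \<open>The truncated rotations by \<open>2 \<pi> t\<close>, transported to the Hardy space: after a full turn nothing is left.\<close>

theorem zero_C0_embeddable: "C0_embeddable (\<lambda>_. 0 :: hardy2)"
proof -
  obtain U :: "circle_L2 \<Rightarrow> hardy2" and V :: "hardy2 \<Rightarrow> circle_L2"
    where U: "bounded_clinear U" and V: "bounded_clinear V"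
      and UV: "\<And>x. U (V x) = x" and VU: "\<And>x. V (U x) = x"
    using hardy2_isomorphic_L2 by blast
  define S where "S t x = U (truncated_rotation (2 * pi * t) (V x))" for t x
  have "C0_semigroup S"
    unfolding C0_semigroup_def
  proof (intro conjI allI impI)
    fix t :: real assume t: "0 < t"
    show "bounded_clinear (S t)"
      unfolding S_def[abs_def] using t
      by (intro bounded_clinear_compose[OF U] bounded_clinear_compose[OF _ V]
          bounded_clinear_truncated_rotation) simp
    fix s :: real assume s: "0 < s"
    show "S t \<circ> S s = S (t + s)"
      using t s by (simp add: fun_eq_iff S_def VU truncated_rotation_add distrib_left)
  next
    fix x
    have "filterlim (\<lambda>t. 2 * pi * t) (at_right 0) (at_right 0)"
      unfolding filterlim_at
      by (auto intro!: tendsto_eq_intros eventually_at_rightI[of 0 1])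
    then have "((\<lambda>t. truncated_rotation (2 * pi * t) (V x)) \<longlongrightarrow> V x) (at_right 0)"
      by (rule filterlim_compose[OF truncated_rotation_tendsto])
    then have "((\<lambda>t. S t x) \<longlongrightarrow> U (V x)) (at_right 0)"
      using bounded_linear.tendsto[of U] U unfolding S_def bounded_clinear_def by blast
    then show "((\<lambda>t. norm (S t x - x)) \<longlongrightarrow> 0) (at_right 0)"
      unfolding UV by (intro tendsto_norm_zero LIM_zero)
  qed
  moreover have "S 1 = (\<lambda>_. 0)"
    using U by (auto simp: S_def truncated_rotation_full_turn bounded_clinear_def
        linear_0[OF bounded_linear.linear])
  ultimately show ?thesis unfolding C0_embeddable_def by blast
qed

section \<open>Embedding Toeplitz operators\<close>

theorem theoremE:
  fixes F :: "complex \<Rightarrow> complex"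
  assumes "F \<in> circle_Linf"
    and "0 \<notin> interior (numerical_range (toeplitz F))"
  shows "C0_embeddable (toeplitz F)"
proof (cases "AE z in circle_measure. F z = 0")
  case True
  have "circle_mult F x = 0" for x
  proof (cases x rule: circle_L2_cases)
    case (1 f)
    have "AE z in circle_measure. F z * f z = 0" using True by eventually_elim simp
    then show ?thesis
      using assms(1) 1 by (simp add: circle_mult_abs zero_circle_L2.abs_eq abs_circle_L2_eq
          circle_sqint_mult circle_sqint_zero)
  qed
  then have "toeplitz F = (\<lambda>_. 0)" by (intro ext cinner_ext) (simp add: cinner_toeplitz)
  then show ?thesis using zero_C0_embeddable by simp
next
  case False
  have T: "bounded_clinear (toeplitz F)" using assms(1) by (rule bounded_clinear_toeplitz)
  obtain c where c: "cmod c = 1" and half: "\<And>w. w \<in> numerical_range (toeplitz F) \<Longrightarrow> 0 \<le> Re (c * w)"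
    using convex_in_half_plane[OF convex_numerical_range[OF T] assms(2)] by blast
  \<comment> \<open>The numerical range only sees unit vectors; other vectors follow by homogeneity.\<close>
  have acc: "0 \<le> Re (c * cinner (toeplitz F x) x)" for x
  proof (cases "x = 0")
    case nz: False
    define u where "u = complex_of_real (inverse (norm x)) *\<^sub>C x"
    have x: "x = complex_of_real (norm x) *\<^sub>C u" using nz by (simp add: u_def scaleC_scaleC flip: of_real_mult)
    have "norm u = 1" using nz by (simp add: u_def norm_scaleC norm_inverse)
    then have "0 \<le> Re (c * cinner (toeplitz F u) u)" by (intro half) (auto simp: numerical_range_def)
    moreover have "toeplitz F x = complex_of_real (norm x) *\<^sub>C toeplitz F u"
      using T by (subst x) (simp add: bounded_clinear_def)
    then have "cinner (toeplitz F x) x = complex_of_real ((norm x)\<^sup>2) * cinner (toeplitz F u) u"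
      by (subst (2) x) (simp add: cinner_scaleC_left cinner_scaleC_right power2_eq_square)
    then have "Re (c * cinner (toeplitz F x) x) = (norm x)\<^sup>2 * Re (c * cinner (toeplitz F u) u)"
      by (simp add: mult.left_commute[of c] flip: of_real_power)
    ultimately show ?thesis by simp
  qed simp
  let ?A = "\<lambda>x. c *\<^sub>C toeplitz F x"
  have "c \<noteq> 0" using c by auto
  have "bounded_clinear ?A"
    using T bounded_linear_compose[OF bounded_linear_scaleC]
    by (auto simp: bounded_clinear_def scaleC_scaleC mult.commute)
  moreover have "0 \<le> Re (cinner (?A x) x)" for x using acc by (simp add: cinner_scaleC_left)
  moreover have "closure (range ?A) = UNIV"
    by (rule dense_range_accretive_toeplitz[OF assms(1) False \<open>c \<noteq> 0\<close> acc])
  ultimately have "C0_embeddable ?A"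
    unfolding C0_embeddable_def by (rule accretive_C0_embeddable)
  then have "C0_embeddable (\<lambda>x. cnj c *\<^sub>C ?A x)"
    by (rule C0_embeddable_unimodular) (simp add: c)
  moreover have "cnj c * c = 1" using c by (metis complex_norm_square mult.commute of_real_1 power_one)
  ultimately show ?thesis by (simp add: scaleC_scaleC)
qed

end
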